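(* Let $n\ge3$ and let $\sigma_n$ be the constant described in the context. There exist positive constants $\lambda_n$ and $C_n$ depending only on $n$ with the following property. Let $\Omega\subset\mathbb{R}^n$ be a bounded domain with $0\in\partial\Omega$ satisfying the exterior ball condition $B_\rho(-\rho e_n)\subset\mathbb{R}^n\setminus\overline{\Omega}$ for some $\rho>0$, and let $D=\sup_{x\in\Omega}|x|$. If $\rho<D/\sigma_n$, then $$\int_\Omega|\nabla u|^2dx+\frac{\lambda_n}{\rho^2}\int_\Omega u^2dx\ \ge\ \frac{n^2}{4}\int_\Omega\frac{u^2}{|x|^2}dx+C_n\Big(\int_\Omega X_1^{\frac{2n-2}{n-2}}|u|^{\frac{2n}{n-2}}dx\Big)^{\frac{n-2}{n}}\qquad\text{for all }u\in C_c^\infty(\Omega),$$ where $X_1=X_1(|x|/(3D))$. If in addition $\Omega$ satisfies an interior ball condition at $0$, then the constant $n^2/4$ and the exponent $\frac{2n-2}{n-2}$ of $X_1$ are sharp: the constant $n^2/4$ cannot be replaced by any larger constant, and the exponent $\frac{2n-2}{n-2}$ cannot be replaced by any smaller number (whatever positive constant is put in place of $C_n$).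
   Context: $B_r(x_0)$ is the open ball of radius $r$ centered at $x_0$; $e_n$ is the unit vector in the $x_n$ direction. Interior ball condition at $0$: there exists an open ball $B\subset\Omega$ with $0\in\partial B$. $X_1(t)=\frac1{1-\ln t}$ for $t\in(0,1)$. The constant $\sigma_n$ is a fixed positive constant depending only on $n$ with the following property (such a constant exists by another theorem of the paper): there is $C>0$ depending only on $n$ such that, whenever $\Omega$ is a bounded domain with $0\in\partial\Omega$, $B_\rho(-\rho e_n)\subset\mathbb{R}^n\setminus\overline\Omega$, $D=\sup_\Omega|x|$ and $\rho\ge D/\sigma_n$, one has $\int_\Omega|\nabla u|^2dx\ge\frac{n^2}{4}\int_\Omega\frac{u^2}{|x|^2}dx+C\big(\int_\Omega X_1^{\frac{2n-2}{n-2}}(|x|/(3D))|u|^{\frac{2n}{n-2}}dx\big)^{\frac{n-2}{n}}$ for all $u\in C_c^\infty(\Omega)$. *)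

theory Defs
  imports "HOL-Analysis.Analysis"
begin

definition X1 :: "real \<Rightarrow> real" where
  "X1 t = 1 / (1 - ln t)"

text \<open>The coordinates of \<open>real ^ 'n\<close> are ordered by the order on \<open>'n\<close>; the last one plays the
  role of \<open>x\<^sub>n\<close>.\<close>

definition e_last :: "real ^ 'n::{finite,linorder}" where
  "e_last = axis (Max UNIV) 1"

definition partial_deriv :: "'n \<Rightarrow> (real ^ 'n \<Rightarrow> real) \<Rightarrow> real ^ 'n \<Rightarrow> real" where
  "partial_deriv i u x = frechet_derivative u (at x) (axis i 1)"

definition grad :: "(real ^ 'n \<Rightarrow> real) \<Rightarrow> real ^ 'n \<Rightarrow> real ^ 'n" where
  "grad u x = (\<chi> i. partial_deriv i u x)"

primrec C_k :: "nat \<Rightarrow> (real ^ 'n \<Rightarrow> real) \<Rightarrow> bool" where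
  "C_k 0 u \<longleftrightarrow> continuous_on UNIV u"
| "C_k (Suc k) u \<longleftrightarrow> (\<forall>x. u differentiable (at x)) \<and> (\<forall>i. C_k k (partial_deriv i u))"

text \<open>Elements of \<open>C_c\<^sup>\<infinity>(\<Omega>)\<close> are represented by their extension by zero to the whole space.\<close>

definition test_functions :: "(real ^ 'n) set \<Rightarrow> (real ^ 'n \<Rightarrow> real) set" where
  "test_functions \<Omega> =
     {u. (\<forall>k. C_k k u) \<and> compact (closure {x. u x \<noteq> 0}) \<and> closure {x. u x \<noteq> 0} \<subseteq> \<Omega>}"

definition sup_norm_on :: "(real ^ 'n) set \<Rightarrow> real" where
  "sup_norm_on \<Omega> = (SUP x\<in>\<Omega>. norm x)"

definition bounded_domain :: "(real ^ 'n) set \<Rightarrow> bool" where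
  "bounded_domain \<Omega> \<longleftrightarrow> open \<Omega> \<and> connected \<Omega> \<and> \<Omega> \<noteq> {} \<and> bounded \<Omega>"

definition exterior_ball_at_0 :: "(real ^ 'n::{finite,linorder}) set \<Rightarrow> real \<Rightarrow> bool" where
  "exterior_ball_at_0 \<Omega> \<rho> \<longleftrightarrow> ball (- \<rho> *\<^sub>R e_last) \<rho> \<subseteq> UNIV - closure \<Omega>"

definition interior_ball_at_0 :: "(real ^ 'n) set \<Rightarrow> bool" where
  "interior_ball_at_0 \<Omega> \<longleftrightarrow> (\<exists>y r. r > 0 \<and> ball y r \<subseteq> \<Omega> \<and> 0 \<in> frontier (ball y r))"

text \<open>The inequality, for all test functions on \<open>\<Omega>\<close>, with coefficient \<open>\<mu>\<close> of the \<open>L\<^sup>2\<close> term, Hardy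
  constant \<open>c\<close>, exponent \<open>p\<close> of the logarithmic weight and Sobolev constant \<open>C\<close>. Since \<open>0 \<notin> \<Omega>\<close> in
  all uses, every integrand is continuous with compact support in \<open>\<Omega>\<close>, hence integrable.\<close>

definition hardy_sobolev_ineq ::
  "(real ^ 'n) set \<Rightarrow> real \<Rightarrow> real \<Rightarrow> real \<Rightarrow> real \<Rightarrow> bool" where
  "hardy_sobolev_ineq \<Omega> \<mu> c p C \<longleftrightarrow>
    (let n = real CARD('n); D = sup_norm_on \<Omega> in
      \<forall>u \<in> test_functions \<Omega>.
        (LINT x:\<Omega>|lborel. (norm (grad u x))\<^sup>2) + \<mu> * (LINT x:\<Omega>|lborel. (u x)\<^sup>2)
        \<ge> c * (LINT x:\<Omega>|lborel. (u x)\<^sup>2 / (norm x)\<^sup>2)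
          + C * (LINT x:\<Omega>|lborel. X1 (norm x / (3 * D)) powr p * \<bar>u x\<bar> powr (2 * n / (n - 2)))
                  powr ((n - 2) / n))"

end

theory Submission
  imports Defs "HOL-Computational_Algebra.Polynomial"
begin

text \<open>
  \<^bold>\<open>The inequality.\<close> The assumption provides the inequality on domains that are small compared with
  the exterior ball. Let \<open>R = min \<sigma> 1 * \<rho>\<close> and split a test function \<open>u\<close> into \<open>cos \<theta> * u\<close> and
  \<open>sin \<theta> * u\<close>, where the angle \<open>\<theta>\<close> rises from \<open>0\<close> to \<open>\<pi>/2\<close> between the spheres of radius \<open>R/2\<close> and
  \<open>R\<close>. As \<open>cos\<^sup>2 + sin\<^sup>2 = 1\<close>, the mixed terms cancel, and the gradient energies of the pieces add up
  to that of \<open>u\<close> up to \<open>u\<^sup>2 |\<nabla>\<theta>|\<^sup>2 = O(u\<^sup>2 / R\<^sup>2)\<close> (lemma \<open>ims_pointwise\<close>); this error and the Hardy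
  integral away from the origin are what the term \<open>lam / \<rho>\<^sup>2\<close> pays for. The inner piece lives in a ball
  of radius \<open>R\<close> minus the closed exterior ball, a domain to which the assumption applies
  (\<open>cap_domain\<close>). The outer piece only needs the Sobolev inequality on the whole space, and that is
  itself a consequence of the assumption: translate the function far into a large half ball, where
  the weight \<open>X1\<close> is bounded below (\<open>sobolev_from_domain_inequality\<close>).

  \<^bold>\<open>Sharpness.\<close> The interior ball is tangent to the exterior one, so it is the ball about \<open>r e\<close> of
  radius \<open>r\<close>, with \<open>e\<close> the last unit vector. The function \<open>\<Phi> x = (x \<bullet> e) |x|\<^bsup>-n/2\<^esup>\<close> solves
  \<open>- \<Delta>\<Phi> = n\<^sup>2/4 \<Phi>/|x|\<^sup>2\<close>, so for \<open>u = \<Phi> v\<close> the energy exceeds \<open>n\<^sup>2/4\<close> times the Hardy integral exactly by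
  the integral of \<open>\<Phi>\<^sup>2 |\<nabla>v|\<^sup>2\<close> (\<open>ground_state_representation\<close>). Let \<open>v\<close> be a cutoff in \<open>ln |x|\<close> that
  lives on \<open>2\<^bsup>-6k\<^esup> \<le> |x| \<le> 2\<^bsup>-3k\<^esup>\<close>. All integrals in question are scale invariant, so each of the
  about \<open>k\<close> dyadic shells contributes the same amount; since \<open>|\<nabla>v| = O(1/(k|x|))\<close>, the remainder is
  \<open>O(1/k)\<close>, while the Hardy integral is at least of order \<open>k\<close> and the weighted integral at least of order
  \<open>k * k powr (-p)\<close>, because \<open>X1\<close> is of order \<open>1/k\<close> there (\<open>concentrating_family\<close>). Cutting \<open>v\<close> off
  along the boundary of the interior ball costs only an exponentially small energy, as \<open>\<Phi>\<close> vanishes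
  to first order on the tangent plane. Comparing powers of \<open>k\<close> gives both optimality claims.
\<close>

section \<open>Smooth functions on open sets\<close>

text \<open>The predicate \<open>C_k\<close> relative to a set. The powers of \<open>|x|\<close> used below are smooth only away from
  the origin, so a local notion is needed before multiplying by a cutoff.\<close>

primrec C_k_on :: "nat \<Rightarrow> (real ^ 'n) set \<Rightarrow> (real ^ 'n \<Rightarrow> real) \<Rightarrow> bool" where
  "C_k_on 0 S u \<longleftrightarrow> continuous_on S u"
| "C_k_on (Suc k) S u \<longleftrightarrow>
     (\<forall>x\<in>S. u differentiable (at x)) \<and> (\<forall>i. C_k_on k S (partial_deriv i u))"

definition smooth_on :: "(real ^ 'n) set \<Rightarrow> (real ^ 'n \<Rightarrow> real) \<Rightarrow> bool" where
  "smooth_on S u \<longleftrightarrow> (\<forall>k. C_k_on k S u)"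

text \<open>Smoothness in one variable is witnessed by the whole sequence of derivatives; this is the form in
  which it enters the induction for compositions.\<close>

definition smooth_real_on :: "real set \<Rightarrow> (real \<Rightarrow> real) \<Rightarrow> bool" where
  "smooth_real_on T h \<longleftrightarrow>
     (\<exists>H. H 0 = h \<and> (\<forall>j. \<forall>t\<in>T. (H j has_real_derivative H (Suc j) t) (at t)))"

lemma grad_nth [simp]: "grad u x $ i = partial_deriv i u x"
  by (simp add: grad_def)

text \<open>This links the coordinatewise gradient to the library's calculus of gradients.\<close>

lemma GDERIV_grad:
  assumes "u differentiable (at x)"
  shows "GDERIV u x :> grad u x"
proof -
  have d: "(u has_derivative frechet_derivative u (at x)) (at x)"
    using assms frechet_derivative_works by blast
  then have lin: "linear (frechet_derivative u (at x))"
    by (rule has_derivative_linear)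
  have "frechet_derivative u (at x) h = h \<bullet> grad u x" for h
  proof -
    have "frechet_derivative u (at x) h
        = frechet_derivative u (at x) (\<Sum>i\<in>UNIV. (h $ i) *\<^sub>R axis i 1)"
      by (simp add: basis_expansion flip: scalar_mult_eq_scaleR)
    also have "\<dots> = (\<Sum>i\<in>UNIV. (h $ i) * frechet_derivative u (at x) (axis i 1))"
      by (simp add: linear_sum[OF lin] linear_scale[OF lin])
    finally show ?thesis
      by (simp add: inner_vec_def partial_deriv_def)
  qed
  then have "frechet_derivative u (at x) = (\<lambda>h. h \<bullet> grad u x)"
    by (rule ext)
  then show ?thesis
    using d by (simp add: gderiv_def)
qed

lemma grad_eqI:
  assumes "GDERIV u x :> g"
  shows "grad u x = g"
proof -
  have "frechet_derivative u (at x) = (\<lambda>h. h \<bullet> g)"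
    using assms by (metis frechet_derivative_at gderiv_def)
  then show ?thesis
    by (simp add: grad_def partial_deriv_def vec_eq_iff inner_axis')
qed

lemma GDERIV_differentiable: "GDERIV u x :> g \<Longrightarrow> u differentiable (at x)"
  unfolding gderiv_def by (rule differentiableI)

lemma GDERIV_cong_open:
  assumes "open S" "x \<in> S" "\<And>y. y \<in> S \<Longrightarrow> u y = w y" "GDERIV u x :> g"
  shows "GDERIV w x :> g"
  using has_derivative_transform_within_open[of u "\<lambda>h. h \<bullet> g" x UNIV S w] assms
  by (simp add: gderiv_def)

lemma partial_deriv_cong_open:
  assumes "open S" "x \<in> S" "\<And>y. y \<in> S \<Longrightarrow> u y = w y" "u differentiable (at x)"
  shows "w differentiable (at x)" "partial_deriv i w x = partial_deriv i u x"
  using GDERIV_cong_open[OF assms(1,2,3) GDERIV_grad[OF assms(4)]]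
  by (auto dest: GDERIV_differentiable grad_eqI simp flip: grad_nth)

lemma C_k_on_cong:
  assumes "open S" "\<And>x. x \<in> S \<Longrightarrow> u x = w x" "C_k_on k S u"
  shows "C_k_on k S w"
  using assms(2,3)
proof (induction k arbitrary: u w)
  case 0
  then show ?case by (auto cong: continuous_on_cong)
next
  case (Suc k)
  have "C_k_on k S (partial_deriv i w)" for i
    by (rule Suc.IH[where u = "partial_deriv i u"])
      (use Suc.prems partial_deriv_cong_open[OF \<open>open S\<close>, of _ u w] in auto)
  then show ?case
    using Suc.prems partial_deriv_cong_open[OF \<open>open S\<close>, of _ u w] by auto
qed

lemma smooth_on_cong:
  assumes "open S" "\<And>x. x \<in> S \<Longrightarrow> u x = w x" "smooth_on S u"
  shows "smooth_on S w"
  using assms C_k_on_cong unfolding smooth_on_def by blast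

lemma C_k_on_Suc: "C_k_on (Suc k) S u \<Longrightarrow> C_k_on k S u"
proof (induction k arbitrary: u)
  case 0
  then show ?case
    by (auto intro!: continuous_at_imp_continuous_on differentiable_imp_continuous_within)
next
  case (Suc k)
  then show ?case by (metis C_k_on.simps(2))
qed

lemma smooth_on_differentiable: "smooth_on S u \<Longrightarrow> x \<in> S \<Longrightarrow> u differentiable (at x)"
  unfolding smooth_on_def by (metis C_k_on.simps(2))

lemma smooth_on_GDERIV: "smooth_on S u \<Longrightarrow> x \<in> S \<Longrightarrow> GDERIV u x :> grad u x"
  by (intro GDERIV_grad smooth_on_differentiable)

lemma smooth_on_partial_deriv: "smooth_on S u \<Longrightarrow> smooth_on S (partial_deriv i u)"
  unfolding smooth_on_def by (metis C_k_on.simps(2))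

lemma smooth_on_continuous_on: "smooth_on S u \<Longrightarrow> continuous_on S u"
  unfolding smooth_on_def by (metis C_k_on.simps(1))

lemma smooth_on_subset: 
  assumes "smooth_on S u" "T \<subseteq> S"
  shows "smooth_on T u"
proof -
  have "C_k_on k S u \<Longrightarrow> C_k_on k T u" for k
    by (induction k arbitrary: u) (use \<open>T \<subseteq> S\<close> continuous_on_subset in auto)
  then show ?thesis using assms by (simp add: smooth_on_def)
qed

lemma smooth_on_Un:
  assumes "open S" "open T" "smooth_on S u" "smooth_on T u"
  shows "smooth_on (S \<union> T) u"
proof -
  have "C_k_on k S u \<Longrightarrow> C_k_on k T u \<Longrightarrow> C_k_on k (S \<union> T) u" for k
    by (induction k arbitrary: u) (use assms continuous_on_open_Un in auto)
  then show ?thesis using assms by (simp add: smooth_on_def)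
qed

lemma smooth_on_UNIV: "smooth_on UNIV u \<longleftrightarrow> (\<forall>k. C_k k u)"
proof -
  have "C_k_on k UNIV u = C_k k u" for k
    by (induction k arbitrary: u) auto
  then show ?thesis by (simp add: smooth_on_def)
qed

lemma C_k_on_const: "C_k_on k S (\<lambda>_. c)"
proof (induction k arbitrary: c)
  case (Suc k)
  have "partial_deriv i (\<lambda>_. c) = (\<lambda>_. 0)" for i :: 'a
    using grad_eqI[OF GDERIV_const[where k = c]] by (metis grad_nth zero_index)
  then show ?case using Suc by simp
qed simp

lemma smooth_on_const [simp]: "smooth_on S (\<lambda>_. c)"
  by (simp add: smooth_on_def C_k_on_const)

lemma GDERIV_nth: "GDERIV (\<lambda>x. x $ m) x :> axis m 1"
  unfolding gderiv_def inner_axis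
  using bounded_linear.has_derivative[OF bounded_linear_vec_nth has_derivative_ident, of m "at x"]
  by simp

lemma smooth_on_nth [simp]: "smooth_on S (\<lambda>x. x $ m)"
proof -
  have "C_k_on k S (\<lambda>x. x $ m)" for k
  proof (cases k)
    case 0
    then show ?thesis by (auto intro!: continuous_intros)
  next
    case (Suc j)
    have "partial_deriv i (\<lambda>x. x $ m) = (\<lambda>_. axis m 1 $ i)" for i :: 'a
      using grad_eqI[OF GDERIV_nth[of m]] by (metis grad_nth)
    then show ?thesis
      using Suc C_k_on_const GDERIV_differentiable[OF GDERIV_nth] by auto
  qed
  then show ?thesis by (simp add: smooth_on_def)
qed

lemma C_k_on_add:
  assumes "open S" "C_k_on k S u" "C_k_on k S w"
  shows "C_k_on k S (\<lambda>x. u x + w x)"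
  using assms(2,3)
proof (induction k arbitrary: u w)
  case 0
  then show ?case by (auto intro!: continuous_intros)
next
  case (Suc k)
  have g: "GDERIV (\<lambda>x. u x + w x) x :> grad u x + grad w x" if "x \<in> S" for x
    using Suc.prems that by (intro GDERIV_add GDERIV_grad) auto
  have "C_k_on k S (\<lambda>x. partial_deriv i u x + partial_deriv i w x)" for i
    using Suc by simp
  then have "C_k_on k S (partial_deriv i (\<lambda>x. u x + w x))" for i
    by (rule C_k_on_cong[OF \<open>open S\<close>, rotated])
      (use grad_eqI[OF g] in \<open>auto simp flip: grad_nth\<close>)
  then show ?case using GDERIV_differentiable[OF g] by simp
qed

lemma C_k_on_mult:
  assumes "open S" "C_k_on k S u" "C_k_on k S w"
  shows "C_k_on k S (\<lambda>x. u x * w x)"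
  using assms(2,3)
proof (induction k arbitrary: u w)
  case 0
  then show ?case by (auto intro!: continuous_intros)
next
  case (Suc k)
  have g: "GDERIV (\<lambda>x. u x * w x) x :> u x *\<^sub>R grad w x + w x *\<^sub>R grad u x" if "x \<in> S" for x
    using Suc.prems that by (intro GDERIV_mult GDERIV_grad) auto
  have "C_k_on k S (\<lambda>x. u x * partial_deriv i w x + w x * partial_deriv i u x)" for i
    by (intro C_k_on_add[OF \<open>open S\<close>] Suc.IH)
      (use Suc.prems C_k_on_Suc[OF Suc.prems(1)] C_k_on_Suc[OF Suc.prems(2)] in auto)
  then have "C_k_on k S (partial_deriv i (\<lambda>x. u x * w x))" for i
    by (rule C_k_on_cong[OF \<open>open S\<close>, rotated]) 
      (use grad_eqI[OF g] in \<open>auto simp flip: grad_nth\<close>)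
  then show ?case using GDERIV_differentiable[OF g] by simp
qed

lemma smooth_on_add:
  "open S \<Longrightarrow> smooth_on S u \<Longrightarrow> smooth_on S w \<Longrightarrow> smooth_on S (\<lambda>x. u x + w x)"
  by (simp add: smooth_on_def C_k_on_add)

lemma smooth_on_mult:
  "open S \<Longrightarrow> smooth_on S u \<Longrightarrow> smooth_on S w \<Longrightarrow> smooth_on S (\<lambda>x. u x * w x)"
  by (simp add: smooth_on_def C_k_on_mult)

lemma smooth_on_norm_power2: "smooth_on S (\<lambda>x. (norm x)\<^sup>2)" if "open S"
proof -
  have "smooth_on S (\<lambda>x. \<Sum>i\<in>A. x $ i * x $ i)" if "finite A" for A
    using that by (induction A) (auto intro!: smooth_on_add smooth_on_mult \<open>open S\<close>)
  then show ?thesis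
    by (simp add: power2_norm_eq_inner inner_vec_def)
qed

text \<open>As \<open>\<partial>\<^sub>i (h \<circ> u) = (h' \<circ> u) \<partial>\<^sub>i u\<close>, the induction on the order of differentiability has to treat
  all derivatives of \<open>h\<close> at once.\<close>

lemma smooth_on_compose:
  assumes "open S" "smooth_on S u" "smooth_real_on T h" "\<And>x. x \<in> S \<Longrightarrow> u x \<in> T"
  shows "smooth_on S (\<lambda>x. h (u x))"
proof -
  obtain H where H: "H 0 = h" "\<And>j t. t \<in> T \<Longrightarrow> (H j has_real_derivative H (Suc j) t) (at t)"
    using assms(3) unfolding smooth_real_on_def by blast
  have g: "GDERIV (\<lambda>x. H j (u x)) x :> H (Suc j) (u x) *\<^sub>R grad u x" if "x \<in> S" for x j
    using that assms smooth_on_GDERIV H by (intro GDERIV_DERIV_compose) auto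
  have "smooth_on S (\<lambda>x. H j (u x))" for j
    unfolding smooth_on_def
  proof
    fix k
    show "C_k_on k S (\<lambda>x. H j (u x))"
    proof (induction k arbitrary: j)
      case 0
      have "(\<lambda>x. H j (u x)) differentiable (at x)" if "x \<in> S" for x
        using g that GDERIV_differentiable by blast
      then show ?case
        by (auto intro!: continuous_at_imp_continuous_on differentiable_imp_continuous_within)
    next
      case (Suc k)
      have "C_k_on k S (\<lambda>x. H (Suc j) (u x) * partial_deriv i u x)" for i
        using Suc smooth_on_partial_deriv[OF assms(2)] by (intro C_k_on_mult[OF \<open>open S\<close>]) (auto simp: smooth_on_def)
      then have "C_k_on k S (partial_deriv i (\<lambda>x. H j (u x)))" for i
        by (rule C_k_on_cong[OF \<open>open S\<close>, rotated]) 
          (use grad_eqI[OF g] in \<open>auto simp flip: grad_nth\<close>)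
      then show ?case using GDERIV_differentiable[OF g] by simp
    qed
  qed
  then show ?thesis using H(1) by metis
qed

section \<open>Functions of one variable and a smooth step\<close>

lemma smooth_real_onI:
  assumes "\<And>j t. t \<in> T \<Longrightarrow> (H j has_real_derivative H (Suc j) t) (at t)" "H 0 = h"
  shows "smooth_real_on T h"
  using assms unfolding smooth_real_on_def by blast

lemma smooth_real_on_antiderivative:
  assumes "smooth_real_on T h'" "\<And>t. t \<in> T \<Longrightarrow> (h has_real_derivative h' t) (at t)"
  shows "smooth_real_on T h"
proof -
  obtain H where "H 0 = h'" "\<And>j t. t \<in> T \<Longrightarrow> (H j has_real_derivative H (Suc j) t) (at t)"
    using assms(1) unfolding smooth_real_on_def by blast
  then show ?thesis
    by (intro smooth_real_onI[where H = "case_nat h H"]) (use assms(2) in \<open>auto split: nat.split\<close>)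
qed

lemma smooth_real_on_powr: "smooth_real_on {0<..} (\<lambda>t. t powr a)"
  by (rule smooth_real_onI[where H = "\<lambda>j t. (\<Prod>i<j. a - real i) * t powr (a - real j)"])
    (auto intro!: derivative_eq_intros simp: algebra_simps)

lemma smooth_real_on_ln: "smooth_real_on {0<..} ln"
  by (rule smooth_real_on_antiderivative[OF smooth_real_on_powr[of "-1"]])
    (auto intro!: derivative_eq_intros simp: powr_minus divide_inverse)

text \<open>The shift by \<open>c\<close> covers the cosine; each derivative is one more shift by \<open>\<pi>/2\<close>.\<close>

lemma smooth_real_on_sin_shift: "smooth_real_on T (\<lambda>t. sin (t + c))"
proof (rule smooth_real_onI[where H = "\<lambda>j t. sin (t + c + real j * pi / 2)"])
  fix j t
  have "sin (t + c + real (Suc j) * pi / 2) = cos (t + c + real j * pi / 2)"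
    using sin_add[of "t + c + real j * pi / 2" "pi / 2"] by (simp add: field_simps)
  then show "((\<lambda>t. sin (t + c + real j * pi / 2)) has_real_derivative
      sin (t + c + real (Suc j) * pi / 2)) (at t)"
    by (auto intro!: derivative_eq_intros)
qed auto

lemma smooth_real_on_sin: "smooth_real_on T sin"
  using smooth_real_on_sin_shift[of T 0] by simp

lemma smooth_real_on_cos: "smooth_real_on T cos"
  using smooth_real_on_sin_shift[of T "pi / 2"] by (simp add: sin_add)

text \<open>The derivative of \<open>p (1/t) exp (-1/t)\<close> is \<open>q (1/t) exp (-1/t)\<close> with \<open>q(s) = s\<^sup>2 (p(s) - p'(s))\<close>.\<close>

primrec flat_poly :: "nat \<Rightarrow> real poly" where
  "flat_poly 0 = 1"
| "flat_poly (Suc j) = [:0, 0, 1:] * (flat_poly j - pderiv (flat_poly j))"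

text \<open>The derivatives of the function that is \<open>exp (-1/t)\<close> for positive \<open>t\<close> and vanishes otherwise.\<close>

definition flat_exp :: "nat \<Rightarrow> real \<Rightarrow> real" where
  "flat_exp j t = (if t > 0 then poly (flat_poly j) (1 / t) * exp (- (1 / t)) else 0)"

lemma tendsto_poly_times_exp_minus: "((\<lambda>x::real. poly q x * exp (- x)) \<longlongrightarrow> 0) at_top"
proof -
  have "((\<lambda>x. \<Sum>i\<le>degree q. coeff q i * (x ^ i / exp x)) \<longlongrightarrow> (\<Sum>i\<le>degree q. coeff q i * 0)) at_top"
    by (intro tendsto_sum tendsto_mult tendsto_const tendsto_power_div_exp_0)
  then show ?thesis
    by (simp add: poly_altdef sum_distrib_right exp_minus divide_inverse mult.assoc)
qed

text \<open>At \<open>0\<close> the difference quotient from the right is again a polynomial in \<open>1/t\<close> times \<open>exp (-1/t)\<close>,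
  and the exponential wins.\<close>

lemma flat_exp_deriv: "(flat_exp j has_real_derivative flat_exp (Suc j) t) (at t)"
proof -
  consider "t > 0" | "t < 0" | "t = 0" by linarith
  then show ?thesis
  proof cases
    case 1
    have "((\<lambda>t. poly (flat_poly j) (1 / t) * exp (- (1 / t))) has_real_derivative
        flat_exp (Suc j) t) (at t)"
      using 1
      by (auto intro!: derivative_eq_intros DERIV_chain'[where g = "poly (flat_poly j)"] poly_DERIV
          simp: flat_exp_def field_simps power2_eq_square)
    then show ?thesis
      by (rule has_field_derivative_transform_within_open[where S = "{0<..}"])
        (use 1 in \<open>auto simp: flat_exp_def\<close>)
  next
    case 2
    have "((\<lambda>_. 0) has_real_derivative flat_exp (Suc j) t) (at t)"
      using 2 by (simp add: flat_exp_def)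
    then show ?thesis
      by (rule has_field_derivative_transform_within_open[where S = "{..<0}"])
        (use 2 in \<open>auto simp: flat_exp_def\<close>)
  next
    case 3
    have "((\<lambda>h. poly (pCons 0 (flat_poly j)) (inverse h) * exp (- inverse h)) \<longlongrightarrow> 0) (at_right 0)"
      using filterlim_compose[OF tendsto_poly_times_exp_minus filterlim_inverse_at_top_right] .
    then have "((\<lambda>h. flat_exp j h / h) \<longlongrightarrow> 0) (at_right 0)"
      by (rule Lim_transform_eventually)
        (auto simp: flat_exp_def eventually_at_right_less field_simps
           intro!: eventually_mono[OF eventually_at_right_less[of 0]])
    moreover have "((\<lambda>h. flat_exp j h / h) \<longlongrightarrow> 0) (at_left 0)"
      by (rule Lim_transform_eventually[OF tendsto_const])
        (auto simp: flat_exp_def eventually_at_filter)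
    ultimately have "((\<lambda>h. flat_exp j h / h) \<longlongrightarrow> 0) (at 0)"
      by (simp add: filterlim_at_split)
    then show ?thesis
      using 3 unfolding DERIV_def by (simp add: flat_exp_def)
  qed
qed

lemma smooth_real_on_flat_exp: "smooth_real_on T (flat_exp 0)"
  by (rule smooth_real_onI[where H = flat_exp]) (simp_all add: flat_exp_deriv)

lemma flat_exp_nonneg: "flat_exp 0 t \<ge> 0"
  by (simp add: flat_exp_def)

lemma flat_exp_pos: "t > 0 \<Longrightarrow> flat_exp 0 t > 0"
  by (simp add: flat_exp_def)

lemma flat_exp_eq_0: "t \<le> 0 \<Longrightarrow> flat_exp j t = 0"
  by (simp add: flat_exp_def)

definition smooth_step :: "real \<Rightarrow> real" where
  "smooth_step t = flat_exp 0 t / (flat_exp 0 t + flat_exp 0 (1 - t))"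

lemma smooth_step_denom: "flat_exp 0 t + flat_exp 0 (1 - t) > 0"
  using flat_exp_pos[of t] flat_exp_pos[of "1 - t"] flat_exp_nonneg[of t] flat_exp_nonneg[of "1 - t"]
  by linarith

lemma smooth_step_nonneg: "smooth_step t \<ge> 0"
  and smooth_step_le_1: "smooth_step t \<le> 1"
  using smooth_step_denom[of t] flat_exp_nonneg[of t] flat_exp_nonneg[of "1 - t"]
  by (auto simp: smooth_step_def)

lemma smooth_step_eq_0: "t \<le> 0 \<Longrightarrow> smooth_step t = 0"
  by (simp add: smooth_step_def flat_exp_eq_0)

lemma smooth_step_eq_1: "t \<ge> 1 \<Longrightarrow> smooth_step t = 1"
  using flat_exp_pos[of t] by (simp add: smooth_step_def flat_exp_eq_0)

text \<open>The quotient rule yields a continuous derivative that vanishes outside the compact interval from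
  \<open>0\<close> to \<open>1\<close>, hence a bounded one.\<close>

lemma smooth_step_bounded_derivative:
  "\<exists>S' K. \<forall>t. (smooth_step has_real_derivative S' t) (at t) \<and> \<bar>S' t\<bar> \<le> K
     \<and> (t < 0 \<or> t > 1 \<longrightarrow> S' t = 0)"
proof -
  define S' where "S' = (\<lambda>t. (flat_exp 1 t * (flat_exp 0 t + flat_exp 0 (1 - t))
     - flat_exp 0 t * (flat_exp 1 t - flat_exp 1 (1 - t))) / (flat_exp 0 t + flat_exp 0 (1 - t))\<^sup>2)"
  have cont: "continuous_on A (flat_exp j)" for A j
    by (intro continuous_at_imp_continuous_on ballI DERIV_isCont[OF flat_exp_deriv])
  have cont': "continuous_on A (\<lambda>t. flat_exp j (1 - t))" for A j
    by (rule continuous_on_compose2[OF cont[of UNIV]]) (auto intro!: continuous_intros)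
  have d0: "(flat_exp 0 has_real_derivative flat_exp 1 t) (at t)" for t
    using flat_exp_deriv[of 0 t] by simp
  have d1: "((\<lambda>t. flat_exp 0 (1 - t)) has_real_derivative - flat_exp 1 (1 - t)) (at t)" for t
  proof -
    have "((\<lambda>t. 1 - t) has_real_derivative - 1) (at t)"
      by (auto intro!: derivative_eq_intros)
    then show ?thesis using DERIV_chain2[OF d0] by fastforce
  qed
  have nz: "flat_exp 0 t + flat_exp 0 (1 - t) \<noteq> 0" for t
    using smooth_step_denom[of t] by simp
  have deriv: "(smooth_step has_real_derivative S' t) (at t)" for t
    unfolding smooth_step_def[abs_def] S'_def
    using DERIV_divide[OF d0 DERIV_add[OF d0 d1] nz] by (simp add: power2_eq_square)
  have "continuous_on {0..1} S'"
    unfolding S'_def by (intro continuous_intros cont cont') (use nz in auto)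
  then have "compact (S' ` {0..1})"
    by (intro compact_continuous_image) auto
  then obtain K where K: "\<And>t. t \<in> {0..1} \<Longrightarrow> \<bar>S' t\<bar> \<le> K"
    by (metis bounded_iff compact_imp_bounded image_eqI real_norm_def)
  have out: "S' t = 0" if "t < 0 \<or> t > 1" for t
    using that by (auto simp: S'_def flat_exp_eq_0)
  have "\<bar>S' t\<bar> \<le> K" for t
    using K[of t] K[of 0] out[of t] by (cases "t \<in> {0..1}") auto
  then show ?thesis
    using deriv out by blast
qed

section \<open>Compositions of smooth functions\<close>

lemma smooth_on_powr:
  "open S \<Longrightarrow> smooth_on S u \<Longrightarrow> (\<And>x. x \<in> S \<Longrightarrow> u x > 0) \<Longrightarrow> smooth_on S (\<lambda>x. u x powr a)"
  by (rule smooth_on_compose[OF _ _ smooth_real_on_powr]) auto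

lemma smooth_on_divide:
  assumes "open S" "smooth_on S u" "smooth_on S w" "\<And>x. x \<in> S \<Longrightarrow> w x > 0"
  shows "smooth_on S (\<lambda>x. u x / w x)"
  by (rule smooth_on_cong[OF \<open>open S\<close> _
        smooth_on_mult[OF \<open>open S\<close> \<open>smooth_on S u\<close> smooth_on_powr[where a = "- 1", OF assms(1,3,4)]]])
    (use assms(4) in \<open>auto simp: powr_minus divide_inverse less_imp_le\<close>)

lemma smooth_on_ln:
  "open S \<Longrightarrow> smooth_on S u \<Longrightarrow> (\<And>x. x \<in> S \<Longrightarrow> u x > 0) \<Longrightarrow> smooth_on S (\<lambda>x. ln (u x))"
  by (rule smooth_on_compose[OF _ _ smooth_real_on_ln]) auto

lemma smooth_on_diff:
  assumes "open S" "smooth_on S u" "smooth_on S w"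
  shows "smooth_on S (\<lambda>x. u x - w x)"
  using smooth_on_add[OF assms(1,2) smooth_on_mult[OF assms(1) smooth_on_const[of S "-1"] assms(3)]]
  by simp

lemma smooth_on_minus: "open S \<Longrightarrow> smooth_on S u \<Longrightarrow> smooth_on S (\<lambda>x. - u x)"
  using smooth_on_diff[of S "\<lambda>_. 0" u] by simp

lemma smooth_on_smooth_step:
  assumes "open S" "smooth_on S u"
  shows "smooth_on S (\<lambda>x. smooth_step (u x))"
proof -
  have f: "smooth_on S (\<lambda>x. flat_exp 0 (w x))" if "smooth_on S w" for w
    by (rule smooth_on_compose[OF \<open>open S\<close> that smooth_real_on_flat_exp[of UNIV]]) simp
  show ?thesis
    unfolding smooth_step_def
    by (intro smooth_on_divide f smooth_on_add smooth_on_diff assms smooth_on_const smooth_step_denom)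
qed

lemma GDERIV_translate:
  assumes "GDERIV u (x + a) :> g"
  shows "GDERIV (\<lambda>x. u (x + a)) x :> g"
proof -
  have "((\<lambda>x. x + a) has_derivative (\<lambda>h. h)) (at x)"
    by (auto intro!: derivative_eq_intros)
  from has_derivative_compose[OF this assms[unfolded gderiv_def]] show ?thesis
    by (simp add: gderiv_def)
qed

lemma grad_translate:
  assumes "u differentiable (at (x + a))"
  shows "grad (\<lambda>x. u (x + a)) x = grad u (x + a)"
  by (rule grad_eqI[OF GDERIV_translate[OF GDERIV_grad[OF assms]]])

lemma smooth_on_translate:
  assumes "smooth_on UNIV u"
  shows "smooth_on UNIV (\<lambda>x. u (x + a))"
proof -
  have "C_k_on k UNIV u \<Longrightarrow> C_k_on k UNIV (\<lambda>x. u (x + a))" for k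
  proof (induction k arbitrary: u)
    case 0
    then have "continuous_on UNIV u" by simp
    then show ?case
      by (auto intro!: continuous_on_compose2[of UNIV u UNIV "\<lambda>x. x + a"] continuous_intros)
  next
    case (Suc k)
    have d: "u differentiable (at x)" for x
      using Suc.prems by simp
    have "(\<lambda>x. u (x + a)) differentiable (at x)" for x
      using GDERIV_differentiable[OF GDERIV_translate[OF GDERIV_grad[OF d]]] .
    moreover have "partial_deriv i (\<lambda>x. u (x + a)) = (\<lambda>x. partial_deriv i u (x + a))" for i
      using grad_translate[OF d] by (metis grad_nth)
    ultimately show ?case
      using Suc by simp
  qed
  then show ?thesis
    using assms by (simp add: smooth_on_def)
qed

section \<open>Test functions\<close>

definition supp :: "(real ^ 'n \<Rightarrow> real) \<Rightarrow> (real ^ 'n) set" where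
  "supp u = closure {x. u x \<noteq> 0}"

lemma not_in_supp: "x \<notin> supp u \<Longrightarrow> u x = 0"
  using closure_subset[of "{x. u x \<noteq> 0}"] by (auto simp: supp_def)

lemma closed_supp [simp]: "closed (supp u)"
  by (simp add: supp_def)

lemma test_functions_iff:
  "u \<in> test_functions \<Omega> \<longleftrightarrow> smooth_on UNIV u \<and> compact (supp u) \<and> supp u \<subseteq> \<Omega>"
  by (simp add: test_functions_def supp_def smooth_on_UNIV)

lemma test_functionsI:
  assumes "smooth_on UNIV u" "compact K" "K \<subseteq> \<Omega>" "\<And>x. x \<notin> K \<Longrightarrow> u x = 0"
  shows "u \<in> test_functions \<Omega>"
proof -
  have "supp u \<subseteq> K"
    unfolding supp_def using assms(4) compact_imp_closed[OF \<open>compact K\<close>]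
    by (intro closure_minimal) blast+
  moreover from this have "compact (supp u)"
    using \<open>compact K\<close> compact_Int_closed[of K "supp u"] by (simp add: Int_absorb1)
  ultimately show ?thesis
    using assms(1,3) by (auto simp: test_functions_iff)
qed

lemma test_functions_mono: "u \<in> test_functions \<Omega> \<Longrightarrow> \<Omega> \<subseteq> \<Omega>' \<Longrightarrow> u \<in> test_functions \<Omega>'"
  by (auto simp: test_functions_iff)

lemma grad_eq_0_open:
  assumes "open S" "x \<in> S" "\<And>y. y \<in> S \<Longrightarrow> u y = 0"
  shows "grad u x = 0"
proof (rule grad_eqI, rule GDERIV_cong_open[OF assms(1,2)])
  show "GDERIV (\<lambda>_. 0) x :> 0"
    by (rule GDERIV_const)
qed (simp add: assms(3))

lemma grad_outside_supp: "x \<notin> supp u \<Longrightarrow> grad u x = 0"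
  by (rule grad_eq_0_open[of "- supp u"]) (auto simp: not_in_supp[of _ u])

text \<open>A function that is smooth on \<open>S\<close> and vanishes off a closed set inside \<open>S\<close> is smooth on both of the
  open sets \<open>S\<close> and \<open>- K\<close>, which together cover the space.\<close>

lemma smooth_on_zero_extension:
  assumes "open S" "smooth_on S w" "closed K" "K \<subseteq> S" "\<And>x. x \<in> S \<Longrightarrow> x \<notin> K \<Longrightarrow> w x = 0"
    "\<And>x. x \<in> S \<Longrightarrow> f x = w x" "\<And>x. x \<notin> K \<Longrightarrow> f x = 0"
  shows "smooth_on UNIV f"
proof -
  have "smooth_on S f"
    by (rule smooth_on_cong[OF \<open>open S\<close> _ \<open>smooth_on S w\<close>]) (simp add: assms(6))
  moreover have "smooth_on (- K) f"
    by (rule smooth_on_cong[where u = "\<lambda>_. 0"]) (simp_all add: assms(3,7) open_Compl)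
  ultimately have "smooth_on (S \<union> - K) f"
    by (intro smooth_on_Un) (simp_all add: assms(1,3) open_Compl)
  moreover have "S \<union> - K = UNIV"
    using \<open>K \<subseteq> S\<close> by auto
  ultimately show ?thesis by simp
qed

lemma test_functions_mult:
  assumes "open \<Omega>" "smooth_on \<Omega> a" "u \<in> test_functions \<Omega>"
  shows "(\<lambda>x. a x * u x) \<in> test_functions \<Omega>"
proof (rule test_functionsI[of _ "supp u"])
  show "smooth_on UNIV (\<lambda>x. a x * u x)"
  proof (rule smooth_on_zero_extension[OF \<open>open \<Omega>\<close>, of "\<lambda>x. a x * u x" "supp u"])
    show "smooth_on \<Omega> (\<lambda>x. a x * u x)"
      using assms smooth_on_subset[of UNIV u \<Omega>]
      by (intro smooth_on_mult) (auto simp: test_functions_iff)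
  qed (use assms in \<open>auto simp: test_functions_iff not_in_supp[of _ u]\<close>)
qed (use assms in \<open>auto simp: test_functions_iff not_in_supp[of _ u]\<close>)

lemma test_functions_partial_deriv:
  assumes "u \<in> test_functions \<Omega>"
  shows "partial_deriv i u \<in> test_functions \<Omega>"
proof (rule test_functionsI[of _ "supp u"])
  show "smooth_on UNIV (partial_deriv i u)"
    using assms by (simp add: test_functions_iff smooth_on_partial_deriv)
  show "partial_deriv i u x = 0" if "x \<notin> supp u" for x
    using grad_outside_supp[OF that] by (simp flip: grad_nth)
qed (use assms in \<open>auto simp: test_functions_iff\<close>)

lemma test_functions_continuous_on: "u \<in> test_functions \<Omega> \<Longrightarrow> continuous_on A u"
  by (rule continuous_on_subset[OF smooth_on_continuous_on[of UNIV]]) (auto simp: test_functions_iff)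

lemma test_functions_continuous_on_partial_deriv:
  "u \<in> test_functions \<Omega> \<Longrightarrow> continuous_on A (partial_deriv i u)"
  by (rule continuous_on_subset[OF smooth_on_continuous_on[OF smooth_on_partial_deriv[of UNIV]]])
    (auto simp: test_functions_iff)

lemma test_functions_continuous_on_grad:
  assumes "u \<in> test_functions \<Omega>"
  shows "continuous_on A (grad u)"
  unfolding grad_def[abs_def]
  by (rule continuous_on_vec_lambda) (rule test_functions_continuous_on_partial_deriv[OF assms])

lemma test_functions_GDERIV: "u \<in> test_functions \<Omega> \<Longrightarrow> GDERIV u x :> grad u x"
  by (rule smooth_on_GDERIV[of UNIV]) (simp_all add: test_functions_iff)

lemma test_functions_translate:
  assumes "u \<in> test_functions UNIV" "\<And>x. x + a \<in> supp u \<Longrightarrow> x \<in> \<Omega>"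
  shows "(\<lambda>x. u (x + a)) \<in> test_functions \<Omega>"
proof (rule test_functionsI)
  show "smooth_on UNIV (\<lambda>x. u (x + a))"
    using assms(1) by (intro smooth_on_translate) (simp add: test_functions_iff)
  show "compact ((\<lambda>x. x - a) ` supp u)"
    using assms(1) by (intro compact_continuous_image continuous_intros) (simp add: test_functions_iff)
  show "(\<lambda>x. x - a) ` supp u \<subseteq> \<Omega>"
    using assms(2) by force
  show "u (x + a) = 0" if "x \<notin> (\<lambda>x. x - a) ` supp u" for x
  proof (rule not_in_supp)
    show "x + a \<notin> supp u"
      using that by (metis add_diff_cancel_right' image_eqI)
  qed
qed

section \<open>Integration of compactly supported functions\<close>

lemma integrable_compact_support:
  fixes f :: "real ^ 'n \<Rightarrow> real"
  assumes "compact K" "continuous_on K f" "\<And>x. x \<notin> K \<Longrightarrow> f x = 0"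
  shows "integrable lborel f"
proof -
  have "integrable lborel (\<lambda>x. indicator K x *\<^sub>R f x)"
    by (rule borel_integrable_compact[OF assms(1,2)])
  moreover have "(\<lambda>x. indicator K x *\<^sub>R f x) = f"
    using assms(3) by (intro ext) (auto simp: indicator_def)
  ultimately show ?thesis by simp
qed

lemma set_integral_eq_integral:
  fixes f :: "real ^ 'n \<Rightarrow> real"
  assumes "\<And>x. x \<notin> \<Omega> \<Longrightarrow> f x = 0"
  shows "(LINT x:\<Omega>|lborel. f x) = (LINT x|lborel. f x)"
  unfolding set_lebesgue_integral_def
  by (rule Bochner_Integration.integral_cong) (use assms in \<open>auto simp: indicator_def\<close>)

lemma integral_translation:
  fixes f :: "real ^ 'n \<Rightarrow> real"
  assumes "integrable lborel f"
  shows "integrable lborel (\<lambda>x. f (x + a))" "(LINT x|lborel. f (x + a)) = (LINT x|lborel. f x)"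
proof -
  have f: "f \<in> borel_measurable borel"
    using assms by auto
  have d: "distr lborel borel ((+) a) = (lborel :: (real ^ 'n) measure)"
    by (rule lborel_distr_plus)
  have "integrable (distr lborel borel ((+) a)) f"
    using assms d by simp
  then show "integrable lborel (\<lambda>x. f (x + a))"
    by (subst (asm) integrable_distr_eq) (use f in \<open>auto simp: add.commute\<close>)
  have "(LINT x|distr lborel borel ((+) a). f x) = (LINT x|lborel. f (a + x))"
    by (rule integral_distr) (use f in auto)
  then show "(LINT x|lborel. f (x + a)) = (LINT x|lborel. f x)"
    using d by (simp add: add.commute)
qed

lemma test_functions_integrable:
  "u \<in> test_functions \<Omega> \<Longrightarrow> integrable lborel u"
  by (rule integrable_compact_support[of "supp u"])
    (auto simp: test_functions_iff not_in_supp[of _ u] intro: test_functions_continuous_on[of u \<Omega>])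

lemma test_functions_integrable_power2:
  assumes "u \<in> test_functions \<Omega>"
  shows "integrable lborel (\<lambda>x. (u x)\<^sup>2)"
  using assms test_functions_continuous_on[OF assms]
  by (intro integrable_compact_support[of "supp u"])
    (auto simp: test_functions_iff not_in_supp[of _ u] intro!: continuous_intros)

lemma test_functions_integrable_powr:
  assumes "u \<in> test_functions \<Omega>" "q > 0"
  shows "integrable lborel (\<lambda>x. \<bar>u x\<bar> powr q)"
proof (rule integrable_compact_support[of "supp u"])
  show "continuous_on (supp u) (\<lambda>x. \<bar>u x\<bar> powr q)"
    using \<open>q > 0\<close> by (intro continuous_on_powr' continuous_on_rabs
        continuous_on_const test_functions_continuous_on[OF assms(1)]) auto
qed (use assms in \<open>auto simp: test_functions_iff not_in_supp[of _ u]\<close>)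

lemma test_functions_integrable_grad:
  assumes "u \<in> test_functions \<Omega>"
  shows "integrable lborel (\<lambda>x. (norm (grad u x))\<^sup>2)"
  using assms test_functions_continuous_on_grad[OF assms]
  by (intro integrable_compact_support[of "supp u"])
    (auto simp: test_functions_iff grad_outside_supp[of _ u] intro!: continuous_intros)

lemma test_functions_integrable_hardy:
  assumes "u \<in> test_functions \<Omega>" "0 \<notin> \<Omega>"
  shows "integrable lborel (\<lambda>x. (u x)\<^sup>2 / (norm x)\<^sup>2)"
  using assms test_functions_continuous_on[OF assms(1)]
  by (intro integrable_compact_support[of "supp u"])
    (auto simp: test_functions_iff not_in_supp[of _ u] intro!: continuous_intros)

text \<open>The integrals of the difference quotients of \<open>w\<close> vanish because Lebesgue measure is invariant under
  translations; the mean value theorem provides the bound for dominated convergence.\<close>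

lemma integral_partial_deriv_eq_0:
  fixes w :: "real ^ 'n \<Rightarrow> real"
  assumes w: "w \<in> test_functions \<Omega>"
  shows "(LINT x|lborel. partial_deriv i w x) = 0"
proof -
  define p where "p = partial_deriv i w"
  define a :: "real ^ 'n" where "a = axis i 1"
  define h where "h = (\<lambda>k. inverse (real (Suc k)))"
  define f where "f = (\<lambda>k x. (w (x + h k *\<^sub>R a) - w x) / h k)"
  have h: "h k > 0" "h k \<le> 1" for k
    by (auto simp: h_def field_simps)
  have deriv: "((\<lambda>t. w (x + t *\<^sub>R a)) has_real_derivative p (x + t *\<^sub>R a)) (at t)" for x t
  proof -
    have 1: "((\<lambda>t. x + t *\<^sub>R a) has_derivative (\<lambda>s. s *\<^sub>R a)) (at t)"
      by (auto intro!: derivative_eq_intros)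
    have 2: "(w has_derivative (\<lambda>h. h \<bullet> grad w (x + t *\<^sub>R a))) (at (x + t *\<^sub>R a))"
      using test_functions_GDERIV[OF w] by (simp add: gderiv_def)
    show ?thesis
      using has_derivative_compose[OF 1 2]
      by (simp add: has_field_derivative_def a_def p_def inner_axis' mult_commute_abs)
  qed
  obtain L where L: "\<And>x. x \<in> supp w \<Longrightarrow> norm x \<le> L"
    using w by (metis bounded_iff compact_imp_bounded test_functions_iff)
  have cont_p: "continuous_on A p" for A
    unfolding p_def by (rule test_functions_continuous_on_partial_deriv[OF w])
  have p0: "p x = 0" if "x \<notin> supp w" for x
    using grad_outside_supp[OF that] by (simp add: p_def flip: grad_nth)
  have "compact (p ` supp w)"
    using w by (intro compact_continuous_image cont_p) (simp add: test_functions_iff)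
  then obtain B0 where "\<And>x. x \<in> supp w \<Longrightarrow> \<bar>p x\<bar> \<le> B0"
    by (metis bounded_iff compact_imp_bounded image_eqI real_norm_def)
  then have B: "\<bar>p x\<bar> \<le> max B0 0" for x
    using p0[of x] by (cases "x \<in> supp w") (auto simp: le_max_iff_disj)
  have int_w: "integrable lborel w"
    by (rule test_functions_integrable[OF w])
  have int_f: "integrable lborel (f k)" for k
    unfolding f_def using int_w integral_translation(1)[OF int_w] by auto
  have f0: "(LINT x|lborel. f k x) = 0" for k
    unfolding f_def using int_w integral_translation[OF int_w, of "h k *\<^sub>R a"]
    by (simp add: Bochner_Integration.integral_diff)
  have bound: "norm (f k x) \<le> indicator (cball 0 (L + 1)) x * max B0 0" for k x
  proof (cases "norm x \<le> L + 1")
    case True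
    obtain z where "w (x + h k *\<^sub>R a) - w (x + 0 *\<^sub>R a) = (h k - 0) * p (x + z *\<^sub>R a)"
      using MVT2[of 0 "h k", OF h(1) deriv] by blast
    then have "f k x = p (x + z *\<^sub>R a)"
      using h(1)[of k] by (simp add: f_def)
    then show ?thesis
      using B True by (simp add: indicator_def)
  next
    case False
    have "norm (h k *\<^sub>R a) \<le> 1"
      using h[of k] by (simp add: a_def)
    then have "norm (x + h k *\<^sub>R a) > L"
      using False norm_triangle_ineq[of "x + h k *\<^sub>R a" "- (h k *\<^sub>R a)"] by simp
    then have "w (x + h k *\<^sub>R a) = 0" "w x = 0"
      using L False by (force intro!: not_in_supp[of _ w])+
    then show ?thesis by (simp add: f_def)
  qed
  have lim: "(\<lambda>k. f k x) \<longlonglongrightarrow> p x" for x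
  proof -
    have "((\<lambda>s. (w (x + s *\<^sub>R a) - w x) / s) \<longlongrightarrow> p x) (at 0)"
      using deriv[of x 0] by (simp add: DERIV_def)
    moreover have "filterlim h (at 0) sequentially"
      by (rule filterlim_atI) (use h(1) LIMSEQ_inverse_real_of_nat in \<open>auto simp: h_def\<close>)
    ultimately show ?thesis
      unfolding f_def by (rule filterlim_compose)
  qed
  have "(\<lambda>k. LINT x|lborel. f k x) \<longlonglongrightarrow> (LINT x|lborel. p x)"
  proof (rule integral_dominated_convergence[where w = "\<lambda>x. indicator (cball 0 (L + 1)) x * max B0 0"])
    show "integrable lborel (\<lambda>x. indicator (cball (0 :: real ^ 'n) (L + 1)) x * max B0 0)"
      using emeasure_bounded_finite[OF bounded_cball, of "0 :: real ^ 'n" "L + 1"]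
      by (intro integrable_mult_left integrable_real_indicator) simp_all
    show "p \<in> borel_measurable lborel"
      using cont_p[of UNIV] borel_measurable_continuous_onI by auto
  qed (use int_f lim bound in auto)
  then show ?thesis
    using f0 by (simp add: LIMSEQ_const_iff p_def)
qed

section \<open>The ground state of the half space\<close>

lemma GDERIV_norm_power2: "GDERIV (\<lambda>x. (norm x)\<^sup>2) x :> 2 *\<^sub>R x"
  unfolding gderiv_def power2_norm_eq_inner
  by (auto intro!: derivative_eq_intros simp: inner_commute)

lemma GDERIV_norm_power2_powr:
  assumes "x \<noteq> 0"
  shows "GDERIV (\<lambda>x. (norm x)\<^sup>2 powr a) x :> (2 * a * (norm x)\<^sup>2 powr (a - 1)) *\<^sub>R x"
  using GDERIV_DERIV_compose[OF GDERIV_norm_power2 has_real_derivative_powr, of x a] assms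
  by (simp add: algebra_simps)

text \<open>The field \<open>B(x) x\<close> has divergence \<open>x \<bullet> \<nabla>B + n B\<close>, which integrates to zero.\<close>

lemma integral_radial_derivative:
  assumes B: "B \<in> test_functions \<Omega>"
  shows "(LINT x|lborel. x \<bullet> grad B x) = - real CARD('n) * (LINT x|lborel. B (x :: real ^ 'n))"
proof -
  have w: "(\<lambda>x. x $ i * B x) \<in> test_functions UNIV" for i
    using test_functions_mult[OF _ _ test_functions_mono[OF B]] by simp
  have int: "integrable lborel (partial_deriv i (\<lambda>x. x $ i * B x))" for i
    by (rule test_functions_integrable[OF test_functions_partial_deriv[OF w]])
  have "partial_deriv i (\<lambda>x. x $ i * B x) x = x $ i * grad B x $ i + B x" for i x
    using grad_eqI[OF GDERIV_mult[OF GDERIV_nth test_functions_GDERIV[OF B]], of i x]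
    by (simp flip: grad_nth)
  then have "(\<Sum>i\<in>UNIV. partial_deriv i (\<lambda>x. x $ i * B x) x) = x \<bullet> grad B x + real CARD('n) * B x" for x
    by (simp add: sum.distrib inner_vec_def)
  moreover have "(LINT x|lborel. (\<Sum>i\<in>UNIV. partial_deriv i (\<lambda>x. x $ i * B x) x)) = 0"
    using integral_partial_deriv_eq_0[OF w] int by (simp add: Bochner_Integration.integral_sum)
  ultimately have 0: "(LINT x|lborel. (x \<bullet> grad B x + real CARD('n) * B x)) = 0"
    by simp
  have "integrable lborel (\<lambda>x. \<Sum>i\<in>UNIV. partial_deriv i (\<lambda>x. x $ i * B x) x)"
    using int by auto
  then have "integrable lborel (\<lambda>x. x \<bullet> grad B x + real CARD('n) * B x)"
    by (simp add: \<open>\<And>x. (\<Sum>i\<in>UNIV. partial_deriv i (\<lambda>x. x $ i * B x) x) = _\<close>)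
  from Bochner_Integration.integrable_diff[OF this integrable_mult_right[OF test_functions_integrable[OF B]], of "real CARD('n)"]
  have "integrable lborel (\<lambda>x. x \<bullet> grad B x)"
    by simp
  then show ?thesis
    using 0 test_functions_integrable[OF B]
    by (simp add: Bochner_Integration.integral_add)
qed

text \<open>The positive solution \<open>x\<^sub>m |x|\<^bsup>-n/2\<^esup>\<close> of \<open>- \<Delta>\<Phi> = n\<^sup>2/4 \<Phi>/|x|\<^sup>2\<close> on the half space \<open>x\<^sub>m > 0\<close>. Writing it with
  the square of the norm makes its smoothness away from the origin immediate.\<close>

definition hardy_profile :: "'n::finite \<Rightarrow> real ^ 'n \<Rightarrow> real" where
  "hardy_profile m x = x $ m * (norm x)\<^sup>2 powr (- real CARD('n) / 4)"

lemma smooth_on_hardy_profile: "smooth_on (- {0}) (hardy_profile m)"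
  unfolding hardy_profile_def[abs_def]
  by (intro smooth_on_mult smooth_on_powr smooth_on_norm_power2 smooth_on_nth) auto

text \<open>For \<open>u = \<Phi> v\<close> one has \<open>|\<nabla>u|\<^sup>2 = \<Phi>\<^sup>2 |\<nabla>v|\<^sup>2 + n\<^sup>2/4 u\<^sup>2/|x|\<^sup>2 + div (v\<^sup>2 \<Phi> \<nabla>\<Phi>)\<close>. Since
  \<open>\<Phi> \<nabla>\<Phi> = x\<^sub>m |x|\<^bsup>-n\<^esup> e\<^sub>m - n/2 x\<^sub>m\<^sup>2 |x|\<^bsup>-n-2\<^esup> x\<close>, the divergence splits into the partial derivative of \<open>w\<close>
  and the radial expression in \<open>B\<close>.\<close>

lemma ground_state_pointwise:
  fixes x :: "real ^ 'n::finite" and m :: 'n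
  defines "N \<equiv> real CARD('n)"
  assumes "x \<noteq> 0" and v: "GDERIV v x :> g"
  defines "w \<equiv> \<lambda>x. (x $ m * (norm x)\<^sup>2 powr (- N / 2)) * (v x * v x)"
    and "B \<equiv> \<lambda>x. (x $ m * (x $ m * (norm x)\<^sup>2 powr (- N / 2 - 1))) * (v x * v x)"
  shows "(norm (grad (\<lambda>x. hardy_profile m x * v x) x))\<^sup>2
      = N\<^sup>2 / 4 * ((hardy_profile m x * v x)\<^sup>2 / (norm x)\<^sup>2) + (hardy_profile m x)\<^sup>2 * (norm g)\<^sup>2
        + (partial_deriv m w x - N / 2 * (x \<bullet> grad B x + N * B x))"
proof -
  define r where "r = (norm x)\<^sup>2"
  have r: "r > 0" using \<open>x \<noteq> 0\<close> by (simp add: r_def)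
  define Q R where "Q = r powr (- N / 4)" and "R = r powr (- N / 2 - 1)"
  have P: "r powr (- N / 2) = Q * Q" 
    by (simp add: Q_def flip: powr_add)
  have Rr: "R * r = Q * Q"
    using r powr_add[of r "- N / 2 - 1" 1] by (simp add: R_def flip: P)
  have Q': "r powr (- N / 4 - 1) = Q / r"
    using r powr_add[of r "- N / 4 - 1" 1] by (simp add: Q_def field_simps)
  have P': "r powr (- N / 2 - 1) = R"
    by (simp add: R_def)
  have R': "r powr (- 2 - N / 2) = R / r"
  proof -
    have "- 2 - N / 2 = (- N / 2 - 1) - 1" by simp
    then show ?thesis
      unfolding R_def by (simp only: powr_diff) (use r in simp)
  qed
  define t where "t = x $ m"
  define gm where "gm = g $ m"
  define e :: "real ^ 'n" where "e = axis m 1"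
  note pw = GDERIV_norm_power2_powr[OF \<open>x \<noteq> 0\<close>]
  have "GDERIV (\<lambda>x. hardy_profile m x * v x) x :>
      (t * Q) *\<^sub>R g + v x *\<^sub>R (t *\<^sub>R ((2 * (- N / 4) * (Q / r)) *\<^sub>R x) + Q *\<^sub>R e)"
    unfolding hardy_profile_def
    using GDERIV_mult[OF GDERIV_mult[OF GDERIV_nth pw] v, of m "- N / 4"] Q'[unfolded Q_def N_def r_def]
    by (simp add: N_def Q_def t_def e_def r_def mult.commute[of _ 2])
  then have gu: "grad (\<lambda>x. hardy_profile m x * v x) x =
      (t * Q) *\<^sub>R g + v x *\<^sub>R (t *\<^sub>R ((2 * (- N / 4) * (Q / r)) *\<^sub>R x) + Q *\<^sub>R e)"
    by (rule grad_eqI)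
  have "GDERIV w x :> (t * (Q * Q)) *\<^sub>R (v x *\<^sub>R g + v x *\<^sub>R g)
      + (v x * v x) *\<^sub>R (t *\<^sub>R ((2 * (- N / 2) * R) *\<^sub>R x) + (Q * Q) *\<^sub>R e)"
    unfolding w_def
    using GDERIV_mult[OF GDERIV_mult[OF GDERIV_nth pw] GDERIV_mult[OF v v], of m "- N / 2"]
    by (simp add: P[symmetric] R_def t_def e_def r_def)
  then have gw: "grad w x = (t * (Q * Q)) *\<^sub>R (v x *\<^sub>R g + v x *\<^sub>R g)
      + (v x * v x) *\<^sub>R (t *\<^sub>R ((2 * (- N / 2) * R) *\<^sub>R x) + (Q * Q) *\<^sub>R e)"
    by (rule grad_eqI)
  have "GDERIV B x :> (t * (t * R)) *\<^sub>R (v x *\<^sub>R g + v x *\<^sub>R g)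
      + (v x * v x) *\<^sub>R (t *\<^sub>R (t *\<^sub>R ((2 * (- N / 2 - 1) * (R / r)) *\<^sub>R x) + R *\<^sub>R e) + (t * R) *\<^sub>R e)"
    unfolding B_def
    using GDERIV_mult[OF GDERIV_mult[OF GDERIV_nth GDERIV_mult[OF GDERIV_nth pw]] GDERIV_mult[OF v v], of m m "- N / 2 - 1"] R'[unfolded R_def r_def]
    by (simp add: R_def t_def e_def r_def)
  then have gB: "grad B x = (t * (t * R)) *\<^sub>R (v x *\<^sub>R g + v x *\<^sub>R g)
      + (v x * v x) *\<^sub>R (t *\<^sub>R (t *\<^sub>R ((2 * (- N / 2 - 1) * (R / r)) *\<^sub>R x) + R *\<^sub>R e) + (t * R) *\<^sub>R e)"
    by (rule grad_eqI)
  have ip: "x \<bullet> x = r" "e \<bullet> e = 1" "x \<bullet> e = t" "e \<bullet> x = t" "g \<bullet> e = gm" "e \<bullet> g = gm" "x \<bullet> g = g \<bullet> x"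
    by (simp_all add: r_def e_def t_def gm_def power2_norm_eq_inner inner_axis inner_axis' inner_commute)
  have 1: "partial_deriv m w x = 2 * v x * t * (Q * Q) * gm + (v x)\<^sup>2 * (Q * Q - N * R * t\<^sup>2)"
    unfolding grad_nth[symmetric] gw
    by (simp add: t_def gm_def e_def algebra_simps power2_eq_square)
  have 2: "x \<bullet> grad B x = 2 * v x * t\<^sup>2 * R * (g \<bullet> x) - N * t\<^sup>2 * R * (v x)\<^sup>2"
    unfolding gB using r
    by (simp only: inner_add_right inner_scaleR_right ip) (simp add: field_simps power2_eq_square)
  have B: "B x = t\<^sup>2 * R * (v x)\<^sup>2"
    by (simp add: B_def t_def R_def r_def power2_eq_square)
  have hp: "hardy_profile m x = t * Q"
    by (simp add: hardy_profile_def t_def Q_def r_def N_def)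
  have R: "R = Q * Q / r"
    using Rr r by (simp add: field_simps)
  show ?thesis
    unfolding 1 2 B gu hp R power2_norm_eq_inner ip(1) 
    using r by (simp only: inner_add_right inner_add_left inner_scaleR_right inner_scaleR_left ip)
      (simp add: field_simps power2_eq_square)
qed

text \<open>The pointwise identity is integrated; its divergence terms vanish because \<open>v\<close> is supported away
  from the singularity.\<close>

lemma ground_state_representation:
  fixes v :: "real ^ 'n::finite \<Rightarrow> real" and m :: 'n
  assumes v: "v \<in> test_functions (- {0})"
  defines "u \<equiv> \<lambda>x. hardy_profile m x * v x"
  shows "(LINT x|lborel. (norm (grad u x))\<^sup>2) =
     (real CARD('n))\<^sup>2 / 4 * (LINT x|lborel. (u x)\<^sup>2 / (norm x)\<^sup>2)
     + (LINT x|lborel. (hardy_profile m x)\<^sup>2 * (norm (grad v x))\<^sup>2)"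
    "integrable lborel (\<lambda>x. (hardy_profile m x)\<^sup>2 * (norm (grad v x))\<^sup>2)"
proof -
  define N where "N = real CARD('n)"
  define w where "w = (\<lambda>x. (x $ m * (norm x)\<^sup>2 powr (- N / 2)) * (v x * v x))"
  define B where "B = (\<lambda>x. (x $ m * (x $ m * (norm x)\<^sup>2 powr (- N / 2 - 1))) * (v x * v x))"
  have vv: "(\<lambda>x. v x * v x) \<in> test_functions (- {0})"
    by (rule test_functions_mult[OF _ _ v]) (use v smooth_on_subset in \<open>auto simp: test_functions_iff\<close>)
  have pw: "smooth_on (- {0}) (\<lambda>x. (norm x)\<^sup>2 powr a)" for a
    by (intro smooth_on_powr smooth_on_norm_power2) auto
  have w: "w \<in> test_functions (- {0})" and B: "B \<in> test_functions (- {0})"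
    unfolding w_def B_def
    by (intro test_functions_mult smooth_on_mult smooth_on_nth pw vv open_Compl closed_singleton)+
  have K: "compact (supp v)" "0 \<notin> supp v"
    using v by (auto simp: test_functions_iff)
  have v0: "v x = 0" "grad v x = 0" if "x \<notin> supp v" for x
    using that not_in_supp grad_outside_supp by blast+
  have gu0: "grad u x = 0" "u x = 0" "grad w x = 0" "grad B x = 0" "B x = 0" if "x \<notin> supp v" for x
    using that v0 by (auto intro!: grad_eq_0_open[of "- supp v"] simp: u_def w_def B_def)
  have cont: "continuous_on (supp v) (hardy_profile m)" "continuous_on (supp v) (norm :: real ^ 'n \<Rightarrow> real)"
    "continuous_on (supp v) v" "continuous_on (supp v) (grad v)"
    using K smooth_on_continuous_on[OF smooth_on_hardy_profile[of m]] continuous_on_subset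
      test_functions_continuous_on[OF v] test_functions_continuous_on_grad[OF v]
    by (auto intro!: continuous_intros intro: continuous_on_subset)
  have I1: "integrable lborel (\<lambda>x. (u x)\<^sup>2 / (norm x)\<^sup>2)"
    unfolding u_def
    by (rule integrable_compact_support[OF K(1)]) (use K v0 in \<open>auto intro!: continuous_intros cont\<close>)
  show I2: "integrable lborel (\<lambda>x. (hardy_profile m x)\<^sup>2 * (norm (grad v x))\<^sup>2)"
    by (rule integrable_compact_support[OF K(1)]) (use K v0 in \<open>auto intro!: continuous_intros cont\<close>)
  have I3: "integrable lborel (partial_deriv m w)"
    by (rule test_functions_integrable[OF test_functions_partial_deriv[OF w]])
  have I4: "integrable lborel B"
    by (rule test_functions_integrable[OF B])
  have I5: "integrable lborel (\<lambda>x. x \<bullet> grad B x)"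
    by (rule integrable_compact_support[OF K(1)]) 
      (use gu0 test_functions_continuous_on_grad[OF B] in \<open>auto intro!: continuous_intros\<close>)
  have lin: "(LINT x|lborel. a * f1 x + f2 x + (f3 x - b * (f5 x + N * f4 x))) =
      a * (LINT x|lborel. f1 x) + (LINT x|lborel. f2 x) + ((LINT x|lborel. f3 x)
       - b * ((LINT x|lborel. f5 x) + N * (LINT x|lborel. f4 x)))"
    if "integrable lborel f1" "integrable lborel f2" "integrable lborel f3" "integrable lborel f4"
      "integrable lborel f5" for f1 f2 f3 f4 f5 :: "real ^ 'n \<Rightarrow> real" and a b
    using that by simp
  have "(norm (grad u x))\<^sup>2 = N\<^sup>2 / 4 * ((u x)\<^sup>2 / (norm x)\<^sup>2) + (hardy_profile m x)\<^sup>2 * (norm (grad v x))\<^sup>2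
        + (partial_deriv m w x - N / 2 * (x \<bullet> grad B x + N * B x))" for x
  proof (cases "x \<in> supp v")
    case True
    then have "x \<noteq> 0" using K by auto
    then show ?thesis
      unfolding u_def w_def B_def N_def
      by (rule ground_state_pointwise) (rule test_functions_GDERIV[OF v])
  next
    case False
    then show ?thesis
      using gu0[OF False] v0[OF False] by (simp flip: grad_nth)
  qed
  then have "(LINT x|lborel. (norm (grad u x))\<^sup>2) = N\<^sup>2 / 4 * (LINT x|lborel. (u x)\<^sup>2 / (norm x)\<^sup>2)
     + (LINT x|lborel. (hardy_profile m x)\<^sup>2 * (norm (grad v x))\<^sup>2)
     + ((LINT x|lborel. partial_deriv m w x) - N / 2 * ((LINT x|lborel. x \<bullet> grad B x) + N * (LINT x|lborel. B x)))"
    by (simp only: lin[OF I1 I2 I3 I4 I5])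
  then show "(LINT x|lborel. (norm (grad u x))\<^sup>2) =
     (real CARD('n))\<^sup>2 / 4 * (LINT x|lborel. (u x)\<^sup>2 / (norm x)\<^sup>2)
     + (LINT x|lborel. (hardy_profile m x)\<^sup>2 * (norm (grad v x))\<^sup>2)"
    using integral_partial_deriv_eq_0[OF w] integral_radial_derivative[OF B]
    by (simp add: N_def)
qed

section \<open>Logarithmic cutoffs inside the interior ball\<close>

lemma norm_power2_powr_half:
  assumes "(x :: real ^ 'n) \<noteq> 0"
  shows "(norm x)\<^sup>2 powr (- real k / 2) = 1 / norm x ^ k"
proof -
  have "(norm x)\<^sup>2 = norm x powr 2"
    using assms by simp
  then have "(norm x)\<^sup>2 powr (- real k / 2) = norm x powr - real k"
    by (simp only: powr_powr) simp
  also have "\<dots> = 1 / norm x ^ k"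
    using assms by (simp add: powr_minus powr_realpow divide_inverse)
  finally show ?thesis .
qed

lemma hardy_profile_power2:
  assumes "(x :: real ^ 'n::finite) \<noteq> 0"
  shows "(hardy_profile m x)\<^sup>2 = (x $ m)\<^sup>2 / norm x ^ CARD('n)"
proof -
  have "((norm x)\<^sup>2 powr (- real CARD('n) / 4))\<^sup>2 = (norm x)\<^sup>2 powr (- real CARD('n) / 2)"
    by (simp add: power2_eq_square[of "_ powr _"] flip: powr_add)
  then show ?thesis
    unfolding hardy_profile_def power_mult_distrib norm_power2_powr_half[OF assms] by simp
qed

text \<open>The closed dyadic shells cover the range between two powers of one half.\<close>

lemma dyadic_shell:
  fixes t :: real
  assumes "(1/2) ^ (N + k) \<le> t" "t \<le> (1/2) ^ N" "k \<ge> 1"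
  shows "\<exists>j\<in>{N..<N + k}. (1/2) ^ Suc j \<le> t \<and> t \<le> (1/2) ^ j"
  using assms
proof (induction k)
  case (Suc k)
  show ?case
  proof (cases "k \<ge> 1 \<and> (1/2) ^ (N + k) \<le> t")
    case True
    then obtain j where "j \<in> {N..<N + k}" "(1/2) ^ Suc j \<le> t \<and> t \<le> (1/2) ^ j"
      using Suc by blast
    then show ?thesis by (intro bexI[of _ j]) auto
  next
    case False
    then show ?thesis
      using Suc.prems by (intro bexI[of _ "N + k"]) (auto simp: not_le Suc_le_eq)
  qed
qed simp

text \<open>Equals \<open>-log\<^sub>2 |x| / N\<close>, so the shell \<open>2\<^bsup>-2N\<^esup> \<le> |x| \<le> 2\<^bsup>-N\<^esup>\<close> is the range of levels from 1 to 2.\<close>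

definition radial_level :: "real \<Rightarrow> real ^ 'n \<Rightarrow> real" where
  "radial_level N x = - ln ((norm x)\<^sup>2) / (2 * N * ln 2)"

text \<open>The first two factors restrict the radial level to the range from 1 to 2 and are 1 for levels from
  4/3 to 5/3. The third restricts to \<open>|x|\<^sup>2 \<le> r x\<^sub>m\<close>, a set whose points other than the origin lie inside
  the ball of radius \<open>r\<close> about \<open>r e\<^sub>m\<close>, which is given by \<open>|x|\<^sup>2 < 2 r x\<^sub>m\<close>.\<close>

definition cutoff :: "'n \<Rightarrow> real \<Rightarrow> real \<Rightarrow> real ^ 'n \<Rightarrow> real" where
  "cutoff m r N x = smooth_step (3 * (radial_level N x - 1)) * smooth_step (3 * (2 - radial_level N x))
     * smooth_step (r * x $ m / (norm x)\<^sup>2 - 1)"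

lemma radial_level_ge_iff:
  assumes "N > 0" "x \<noteq> 0"
  shows "radial_level N x \<ge> c \<longleftrightarrow> norm x \<le> 2 powr (- (N * c))"
proof -
  have "radial_level N x \<ge> c \<longleftrightarrow> ln (norm x) \<le> - (N * c) * ln 2"
    using assms by (simp add: radial_level_def ln_realpow field_simps) linarith
  also have "\<dots> \<longleftrightarrow> norm x \<le> exp (- (N * c) * ln 2)"
    using assms by (simp add: ln_le_cancel_iff[symmetric] del: ln_le_cancel_iff)
  finally show ?thesis by (simp add: powr_def)
qed

lemma radial_level_le_iff:
  assumes "N > 0" "x \<noteq> 0"
  shows "radial_level N x \<le> c \<longleftrightarrow> norm x \<ge> 2 powr (- (N * c))"
proof -
  have "radial_level N x \<le> c \<longleftrightarrow> ln (norm x) \<ge> - (N * c) * ln 2"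
    using assms by (simp add: radial_level_def ln_realpow field_simps) linarith
  also have "\<dots> \<longleftrightarrow> norm x \<ge> exp (- (N * c) * ln 2)"
    using assms by (simp add: ln_le_cancel_iff[symmetric] del: ln_le_cancel_iff)
  finally show ?thesis by (simp add: powr_def)
qed

lemma cutoff_support:
  assumes "N > 0" "cutoff m r N x \<noteq> 0"
  shows "x \<noteq> 0" "2 powr (- 2 * N) \<le> norm x" "norm x \<le> 2 powr (- N)" "(norm x)\<^sup>2 \<le> r * x $ m"
proof -
  show x: "x \<noteq> 0"
  proof
    assume "x = 0"
    then have "radial_level N x = 0" by (simp add: radial_level_def)
    then show False using assms by (simp add: cutoff_def smooth_step_eq_0)
  qed
  have "radial_level N x \<ge> 1" "radial_level N x \<le> 2" "r * x $ m / (norm x)\<^sup>2 \<ge> 1"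
    using assms(2) smooth_step_eq_0[of "3 * (radial_level N x - 1)"]
      smooth_step_eq_0[of "3 * (2 - radial_level N x)"] smooth_step_eq_0[of "r * x $ m / (norm x)\<^sup>2 - 1"]
    unfolding cutoff_def by fastforce+
  then show "2 powr (- 2 * N) \<le> norm x" "norm x \<le> 2 powr (- N)" "(norm x)\<^sup>2 \<le> r * x $ m"
    using radial_level_ge_iff[OF assms(1) x] radial_level_le_iff[OF assms(1) x] x
    by (auto simp: field_simps)
qed

lemma cutoff_test_function:
  fixes m :: "'n::finite"
  assumes "N > 0" "r > 0"
  shows "cutoff m r N \<in> test_functions (ball (r *\<^sub>R axis m 1) r)"
    "\<And>x. grad (cutoff m r N) x \<noteq> 0 \<Longrightarrow>
       x \<noteq> 0 \<and> 2 powr (- 2 * N) \<le> norm x \<and> norm x \<le> 2 powr (- N) \<and> (norm x)\<^sup>2 \<le> r * x $ m"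
proof -
  define C where "C = {x :: real ^ 'n. 2 powr (- 2 * N) \<le> norm x \<and> norm x \<le> 2 powr (- N) \<and> (norm x)\<^sup>2 \<le> r * x $ m}"
  have "closed C"
    unfolding C_def by (intro closed_Collect_conj closed_Collect_le continuous_intros)
  moreover have "C \<subseteq> cball 0 (2 powr (- N))"
    by (auto simp: C_def)
  ultimately have "compact C"
    using bounded_subset bounded_cball by (auto simp: compact_eq_bounded_closed)
  have C0: "x \<noteq> 0" if "x \<in> C" for x
    using that by (auto simp: C_def)
  have supp: "cutoff m r N x = 0" if "x \<notin> C" for x
    using cutoff_support[OF \<open>N > 0\<close>] that unfolding C_def by blast
  have "smooth_on (- {0}) (cutoff m r N)"
    unfolding cutoff_def[abs_def] radial_level_def
    by (intro smooth_on_mult smooth_on_smooth_step smooth_on_diff smooth_on_divide smooth_on_const smooth_on_nth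
        smooth_on_norm_power2 smooth_on_ln smooth_on_minus) (use \<open>N > 0\<close> in auto)
  then have "smooth_on UNIV (cutoff m r N)"
    by (rule smooth_on_zero_extension[OF open_Compl[OF closed_singleton] _ \<open>closed C\<close>])
      (use C0 supp in auto)
  moreover have "x \<in> ball (r *\<^sub>R axis m 1) r" if "x \<in> C" for x
  proof -
    have "(norm x)\<^sup>2 > 0" "(norm x)\<^sup>2 \<le> r * x $ m"
      using that C0[OF that] by (auto simp: C_def)
    moreover have "(norm (r *\<^sub>R axis m 1 - x))\<^sup>2 = r\<^sup>2 - 2 * (r * x $ m) + (norm x)\<^sup>2"
      by (simp only: power2_norm_eq_inner)
        (simp add: inner_diff_left inner_diff_right inner_axis inner_axis' power2_eq_square right_diff_distrib)
    ultimately have "(norm (r *\<^sub>R axis m 1 - x))\<^sup>2 < r\<^sup>2"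
      by linarith
    then show ?thesis
      using \<open>r > 0\<close> power2_less_imp_less[of "norm (r *\<^sub>R axis m 1 - x)" r] by (simp add: dist_norm)
  qed
  ultimately show "cutoff m r N \<in> test_functions (ball (r *\<^sub>R axis m 1) r)"
    using supp by (intro test_functionsI[OF _ \<open>compact C\<close>]) auto
  fix x
  assume "grad (cutoff m r N) x \<noteq> 0"
  then have "x \<in> C"
    using grad_eq_0_open[of "- C" x "cutoff m r N"] supp \<open>closed C\<close> by auto
  then show "x \<noteq> 0 \<and> 2 powr (- 2 * N) \<le> norm x \<and> norm x \<le> 2 powr (- N) \<and> (norm x)\<^sup>2 \<le> r * x $ m"
    using C0 by (auto simp: C_def)
qed

lemma GDERIV_radial_level:
  assumes "x \<noteq> 0" "N > 0"
  shows "GDERIV (radial_level N) x :> (- 1 / (N * ln 2 * (norm x)\<^sup>2)) *\<^sub>R x"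
proof -
  have "((\<lambda>t. - ln t / (2 * N * ln 2)) has_real_derivative - 1 / ((norm x)\<^sup>2 * (2 * N * ln 2))) (at ((norm x)\<^sup>2))"
    using assms by (auto intro!: derivative_eq_intros simp: field_simps)
  from GDERIV_DERIV_compose[OF GDERIV_norm_power2 this] show ?thesis
    unfolding radial_level_def[abs_def] by (rule GDERIV_subst) (simp add: field_simps)
qed

lemma GDERIV_angular_level:
  assumes "x \<noteq> 0"
  shows "\<exists>g. GDERIV (\<lambda>x. r * x $ m / (norm x)\<^sup>2 - 1) x :> g \<and> norm g \<le> 3 * \<bar>r\<bar> / (norm x)\<^sup>2"
proof -
  define g where "g = r *\<^sub>R ((1 / (norm x)\<^sup>2) *\<^sub>R axis m 1 + (x $ m * (- 2 / (norm x) ^ 4)) *\<^sub>R x)"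
  have "((\<lambda>t. 1 / t) has_real_derivative - 1 / ((norm x)\<^sup>2)\<^sup>2) (at ((norm x)\<^sup>2))"
    using assms by (auto intro!: derivative_eq_intros simp: field_simps power2_eq_square)
  from GDERIV_diff[OF GDERIV_mult[OF GDERIV_const[of r] GDERIV_mult[OF GDERIV_nth[of m] GDERIV_DERIV_compose[OF GDERIV_norm_power2 this]]] GDERIV_const[of 1]]
  have "GDERIV (\<lambda>x. r * x $ m / (norm x)\<^sup>2 - 1) x :> g"
    by (simp add: g_def algebra_simps flip: power_mult)
  moreover have "norm g \<le> 3 * \<bar>r\<bar> / (norm x)\<^sup>2"
  proof -
    have "norm g \<le> \<bar>r\<bar> * (1 / (norm x)\<^sup>2 + \<bar>x $ m\<bar> * 2 / (norm x) ^ 4 * norm x)"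
      unfolding g_def norm_scaleR
      by (intro mult_left_mono order_trans[OF norm_triangle_ineq]) (auto simp: abs_mult)
    also have "\<dots> \<le> \<bar>r\<bar> * (1 / (norm x)\<^sup>2 + norm x * 2 / (norm x) ^ 4 * norm x)"
      by (intro mult_left_mono add_left_mono mult_right_mono divide_right_mono component_le_norm_cart) auto
    also have "\<dots> = 3 * \<bar>r\<bar> / (norm x)\<^sup>2"
      using assms by (simp add: field_simps eval_nat_numeral)
    finally show ?thesis .
  qed
  ultimately show ?thesis by blast
qed

text \<open>All factors lie between 0 and 1, so the gradient of the product is bounded by the sum of theirs. The
  radial factors contribute \<open>O(1/(N|x|))\<close>; the factor along the boundary contributes \<open>O(r/|x|\<^sup>2)\<close>, but
  only where \<open>r x\<^sub>m \<le> 2|x|\<^sup>2\<close>.\<close>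

lemma cutoff_gradient_bound:
  "\<exists>K\<ge>0. \<forall>(m :: 'n::finite) r N x. r > 0 \<longrightarrow> N > 0 \<longrightarrow> x \<noteq> 0 \<longrightarrow>
     (norm (grad (cutoff m r N) x))\<^sup>2 \<le> K * (1 / (N\<^sup>2 * (norm x)\<^sup>2)
        + (if r * x $ m \<le> 2 * (norm x)\<^sup>2 then r\<^sup>2 / (norm x) ^ 4 else 0))"
proof -
  obtain S' K where S': "\<And>t. (smooth_step has_real_derivative S' t) (at t)" "\<And>t. \<bar>S' t\<bar> \<le> K"
      "\<And>t. t > 1 \<Longrightarrow> S' t = 0"
    using smooth_step_bounded_derivative by blast
  have "K \<ge> 0" using S'(2)[of 0] by linarith
  have *: "(norm (grad (cutoff m r N) x))\<^sup>2 \<le> (72 * K\<^sup>2 / (ln 2)\<^sup>2 + 18 * K\<^sup>2) * (1 / (N\<^sup>2 * (norm x)\<^sup>2)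
        + (if r * x $ m \<le> 2 * (norm x)\<^sup>2 then r\<^sup>2 / (norm x) ^ 4 else 0))"
    if "r > 0" "N > 0" "x \<noteq> 0" for m :: 'n and r N x
  proof -
    define l where "l = radial_level N x"
    define q where "q = r * x $ m / (norm x)\<^sup>2 - 1"
    define gl where "gl = (- 1 / (N * ln 2 * (norm x)\<^sup>2)) *\<^sub>R x"
    note gl = GDERIV_radial_level[OF \<open>x \<noteq> 0\<close> \<open>N > 0\<close>, folded gl_def]
    obtain gq where gq: "GDERIV (\<lambda>x. r * x $ m / (norm x)\<^sup>2 - 1) x :> gq" "norm gq \<le> 3 * r / (norm x)\<^sup>2"
      using GDERIV_angular_level[OF \<open>x \<noteq> 0\<close>, of r m] \<open>r > 0\<close> by auto
    have norm_gl: "norm gl = 1 / (N * ln 2 * norm x)"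
      using that by (simp add: gl_def power2_eq_square)
    have d1: "((\<lambda>t. smooth_step (3 * (t - 1))) has_real_derivative 3 * S' (3 * (l - 1))) (at l)"
    proof -
      have "((\<lambda>t. 3 * (t - 1)) has_real_derivative 3) (at l)"
        by (auto intro!: derivative_eq_intros)
      from DERIV_chain2[OF S'(1) this] show ?thesis by (simp only: mult.commute)
    qed
    have d2: "((\<lambda>t. smooth_step (3 * (2 - t))) has_real_derivative - 3 * S' (3 * (2 - l))) (at l)"
    proof -
      have "((\<lambda>t. 3 * (2 - t)) has_real_derivative - 3) (at l)"
        by (auto intro!: derivative_eq_intros)
      from DERIV_chain2[OF S'(1) this] show ?thesis by (simp only: mult.commute)
    qed
    define g1 g2 g3 where "g1 = (3 * S' (3 * (l - 1))) *\<^sub>R gl" and "g2 = (- 3 * S' (3 * (2 - l))) *\<^sub>R gl"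
      and "g3 = S' q *\<^sub>R gq"
    have G1: "GDERIV (\<lambda>x. smooth_step (3 * (radial_level N x - 1))) x :> g1"
      unfolding g1_def by (rule GDERIV_DERIV_compose[OF gl d1[unfolded l_def], folded l_def])
    have G2: "GDERIV (\<lambda>x. smooth_step (3 * (2 - radial_level N x))) x :> g2"
      unfolding g2_def by (rule GDERIV_DERIV_compose[OF gl d2[unfolded l_def], folded l_def])
    have G3: "GDERIV (\<lambda>x. smooth_step (r * x $ m / (norm x)\<^sup>2 - 1)) x :> g3"
      unfolding g3_def q_def by (rule GDERIV_DERIV_compose[OF gq(1) S'(1)])
    define s1 s2 s3 where "s1 = smooth_step (3 * (l - 1))" and "s2 = smooth_step (3 * (2 - l))"
      and "s3 = smooth_step q"
    have s: "\<bar>s1\<bar> \<le> 1" "\<bar>s2\<bar> \<le> 1" "\<bar>s3\<bar> \<le> 1"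
      using smooth_step_nonneg smooth_step_le_1 by (auto simp: s1_def s2_def s3_def)
    have "grad (cutoff m r N) x = (s1 * s2) *\<^sub>R g3 + s3 *\<^sub>R (s1 *\<^sub>R g2 + s2 *\<^sub>R g1)"
      unfolding cutoff_def[abs_def] s1_def s2_def s3_def l_def q_def
      by (rule grad_eqI[OF GDERIV_mult[OF GDERIV_mult[OF G1 G2] G3]])
    then have "norm (grad (cutoff m r N) x) \<le> norm ((s1 * s2) *\<^sub>R g3) + norm (s3 *\<^sub>R (s1 *\<^sub>R g2 + s2 *\<^sub>R g1))"
      by (simp only: norm_triangle_ineq)
    also have "\<dots> \<le> norm g3 + (norm g2 + norm g1)"
    proof (intro add_mono)
      have "\<bar>s1\<bar> * \<bar>s2\<bar> \<le> 1" using s by (simp add: mult_le_one)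
      then show "norm ((s1 * s2) *\<^sub>R g3) \<le> norm g3"
        by (simp add: abs_mult mult_left_le_one_le)
      have "norm (s3 *\<^sub>R (s1 *\<^sub>R g2 + s2 *\<^sub>R g1)) \<le> norm (s1 *\<^sub>R g2 + s2 *\<^sub>R g1)"
        using s by (simp add: mult_left_le_one_le)
      also have "\<dots> \<le> norm (s1 *\<^sub>R g2) + norm (s2 *\<^sub>R g1)" by (rule norm_triangle_ineq)
      also have "\<dots> \<le> norm g2 + norm g1"
        using s by (intro add_mono) (simp_all add: mult_left_le_one_le)
      finally show "norm (s3 *\<^sub>R (s1 *\<^sub>R g2 + s2 *\<^sub>R g1)) \<le> norm g2 + norm g1" .
    qed
    also have "norm g1 \<le> 3 * K * norm gl"
      unfolding g1_def by (simp add: abs_mult mult_right_mono S'(2))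
    also have "norm g2 \<le> 3 * K * norm gl"
      unfolding g2_def by (simp add: abs_mult mult_right_mono S'(2))
    finally have "norm (grad (cutoff m r N) x) \<le> norm g3 + 6 * K * norm gl"
      by simp
    then have "(norm (grad (cutoff m r N) x))\<^sup>2 \<le> (norm g3 + 6 * K * norm gl)\<^sup>2"
      by (intro power_mono) auto
    also have "\<dots> \<le> 2 * (norm g3)\<^sup>2 + 2 * (6 * K * norm gl)\<^sup>2"
      using sum_squares_bound[of "norm g3" "6 * K * norm gl"] by (simp add: power2_sum)
    also have "2 * (6 * K * norm gl)\<^sup>2 = 72 * K\<^sup>2 / (ln 2)\<^sup>2 * (1 / (N\<^sup>2 * (norm x)\<^sup>2))"
      unfolding norm_gl by (simp add: power_mult_distrib power_divide)
    also have "2 * (norm g3)\<^sup>2 \<le> 18 * K\<^sup>2 * (if r * x $ m \<le> 2 * (norm x)\<^sup>2 then r\<^sup>2 / (norm x) ^ 4 else 0)"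
    proof (cases "r * x $ m \<le> 2 * (norm x)\<^sup>2")
      case True
      have "norm g3 \<le> K * (3 * r / (norm x)\<^sup>2)"
        unfolding g3_def norm_scaleR using S'(2) gq(2) \<open>K \<ge> 0\<close> by (intro mult_mono) auto
      then have "(norm g3)\<^sup>2 \<le> (K * (3 * r / (norm x)\<^sup>2))\<^sup>2"
        by (intro power_mono) auto
      then show ?thesis
        using True by (simp add: power_mult_distrib power_divide flip: power_mult)
    next
      case False
      then have "q > 1"
        using \<open>x \<noteq> 0\<close> by (simp add: q_def field_simps)
      then show ?thesis
        using False S'(3) by (simp add: g3_def)
    qed
    finally have "(norm (grad (cutoff m r N) x))\<^sup>2 \<le>
        18 * K\<^sup>2 * (if r * x $ m \<le> 2 * (norm x)\<^sup>2 then r\<^sup>2 / (norm x) ^ 4 else 0)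
        + 72 * K\<^sup>2 / (ln 2)\<^sup>2 * (1 / (N\<^sup>2 * (norm x)\<^sup>2))"
      by simp
    also have "\<dots> \<le> (72 * K\<^sup>2 / (ln 2)\<^sup>2 + 18 * K\<^sup>2) * (if r * x $ m \<le> 2 * (norm x)\<^sup>2 then r\<^sup>2 / (norm x) ^ 4 else 0)
        + (72 * K\<^sup>2 / (ln 2)\<^sup>2 + 18 * K\<^sup>2) * (1 / (N\<^sup>2 * (norm x)\<^sup>2))"
      by (intro add_mono mult_right_mono) auto
    finally show ?thesis by (simp add: distrib_left)
  qed
  show ?thesis
    by (rule exI[of _ "72 * K\<^sup>2 / (ln 2)\<^sup>2 + 18 * K\<^sup>2"]) (use * in auto)
qed

section \<open>Energy of the cutoffs\<close>

lemma two_powr_minus_nat: "2 powr (- real i) = (1/2) ^ i"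
  by (simp add: powr_minus powr_realpow power_one_over inverse_eq_divide)

lemma power2_le_two_times_exp: "real N ^ 2 \<le> 2 * 2 ^ N"
proof (induction N)
  case (Suc N)
  consider "N = 0" | "N = 1" | "N = 2" | "N \<ge> 3" by linarith
  then show ?case
  proof cases
    case 4
    have "(2::real) * real N + 1 \<le> real N * real N"
      using mult_right_mono[of 3 "real N" "real N"] 4 by linarith
    then show ?thesis
      using Suc.IH by (simp add: power2_eq_square algebra_simps)
  qed (auto simp: power2_eq_square)
qed simp

lemma measure_cbox_cart:
  fixes a b :: "real ^ 'n"
  assumes "\<And>i. a $ i \<le> b $ i"
  shows "measure lborel (cbox a b) = (\<Prod>i\<in>UNIV. b $ i - a $ i)"
  using assms content_cbox_cart[of a b] by (auto simp: interval_ne_empty_cart)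

definition dyadic_box :: "nat \<Rightarrow> (real ^ 'n) set" where
  "dyadic_box j = cbox (\<chi> i. - ((1/2) ^ j)) (\<chi> i. (1/2) ^ j)"

text \<open>A thin part of the dyadic box that contains the transition layer \<open>0 \<le> r x\<^sub>m \<le> 2|x|\<^sup>2\<close> of the
  cutoff in that shell.\<close>

definition dyadic_slab :: "'n \<Rightarrow> real \<Rightarrow> nat \<Rightarrow> (real ^ 'n) set" where
  "dyadic_slab m r j = cbox (\<chi> i. if i = m then 0 else - ((1/2) ^ j))
     (\<chi> i. if i = m then 2 / r * (1/4) ^ j else (1/2) ^ j)"

lemma measure_dyadic_box: "measure lborel (dyadic_box j :: (real ^ 'n) set) = (2 * (1/2) ^ j) ^ CARD('n)"
  unfolding dyadic_box_def by (subst measure_cbox_cart) (auto intro: order_trans[of _ 0])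

lemma measure_dyadic_slab:
  assumes "r > 0"
  shows "measure lborel (dyadic_slab m r j :: (real ^ 'n::finite) set)
    = 2 / r * (1/4) ^ j * (2 * (1/2) ^ j) ^ (CARD('n) - 1)"
proof -
  have "measure lborel (dyadic_slab m r j :: (real ^ 'n) set)
     = (\<Prod>i\<in>UNIV. if i = m then 2 / r * (1/4) ^ j else 2 * (1/2) ^ j)"
    unfolding dyadic_slab_def using assms
    by (subst measure_cbox_cart) (auto intro!: prod.cong intro: order_trans[of _ 0])
  also have "\<dots> = 2 / r * (1/4) ^ j * (\<Prod>i\<in>UNIV - {m}. 2 * (1/2) ^ j)"
    by (subst prod.remove[of _ m]) (auto intro!: prod.cong)
  finally show ?thesis by (simp add: card_Diff_singleton)
qed

lemma scaled_measure_dyadic_box: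
  "(2 ^ Suc j) ^ CARD('n) * measure lborel (dyadic_box j :: (real ^ 'n) set) = 4 ^ CARD('n)"
  unfolding measure_dyadic_box power_mult_distrib[symmetric] by (simp add: power_one_over)

lemma scaled_measure_dyadic_slab:
  assumes "r > 0"
  shows "(2 ^ Suc j) ^ CARD('n) * measure lborel (dyadic_slab m r j :: (real ^ 'n::finite) set)
    = 4 ^ CARD('n) * (1/2) ^ j / r"
proof -
  obtain d where d: "CARD('n) = Suc d"
    using zero_less_card_finite[where 'a = 'n] by (metis gr0_implies_Suc)
  have "(1/4 :: real) ^ j = (1/2) ^ j * (1/2) ^ j"
    by (simp flip: power_mult_distrib)
  then have "(2 ^ Suc j) ^ CARD('n) * measure lborel (dyadic_slab m r j :: (real ^ 'n) set)
     = 2 / r * (2 ^ Suc j * (1/2) ^ j) * (1/2) ^ j * (2 ^ Suc j * (2 * (1/2) ^ j)) ^ d"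
    unfolding measure_dyadic_slab[OF assms] d power_mult_distrib by simp
  also have "(2::real) ^ Suc j * (1/2) ^ j = 2"
    by (simp add: power_one_over)
  also have "(2::real) ^ Suc j * (2 * (1/2) ^ j) = 4"
    by (simp add: power_one_over)
  finally show ?thesis by (simp add: d)
qed

text \<open>On the shell \<open>|x| \<approx> 2\<^bsup>-j\<^esup>\<close> the integrand is at most a constant times \<open>|x|\<^bsup>-n\<^esup>\<close> times \<open>1/N\<^sup>2 + 4\<^bsup>-j\<^esup>\<close>, plus
  a constant times \<open>|x|\<^bsup>-n\<^esup>\<close> on the slab: there \<open>\<Phi>\<^sup>2\<close> gains the factor \<open>x\<^sub>m\<^sup>2 \<le> 4|x|\<^sup>4/r\<^sup>2\<close>, which cancels the
  square of the large gradient. The slab fills only a fraction \<open>2\<^bsup>-j\<^esup>/r\<close> of the box. So each of the \<open>N\<close>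
  shells contributes \<open>O(1/N\<^sup>2)\<close>.\<close>

lemma cutoff_energy:
  fixes m :: "'n::finite"
  assumes "r > 0" "M \<ge> 0"
  shows "\<exists>A. \<forall>N\<ge>1::nat.
     (LINT x|lborel. (hardy_profile m x)\<^sup>2 * (norm (grad (cutoff m r N) x))\<^sup>2)
     + M * (LINT x|lborel. (hardy_profile m x * cutoff m r N x)\<^sup>2) \<le> A / N"
proof -
  obtain K where "K \<ge> 0" and K: "\<And>(m :: 'n) r N x. r > 0 \<Longrightarrow> N > 0 \<Longrightarrow> x \<noteq> 0 \<Longrightarrow>
     (norm (grad (cutoff m r N) x))\<^sup>2 \<le> K * (1 / (N\<^sup>2 * (norm x)\<^sup>2)
        + (if r * x $ m \<le> 2 * (norm x)\<^sup>2 then r\<^sup>2 / (norm x) ^ 4 else 0))"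
    using cutoff_gradient_bound[where 'n = 'n] by blast
  define A where "A = 4 ^ CARD('n) * (K + 2 * M + 8 * K / r)"
  show ?thesis
  proof (rule exI[of _ A], intro allI impI)
    fix N :: nat
    assume "N \<ge> 1"
    then have N: "real N > 0" by simp
    define v where "v = (cutoff m r (real N) :: real ^ 'n \<Rightarrow> real)"
    define F where "F = (\<lambda>x. (hardy_profile m x)\<^sup>2 * (norm (grad v x))\<^sup>2 + M * (hardy_profile m x * v x)\<^sup>2)"
    define T :: "nat \<Rightarrow> real ^ 'n \<Rightarrow> real" where "T = (\<lambda>j x. (2 ^ Suc j) ^ CARD('n) * (K / (real N)\<^sup>2 + M * (1/4) ^ j) * indicator (dyadic_box j) x
        + (2 ^ Suc j) ^ CARD('n) * (4 * K) * indicator (dyadic_slab m r j) x)"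
    have T0: "T j x \<ge> 0" for j x
      unfolding T_def using \<open>K \<ge> 0\<close> \<open>M \<ge> 0\<close> by (intro add_nonneg_nonneg mult_nonneg_nonneg) auto
    have FT: "F x \<le> (\<Sum>j\<in>{N..<N + N}. T j x)" for x
    proof (cases "grad v x = 0 \<and> v x = 0")
      case True
      then show ?thesis by (simp add: F_def sum_nonneg T0)
    next
      case False
      define \<tau> where "\<tau> = norm x"
      define t where "t = x $ m"
      have "x \<noteq> 0 \<and> 2 powr (- 2 * real N) \<le> norm x \<and> norm x \<le> 2 powr (- real N) \<and> (norm x)\<^sup>2 \<le> r * x $ m"
        using False cutoff_support[OF N] cutoff_test_function(2)[OF N \<open>r > 0\<close>] unfolding v_def by blast
      then have x: "x \<noteq> 0" "\<tau> > 0" "(1/2) ^ (N + N) \<le> \<tau>" "\<tau> \<le> (1/2) ^ N" "\<tau>\<^sup>2 \<le> r * t"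
        using two_powr_minus_nat[of N] two_powr_minus_nat[of "N + N"] by (auto simp: \<tau>_def t_def)
      obtain j where j: "j \<in> {N..<N + N}" "(1/2) ^ Suc j \<le> \<tau>" "\<tau> \<le> (1/2) ^ j"
        using dyadic_shell[OF x(3,4) \<open>N \<ge> 1\<close>] by blast
      have "r * t > 0"
        using x(2,5) zero_less_power[of \<tau> 2] by linarith
      from this have t: "t > 0" "t \<le> \<tau>"
        using zero_less_mult_pos[OF \<open>r * t > 0\<close> \<open>r > 0\<close>] component_le_norm_cart[of x m]
        unfolding t_def \<tau>_def by linarith+
      have comp: "\<bar>x $ i\<bar> \<le> (1/2) ^ j" for i
        using component_le_norm_cart[of x i] j(3) by (simp add: \<tau>_def)
      have box: "x \<in> dyadic_box j"
        using comp unfolding dyadic_box_def by (auto simp: mem_box_cart abs_le_iff minus_le_iff)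
      define ind where "ind = (if r * t \<le> 2 * \<tau>\<^sup>2 then 1 else 0 :: real)"
      have \<tau>2: "\<tau>\<^sup>2 \<le> (1/4) ^ j"
        using power_mono[OF j(3), of 2] x(2) by (simp add: power2_eq_square flip: power_mult_distrib)
      have slab: "ind \<le> indicator (dyadic_slab m r j) x"
      proof (cases "r * t \<le> 2 * \<tau>\<^sup>2")
        case True
        then have "t * r \<le> 2 * (1/4) ^ j"
          using \<tau>2 unfolding mult.commute[of t] by linarith
        then have "t \<le> 2 * (1/4) ^ j / r"
          by (simp only: pos_le_divide_eq[OF \<open>r > 0\<close>])
        then have "t \<le> 2 / r * (1/4) ^ j"
          by simp
        then have "x \<in> dyadic_slab m r j"
          using t comp unfolding dyadic_slab_def by (auto simp: mem_box_cart abs_le_iff minus_le_iff t_def)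
        then show ?thesis by (simp add: ind_def)
      qed (simp add: ind_def)
      have ind: "ind * (r * t)\<^sup>2 \<le> ind * (4 * \<tau> ^ 4)" "ind \<ge> 0"
        using power_mono[of "r * t" "2 * \<tau>\<^sup>2" 2] t \<open>r > 0\<close> by (auto simp: ind_def power_mult_distrib simp flip: power_mult)
      have tau: "1 / \<tau> ^ CARD('n) \<le> (2 ^ Suc j) ^ CARD('n)"
      proof -
        have "1 / \<tau> \<le> 2 ^ Suc j"
          using j(2) x(2) by (simp add: field_simps power_one_over)
        then have "(1 / \<tau>) ^ CARD('n) \<le> (2 ^ Suc j) ^ CARD('n)"
          using x(2) by (intro power_mono) auto
        then show ?thesis by (simp add: power_one_over)
      qed
      have hp: "(hardy_profile m x)\<^sup>2 = t\<^sup>2 / \<tau> ^ CARD('n)"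
        using hardy_profile_power2[OF x(1)] by (simp add: t_def \<tau>_def)
      have "t\<^sup>2 \<le> \<tau>\<^sup>2" using t by (intro power_mono) auto
      have "t\<^sup>2 * (norm (grad v x))\<^sup>2 \<le> t\<^sup>2 * (K * (1 / ((real N)\<^sup>2 * \<tau>\<^sup>2) + ind * r\<^sup>2 / \<tau> ^ 4))"
        using K[OF \<open>r > 0\<close> N x(1), of m] by (intro mult_left_mono) (auto simp: v_def ind_def t_def \<tau>_def)
      also have "\<dots> = K * (1 / (real N)\<^sup>2 * (t\<^sup>2 / \<tau>\<^sup>2) + ind * (r * t)\<^sup>2 / \<tau> ^ 4)"
        by (simp add: power_mult_distrib algebra_simps)
      also have "\<dots> \<le> K * (1 / (real N)\<^sup>2 * 1 + ind * (4 * \<tau> ^ 4) / \<tau> ^ 4)"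
      proof (rule mult_left_mono[OF add_mono \<open>K \<ge> 0\<close>])
        show "1 / (real N)\<^sup>2 * (t\<^sup>2 / \<tau>\<^sup>2) \<le> 1 / (real N)\<^sup>2 * 1"
          using \<open>t\<^sup>2 \<le> \<tau>\<^sup>2\<close> x(2) by (intro mult_left_mono) auto
        show "ind * (r * t)\<^sup>2 / \<tau> ^ 4 \<le> ind * (4 * \<tau> ^ 4) / \<tau> ^ 4"
          by (rule divide_right_mono[OF ind(1)]) simp
      qed
      also have "\<dots> = K / (real N)\<^sup>2 + 4 * K * ind"
        using x(2) by (simp add: algebra_simps)
      finally have 1: "t\<^sup>2 * (norm (grad v x))\<^sup>2 \<le> K / (real N)\<^sup>2 + 4 * K * ind" .
      have v1: "(v x)\<^sup>2 \<le> 1"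
        using smooth_step_nonneg smooth_step_le_1
        by (auto simp: v_def cutoff_def abs_square_le_1 abs_mult intro!: mult_le_one)
      have "t\<^sup>2 * (v x)\<^sup>2 \<le> (1/4) ^ j * 1"
        using v1 \<open>t\<^sup>2 \<le> \<tau>\<^sup>2\<close> \<tau>2 by (intro mult_mono) auto
      then have 2: "M * (t\<^sup>2 * (v x)\<^sup>2) \<le> M * (1/4) ^ j"
        using \<open>M \<ge> 0\<close> by (intro mult_left_mono) auto
      have "F x = 1 / \<tau> ^ CARD('n) * (t\<^sup>2 * (norm (grad v x))\<^sup>2 + M * (t\<^sup>2 * (v x)\<^sup>2))"
        by (simp add: F_def hp power_mult_distrib algebra_simps)
      also have "\<dots> \<le> (2 ^ Suc j) ^ CARD('n) * (K / (real N)\<^sup>2 + 4 * K * ind + M * (1/4) ^ j)"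
        using add_mono[OF 1 2] \<open>M \<ge> 0\<close> by (intro mult_mono[OF tau]) auto
      also have "\<dots> = (2 ^ Suc j) ^ CARD('n) * (K / (real N)\<^sup>2 + M * (1/4) ^ j) + (2 ^ Suc j) ^ CARD('n) * (4 * K) * ind"
        by (simp add: algebra_simps)
      also have "\<dots> \<le> T j x"
        unfolding T_def using box slab \<open>K \<ge> 0\<close>
        by (intro add_mono mult_left_mono) (auto simp: indicator_def)
      also have "\<dots> \<le> (\<Sum>j\<in>{N..<N + N}. T j x)"
        using j(1) T0 by (intro member_le_sum) auto
      finally show ?thesis .
    qed
    have vt: "v \<in> test_functions (ball (r *\<^sub>R axis m 1) r)"
      unfolding v_def by (rule cutoff_test_function(1)[OF N \<open>r > 0\<close>])
    have sub: "ball (r *\<^sub>R axis m 1) r \<subseteq> (- {0} :: (real ^ 'n) set)"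
      by auto
    have v0: "v \<in> test_functions (- {0})"
      by (rule test_functions_mono[OF vt sub])
    have int1: "integrable lborel (\<lambda>x. (hardy_profile m x)\<^sup>2 * (norm (grad v x))\<^sup>2)"
      by (rule ground_state_representation(2)[OF v0])
    have u: "(\<lambda>x. hardy_profile m x * v x) \<in> test_functions (- {0})"
      by (rule test_functions_mult[OF _ smooth_on_hardy_profile v0]) auto
    have int2: "integrable lborel (\<lambda>x. (hardy_profile m x * v x)\<^sup>2)"
      by (rule test_functions_integrable_power2[OF u])
    have fin: "emeasure lborel (dyadic_box j :: (real ^ 'n) set) < \<infinity>"
      "emeasure lborel (dyadic_slab m r j :: (real ^ 'n) set) < \<infinity>" for j
      unfolding dyadic_box_def dyadic_slab_def by (rule emeasure_bounded_finite[OF bounded_cbox])+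
    have ind_int: "integrable lborel (indicator (dyadic_box j) :: real ^ 'n \<Rightarrow> real)"
       "integrable lborel (indicator (dyadic_slab m r j) :: real ^ 'n \<Rightarrow> real)" for j
      using fin by (auto intro!: integrable_real_indicator simp: dyadic_box_def dyadic_slab_def)
    have T_int: "integrable lborel (T j)" for j
      unfolding T_def by (intro Bochner_Integration.integrable_add integrable_mult_right ind_int)
    have T_val: "(LINT x|lborel. T j x) \<le> A / (real N)\<^sup>2" if "j \<ge> N" for j
    proof -
      have "(LINT x|lborel. T j x) = (2 ^ Suc j) ^ CARD('n) * (K / (real N)\<^sup>2 + M * (1/4) ^ j) * measure lborel (dyadic_box j :: (real ^ 'n) set)
         + (2 ^ Suc j) ^ CARD('n) * (4 * K) * measure lborel (dyadic_slab m r j :: (real ^ 'n) set)"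
        unfolding T_def using ind_int[of j] by simp
      also have "\<dots> = ((2 ^ Suc j) ^ CARD('n) * measure lborel (dyadic_box j :: (real ^ 'n) set)) * (K / (real N)\<^sup>2 + M * (1/4) ^ j)
         + ((2 ^ Suc j) ^ CARD('n) * measure lborel (dyadic_slab m r j :: (real ^ 'n) set)) * (4 * K)"
        by (simp only: mult_ac)
      also have "\<dots> = 4 ^ CARD('n) * (K / (real N)\<^sup>2 + M * (1/4) ^ j + 4 * K / r * (1/2) ^ j)"
        unfolding scaled_measure_dyadic_box scaled_measure_dyadic_slab[OF \<open>r > 0\<close>]
        by (simp add: algebra_simps)
      also have "\<dots> \<le> 4 ^ CARD('n) * (K / (real N)\<^sup>2 + M * (2 / (real N)\<^sup>2) + 4 * K / r * (2 / (real N)\<^sup>2))"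
      proof -
        have "(1/2 :: real) ^ j \<le> (1/2) ^ N"
          using that by (intro power_decreasing) auto
        also have "\<dots> \<le> 2 / (real N)\<^sup>2"
          using power2_le_two_times_exp[of N] N by (simp add: field_simps power_one_over)
        finally have h: "(1/2 :: real) ^ j \<le> 2 / (real N)\<^sup>2" .
        moreover have "(1/4 :: real) ^ j \<le> (1/2) ^ j"
          by (intro power_mono) auto
        ultimately show ?thesis
          using \<open>K \<ge> 0\<close> \<open>M \<ge> 0\<close> \<open>r > 0\<close> by (intro mult_left_mono add_mono) auto
      qed
      also have "\<dots> = A / (real N)\<^sup>2"
        by (simp add: A_def add_divide_distrib algebra_simps)
      finally show ?thesis .
    qed
    have "(LINT x|lborel. (hardy_profile m x)\<^sup>2 * (norm (grad v x))\<^sup>2) + M * (LINT x|lborel. (hardy_profile m x * v x)\<^sup>2)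
      = (LINT x|lborel. F x)"
      unfolding F_def using int1 int2 by simp
    also have "\<dots> \<le> (LINT x|lborel. (\<Sum>j\<in>{N..<N + N}. T j x))"
      by (rule integral_mono) (use int1 int2 T_int FT in \<open>auto simp: F_def\<close>)
    also have "\<dots> = (\<Sum>j\<in>{N..<N + N}. LINT x|lborel. T j x)"
      by (rule Bochner_Integration.integral_sum) (rule T_int)
    also have "\<dots> \<le> (\<Sum>j\<in>{N..<N + N}. A / (real N)\<^sup>2)"
      using T_val by (intro sum_mono) auto
    also have "\<dots> = A / N"
      using N by (simp add: power2_eq_square)
    finally show "(LINT x|lborel. (hardy_profile m x)\<^sup>2 * (norm (grad (cutoff m r N) x))\<^sup>2)
      + M * (LINT x|lborel. (hardy_profile m x * cutoff m r N x)\<^sup>2) \<le> A / N"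
      by (simp add: v_def)
  qed
qed

section \<open>Lower bounds by dyadic shells\<close>

text \<open>A ball in the \<open>j\<close>-th dyadic shell, close to the axis, where \<open>x\<^sub>m\<close> is comparable with \<open>|x|\<close>.\<close>

definition shell_ball :: "'n \<Rightarrow> nat \<Rightarrow> (real ^ 'n) set" where
  "shell_ball m j = ball ((3/4 * (1/2) ^ j) *\<^sub>R axis m 1) (1/8 * (1/2) ^ j)"

lemma shell_ball_bounds:
  assumes "x \<in> shell_ball m j"
  shows "5/8 * (1/2) ^ j < x $ m" "norm x < (1/2) ^ j" "(1/2) ^ Suc j < norm x" "x \<noteq> 0" 
proof -
  define h :: real where "h = (1/2) ^ j"
  have "h > 0" by (simp add: h_def)
  have d: "norm (x - (3/4 * h) *\<^sub>R axis m 1) < 1/8 * h"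
    using assms by (simp add: shell_ball_def dist_norm norm_minus_commute h_def)
  then have "\<bar>x $ m - 3/4 * h\<bar> < 1/8 * h"
    using component_le_norm_cart[of "x - (3/4 * h) *\<^sub>R axis m 1" m] by simp
  then show 1: "5/8 * (1/2) ^ j < x $ m"
    unfolding h_def[symmetric] by linarith
  have "norm x \<le> norm (x - (3/4 * h) *\<^sub>R axis m 1) + norm ((3/4 * h) *\<^sub>R axis m (1::real) :: real ^ 'a)"
    using norm_triangle_ineq[of "x - (3/4 * h) *\<^sub>R axis m 1" "(3/4 * h) *\<^sub>R axis m 1"] by simp
  then show "norm x < (1/2) ^ j"
    using d \<open>h > 0\<close> by (simp add: h_def[symmetric])
  show "(1/2) ^ Suc j < norm x"
    using 1 component_le_norm_cart[of x m] \<open>h > 0\<close> by (simp add: h_def[symmetric])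
  then show "x \<noteq> 0" by auto
qed

text \<open>The balls are disjoint and the volume of the \<open>j\<close>-th one is a fixed multiple of \<open>2\<^bsup>-jn\<^esup>\<close>, so every
  shell contributes the same amount.\<close>

lemma integral_ge_shell_balls:
  fixes G :: "real ^ 'n::finite \<Rightarrow> real"
  assumes "integrable lborel G" "\<And>x. G x \<ge> 0" "c \<ge> 0" "finite J"
    and G: "\<And>j x. j \<in> J \<Longrightarrow> x \<in> shell_ball m j \<Longrightarrow> G x \<ge> c * (2 ^ j) ^ CARD('n)"
  shows "(LINT x|lborel. G x) \<ge> real (card J) * (c * (unit_ball_vol (CARD('n)) / 8 ^ CARD('n)))"
proof -
  define T :: "nat \<Rightarrow> real ^ 'n \<Rightarrow> real" where
    "T = (\<lambda>j x. c * (2 ^ j) ^ CARD('n) * indicator (shell_ball m j) x)"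
  have T_int: "integrable lborel (T j)" for j
    unfolding T_def using emeasure_bounded_finite[OF bounded_ball]
    by (intro integrable_mult_right integrable_real_indicator) (auto simp: shell_ball_def)
  have T_val: "(LINT x|lborel. T j x) = c * (unit_ball_vol (CARD('n)) / 8 ^ CARD('n))" for j
  proof -
    have "(LINT x|lborel. T j x) = c * (2 ^ j) ^ CARD('n) * measure lborel (shell_ball m j :: (real ^ 'n) set)"
      unfolding T_def by simp
    also have "measure lborel (shell_ball m j :: (real ^ 'n) set) = unit_ball_vol (CARD('n)) * (1/8 * (1/2) ^ j) ^ CARD('n)"
      unfolding shell_ball_def by (subst content_ball) auto
    also have "c * (2 ^ j) ^ CARD('n) * \<dots> = c * (unit_ball_vol (CARD('n)) * (2 ^ j * (1/8 * (1/2) ^ j)) ^ CARD('n))"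
      unfolding power_mult_distrib[of "2 ^ j" "1/8 * (1/2) ^ j"] by (simp only: mult_ac)
    also have "(2::real) ^ j * (1/8 * (1/2) ^ j) = 1/8"
      by (simp add: power_one_over)
    finally show ?thesis by (simp add: power_one_over)
  qed
  have TG: "(\<Sum>j\<in>J. T j x) \<le> G x" for x
  proof (cases "\<exists>j\<in>J. x \<in> shell_ball m j")
    case True
    then obtain j where j: "j \<in> J" "x \<in> shell_ball m j" by blast
    have "x \<notin> shell_ball m i" if "i \<noteq> j" for i
    proof
      assume i: "x \<in> shell_ball m i"
      have "(1/2 :: real) ^ i \<le> (1/2) ^ Suc j \<or> (1/2 :: real) ^ j \<le> (1/2) ^ Suc i"
        using that by (cases "i < j") (auto intro!: power_decreasing simp del: power_Suc)
      then show False
        using shell_ball_bounds(2,3)[OF i] shell_ball_bounds(2,3)[OF j(2)] by linarith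
    qed
    then have "(\<Sum>i\<in>J. T i x) = (\<Sum>i\<in>J. if i = j then T j x else 0)"
      by (intro sum.cong) (auto simp: T_def)
    also have "\<dots> = T j x"
      using j \<open>finite J\<close> by simp
    also have "\<dots> \<le> G x"
      using G[OF j] j by (simp add: T_def)
    finally show ?thesis .
  next
    case False
    then have "(\<Sum>j\<in>J. T j x) = 0"
      by (intro sum.neutral) (auto simp: T_def)
    then show ?thesis using assms(2) by simp
  qed
  have "real (card J) * (c * (unit_ball_vol (CARD('n)) / 8 ^ CARD('n))) = (\<Sum>j\<in>J. LINT x|lborel. T j x)"
    by (simp add: T_val)
  also have "\<dots> = (LINT x|lborel. (\<Sum>j\<in>J. T j x))"
    by (rule Bochner_Integration.integral_sum[symmetric]) (rule T_int)
  also have "\<dots> \<le> (LINT x|lborel. G x)"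
    by (rule integral_mono) (use T_int assms(1) TG in auto)
  finally show ?thesis .
qed

text \<open>The shells with \<open>4k \<le> j < 5k\<close> are the ones with radial level between 4/3 and 5/3 for \<open>N = 3k\<close>.\<close>

lemma cutoff_eq_1:
  assumes "r > 0" "k \<ge> 1" "(1/2) ^ (4 * k) \<le> 5/16 * r" "j \<in> {4 * k..<5 * k}" "x \<in> shell_ball m j"
  shows "cutoff m r (real (3 * k)) x = 1"
proof -
  note b = shell_ball_bounds[OF assms(5)]
  define N where "N = real (3 * k)"
  have N: "N > 0" using assms by (simp add: N_def)
  have j: "4 * k \<le> j" "Suc j \<le> 5 * k"
    using assms(4) by auto
  have pj: "(1/2 :: real) ^ j \<le> (1/2) ^ (4 * k)" "(1/2 :: real) ^ (5 * k) \<le> (1/2) ^ Suc j"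
    by (rule power_decreasing; use j in simp)+
  have "norm x \<le> (1/2) ^ (4 * k)"
    using b(2) pj(1) by linarith
  then have "radial_level N x \<ge> 4/3"
    unfolding radial_level_ge_iff[OF N b(4)] using two_powr_minus_nat[of "4 * k"] by (simp add: N_def)
  then have 1: "smooth_step (3 * (radial_level N x - 1)) = 1"
    by (intro smooth_step_eq_1) simp
  have "norm x \<ge> (1/2) ^ (5 * k)"
    using b(3) pj(2) by linarith
  then have "radial_level N x \<le> 5/3"
    unfolding radial_level_le_iff[OF N b(4)] using two_powr_minus_nat[of "5 * k"] by (simp add: N_def)
  then have 2: "smooth_step (3 * (2 - radial_level N x)) = 1"
    by (intro smooth_step_eq_1) simp
  define h :: real where "h = (1/2) ^ j"
  have h: "h > 0" "h \<le> 5/16 * r"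
    using order_trans[OF pj(1) assms(3)] unfolding h_def by simp_all
  have "(norm x)\<^sup>2 \<le> h * h"
    unfolding power2_eq_square using b(2) by (intro mult_mono) (auto simp: h_def)
  also have "2 * (h * h) \<le> r * (5/8 * h)"
    using mult_left_mono[OF h(2), of "2 * h"] h(1) by (simp add: algebra_simps)
  also have "\<dots> \<le> r * x $ m"
    using b(1) assms(1) by (intro mult_left_mono) (auto simp: h_def)
  finally have "2 * (norm x)\<^sup>2 \<le> r * x $ m" by simp
  then have "smooth_step (r * x $ m / (norm x)\<^sup>2 - 1) = 1"
    using b(4) by (intro smooth_step_eq_1) (simp add: field_simps)
  then show ?thesis
    using 1 2 by (simp add: cutoff_def N_def)
qed

section \<open>The weight and the inequality on the whole space\<close>

lemma norm_le_sup_norm_on: "bounded \<Omega> \<Longrightarrow> x \<in> \<Omega> \<Longrightarrow> norm x \<le> sup_norm_on \<Omega>"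
  unfolding sup_norm_on_def
  by (rule cSUP_upper) (auto intro!: bdd_aboveI2 simp: bounded_iff image_def bdd_above_def)

lemma X1_bounds:
  assumes "0 < t" "t < 1"
  shows "0 < X1 t" "X1 t \<le> 1"
proof -
  have "ln t < 0" using assms by simp
  then show "0 < X1 t" "X1 t \<le> 1" by (simp_all add: X1_def)
qed

lemma X1_mono:
  assumes "0 < s" "s \<le> t" "t < 1"
  shows "X1 s \<le> X1 t"
proof -
  have "ln s \<le> ln t" "ln t < 0" using assms by auto
  then show ?thesis
    unfolding X1_def by (intro divide_left_mono mult_pos_pos) auto
qed

text \<open>Test functions vanish outside the domain, so all integrals may be taken over the whole space.\<close>

lemma hardy_sobolev_ineq_iff:
  fixes \<Omega> :: "(real ^ 'n) set"
  defines "n \<equiv> real CARD('n)"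
  shows "hardy_sobolev_ineq \<Omega> \<mu> c p C \<longleftrightarrow> (\<forall>u\<in>test_functions \<Omega>.
     c * (LINT x|lborel. (u x)\<^sup>2 / (norm x)\<^sup>2)
       + C * (LINT x|lborel. X1 (norm x / (3 * sup_norm_on \<Omega>)) powr p * \<bar>u x\<bar> powr (2 * n / (n - 2))) powr ((n - 2) / n)
     \<le> (LINT x|lborel. (norm (grad u x))\<^sup>2) + \<mu> * (LINT x|lborel. (u x)\<^sup>2))"
proof -
  have 0: "u x = 0 \<and> grad u x = 0" if "u \<in> test_functions \<Omega>" "x \<notin> \<Omega>" for u x
    using that not_in_supp[of x u] grad_outside_supp[of x u] by (auto simp: test_functions_iff)
  have 1: "(LINT x:\<Omega>|lborel. (norm (grad u x))\<^sup>2) = (LINT x|lborel. (norm (grad u x))\<^sup>2)"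
    "(LINT x:\<Omega>|lborel. (u x)\<^sup>2) = (LINT x|lborel. (u x)\<^sup>2)"
    "(LINT x:\<Omega>|lborel. (u x)\<^sup>2 / (norm x)\<^sup>2) = (LINT x|lborel. (u x)\<^sup>2 / (norm x)\<^sup>2)"
    "(LINT x:\<Omega>|lborel. X1 (norm x / D) powr p * \<bar>u x\<bar> powr q) = (LINT x|lborel. X1 (norm x / D) powr p * \<bar>u x\<bar> powr q)"
    if "u \<in> test_functions \<Omega>" for u D q
    by (rule set_integral_eq_integral, use 0[OF that] in simp)+
  show ?thesis
    unfolding hardy_sobolev_ineq_def Let_def n_def by (intro ball_cong refl) (simp only: 1)
qed

lemma test_functions_integrable_weighted:
  assumes "u \<in> test_functions \<Omega>" "0 \<notin> \<Omega>" "D > 0" "\<And>x. x \<in> \<Omega> \<Longrightarrow> norm x \<le> D" "q > 0"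
  shows "integrable lborel (\<lambda>x. X1 (norm x / (3 * D)) powr p * \<bar>u x\<bar> powr q)"
proof (rule integrable_compact_support[of "supp u"])
  have x: "x \<noteq> 0" "norm x / (3 * D) > 0" "norm x / (3 * D) < 1" if "x \<in> supp u" for x
  proof -
    show "x \<noteq> 0" using assms(1,2) that by (auto simp: test_functions_iff)
    then show "norm x / (3 * D) > 0" using \<open>D > 0\<close> by simp
    have "norm x \<le> D" using assms(1,4) that by (auto simp: test_functions_iff)
    then show "norm x / (3 * D) < 1" using \<open>D > 0\<close> by simp
  qed
  have ne: "1 - ln (norm x / (3 * D)) \<noteq> 0" "X1 (norm x / (3 * D)) \<noteq> 0" if "x \<in> supp u" for x
    using X1_bounds(1)[OF x(2,3)[OF that]] ln_less_zero[OF x(2,3)[OF that]] by linarith+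
  have "continuous_on (supp u) (\<lambda>x. X1 (norm x / (3 * D)))"
    unfolding X1_def using ne x \<open>D > 0\<close> by (intro continuous_intros) auto
  then show "continuous_on (supp u) (\<lambda>x. X1 (norm x / (3 * D)) powr p * \<bar>u x\<bar> powr q)"
    using ne \<open>q > 0\<close>
    by (intro continuous_on_mult continuous_on_powr continuous_on_powr' continuous_on_const
        continuous_on_rabs test_functions_continuous_on[OF assms(1)]) auto
  show "compact (supp u)" using assms(1) by (simp add: test_functions_iff)
  show "X1 (norm x / (3 * D)) powr p * \<bar>u x\<bar> powr q = 0" if "x \<notin> supp u" for x
    using not_in_supp[OF that] by simp
qed

section \<open>Sharpness of the constant and of the exponent\<close>

text \<open>Two disjoint balls have centers at distance at least the sum of the radii. Here both touch the
  origin, so equality holds in the triangle inequality and the centers lie on opposite rays.\<close>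

lemma interior_ball_tangent:
  fixes e y :: "'a::euclidean_space"
  assumes "norm e = 1" "\<rho> > 0" "r > 0" "norm y = r" "ball (- \<rho> *\<^sub>R e) \<rho> \<inter> ball y r = {}"
  shows "y = r *\<^sub>R e"
proof -
  define d where "d = norm (y + \<rho> *\<^sub>R e)"
  have "d \<ge> r + \<rho>"
  proof (rule ccontr)
    assume "\<not> d \<ge> r + \<rho>"
    then have d: "d / (r + \<rho>) < 1" using assms by simp
    define z where "z = y - (r / (r + \<rho>)) *\<^sub>R (y + \<rho> *\<^sub>R e)"
    have "norm (y - z) = r / (r + \<rho>) * d"
      using assms by (simp add: z_def d_def)
    also have "\<dots> < r"
      using mult_strict_left_mono[OF d \<open>r > 0\<close>] by simp
    finally have zy: "z \<in> ball y r" by (simp add: dist_norm)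
    have "z + \<rho> *\<^sub>R e = (1 - r / (r + \<rho>)) *\<^sub>R (y + \<rho> *\<^sub>R e)"
      by (simp add: z_def algebra_simps)
    moreover have "1 - r / (r + \<rho>) = \<rho> / (r + \<rho>)"
      using assms by (simp add: field_simps)
    ultimately have "norm (z + \<rho> *\<^sub>R e) = \<rho> / (r + \<rho>) * d"
      using assms by (simp add: d_def)
    then have "norm (z + \<rho> *\<^sub>R e) < \<rho>"
      using mult_strict_left_mono[OF d \<open>\<rho> > 0\<close>] by simp
    then have "z \<in> ball (- \<rho> *\<^sub>R e) \<rho>"
      by (simp add: dist_norm norm_minus_commute[of _ z])
    then show False using zy assms(5) by blast
  qed
  then have "norm (y + \<rho> *\<^sub>R e) = norm y + norm (\<rho> *\<^sub>R e)"
    using norm_triangle_ineq[of y "\<rho> *\<^sub>R e"] assms by (simp add: d_def)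
  then have "norm y *\<^sub>R (\<rho> *\<^sub>R e) = norm (\<rho> *\<^sub>R e) *\<^sub>R y"
    by (simp only: norm_triangle_eq)
  then have "\<rho> *\<^sub>R (r *\<^sub>R e) = \<rho> *\<^sub>R y"
    using assms by (simp add: mult.commute)
  then show ?thesis
    using \<open>\<rho> > 0\<close> by (metis less_irrefl scaleR_cancel_left)
qed

text \<open>The exponent \<open>2n/(n-2)\<close> turns the homogeneity degree \<open>1 - n/2\<close> of the profile into \<open>-n\<close>, the
  scale-invariant degree.\<close>

lemma hardy_profile_powr:
  fixes x :: "real ^ 'n::finite"
  assumes "x \<noteq> 0" "x $ m \<ge> 0" "CARD('n) \<ge> 3"
  defines "n \<equiv> real CARD('n)"
  shows "hardy_profile m x powr (2 * n / (n - 2)) = (x $ m / norm x) powr (2 * n / (n - 2)) / norm x ^ CARD('n)"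
proof -
  have n: "n - 2 \<noteq> 0" using assms(3) by (simp add: n_def)
  have "(norm x)\<^sup>2 = norm x powr 2"
    using assms by simp
  then have 1: "(norm x)\<^sup>2 powr (- n / 4) = norm x powr (- n / 2)"
    by (simp only: powr_powr) simp
  have "hardy_profile m x = (x $ m / norm x) * (norm x powr 1 * norm x powr (- n / 2))"
    using assms 1 by (simp add: hardy_profile_def n_def)
  also have "\<dots> = (x $ m / norm x) * norm x powr (1 - n / 2)"
    by (simp only: powr_add[symmetric]) simp
  finally have "hardy_profile m x powr (2 * n / (n - 2)) =
      (x $ m / norm x) powr (2 * n / (n - 2)) * norm x powr ((1 - n / 2) * (2 * n / (n - 2)))"
    using assms(1,2) by (simp only: powr_mult powr_powr divide_nonneg_nonneg norm_ge_zero powr_ge_zero)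
  also have "(1 - n / 2) * (2 * n / (n - 2)) = - n"
    using n by (simp add: field_simps)
  also have "norm x powr - n = 1 / norm x ^ CARD('n)"
    using assms by (simp add: n_def powr_minus powr_realpow inverse_eq_divide)
  finally show ?thesis by simp
qed

text \<open>For \<open>2\<^bsup>-5k\<^esup> \<le> \<tau> \<le> D\<close> the logarithm of \<open>3D/\<tau>\<close> is positive and \<open>O(k)\<close>.\<close>

lemma X1_lower_bound:
  assumes "D > 0" "k \<ge> (1::nat)" "(1/2) ^ (5 * k) \<le> \<tau>" "\<tau> \<le> D"
  shows "1 / ((6 + \<bar>ln (3 * D)\<bar>) * real k) \<le> X1 (\<tau> / (3 * D))"
proof -
  have "\<tau> > 0"
    using assms(3) by (rule less_le_trans[rotated]) simp
  have "ln (\<tau> / (3 * D)) < 0"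
    using assms \<open>\<tau> > 0\<close> by (intro ln_less_zero) auto
  have "ln ((1/2 :: real) ^ (5 * k)) = - (real (5 * k) * ln 2)"
    by (simp add: ln_realpow ln_div)
  moreover have "ln ((1/2 :: real) ^ (5 * k)) \<le> ln \<tau>"
    using assms(3) \<open>\<tau> > 0\<close> by (subst ln_le_cancel_iff) auto
  moreover have "real (5 * k) * ln 2 \<le> real (5 * k) * 1"
    by (rule mult_left_mono) (use ln_2_less_1 in auto)
  moreover have "ln (\<tau> / (3 * D)) = ln \<tau> - ln (3 * D)"
    using \<open>\<tau> > 0\<close> assms by (subst ln_div) auto
  moreover have "(1 + \<bar>ln (3 * D)\<bar>) * 1 \<le> (1 + \<bar>ln (3 * D)\<bar>) * real k"
    using assms by (intro mult_left_mono) auto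
  ultimately have "1 - ln (\<tau> / (3 * D)) \<le> (6 + \<bar>ln (3 * D)\<bar>) * real k"
    by (simp add: algebra_simps)
  then show ?thesis
    unfolding X1_def using \<open>ln (\<tau> / (3 * D)) < 0\<close> \<open>k \<ge> 1\<close> by (intro divide_left_mono mult_pos_pos add_pos_nonneg) auto
qed

text \<open>The functions \<open>\<Phi> v\<close> with \<open>v\<close> the cutoff for \<open>N = 3k\<close>. The exponent \<open>max p 0\<close> appears because for
  negative \<open>p\<close> the weight is simply at least 1.\<close>

lemma concentrating_family:
  fixes \<Omega> :: "(real ^ 'n::finite) set" and m :: 'n
  defines "n \<equiv> real CARD('n)" and "D \<equiv> sup_norm_on \<Omega>"
  assumes "CARD('n) \<ge> 3" "bounded \<Omega>" "0 \<notin> \<Omega>" "r > 0" "ball (r *\<^sub>R axis m 1) r \<subseteq> \<Omega>" "\<mu> \<ge> 0"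
  shows "\<exists>A a B (k0::nat). a > 0 \<and> B > 0 \<and> (\<forall>k::nat. k0 \<le> k \<longrightarrow> (\<exists>u\<in>test_functions \<Omega>.
      (LINT x|lborel. (norm (grad u x))\<^sup>2) + \<mu> * (LINT x|lborel. (u x)\<^sup>2)
         \<le> n\<^sup>2 / 4 * (LINT x|lborel. (u x)\<^sup>2 / (norm x)\<^sup>2) + A / real k
      \<and> a * real k \<le> (LINT x|lborel. (u x)\<^sup>2 / (norm x)\<^sup>2)
      \<and> (\<forall>p. a * real k * (1 / (B * real k)) powr (max p 0)
          \<le> (LINT x|lborel. X1 (norm x / (3 * D)) powr p * \<bar>u x\<bar> powr (2 * n / (n - 2))))))"
proof -
  define q where "q = 2 * n / (n - 2)"
  have "q > 0" using assms(3) by (simp add: q_def n_def)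
  have "r *\<^sub>R axis m 1 \<in> \<Omega>"
    using assms(6,7) by (auto intro: subsetD)
  then have "D \<ge> r"
    using norm_le_sup_norm_on[OF \<open>bounded \<Omega>\<close>] \<open>r > 0\<close> by (force simp: D_def)
  then have "D > 0" using \<open>r > 0\<close> by simp
  have le_D: "norm x \<le> D" if "x \<in> \<Omega>" for x
    unfolding D_def by (rule norm_le_sup_norm_on[OF \<open>bounded \<Omega>\<close> that])
  define V where "V = unit_ball_vol n / 8 ^ CARD('n)"
  have "V > 0" by (simp add: V_def n_def)
  define a where "a = min ((5/8)\<^sup>2) ((5/8) powr q) * V"
  have "a > 0" using \<open>V > 0\<close> by (simp add: a_def)
  define B where "B = 6 + \<bar>ln (3 * D)\<bar>"
  have "B > 0" by (simp add: B_def)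
  obtain A where A: "\<And>N. (1::nat) \<le> N \<Longrightarrow>
     (LINT x|lborel. (hardy_profile m x)\<^sup>2 * (norm (grad (cutoff m r N) x))\<^sup>2)
     + \<mu> * (LINT x|lborel. (hardy_profile m x * cutoff m r N x)\<^sup>2) \<le> A / N"
    using cutoff_energy[OF \<open>r > 0\<close> \<open>\<mu> \<ge> 0\<close>, of m] by blast
  obtain k1 where k1: "(1/2 :: real) ^ k1 < 5/16 * r"
    using real_arch_pow_inv[of "5/16 * r" "1/2"] \<open>r > 0\<close> by auto
  show ?thesis
  \<comment> \<open>\<open>k1\<close> makes the chosen balls small enough to lie where the third factor of the cutoff is 1.\<close>
  proof (rule exI[of _ "A / 3"], rule exI[of _ a], rule exI[of _ B], rule exI[of _ "max 1 k1"], intro conjI allI impI)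
    fix k :: nat
    assume "max 1 k1 \<le> k"
    then have k: "k \<ge> 1" "k1 \<le> 4 * k" by auto
    have small: "(1/2) ^ (4 * k) \<le> 5/16 * r"
      by (rule order_trans[OF power_decreasing[OF k(2)]]) (use k1 in auto)
    define v where "v = (cutoff m r (real (3 * k)) :: real ^ 'n \<Rightarrow> real)"
    define u where "u = (\<lambda>x. hardy_profile m x * v x)"
    have N: "real (3 * k) > 0" using k by simp
    have sub: "ball (r *\<^sub>R axis m 1) r \<subseteq> (- {0} :: (real ^ 'n) set)"
      by auto
    have vt: "v \<in> test_functions (ball (r *\<^sub>R axis m 1) r)"
      unfolding v_def by (rule cutoff_test_function(1)[OF N \<open>r > 0\<close>])
    have v0: "v \<in> test_functions (- {0})"
      by (rule test_functions_mono[OF vt sub])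
    have "u \<in> test_functions (ball (r *\<^sub>R axis m 1) r)"
      unfolding u_def
      by (rule test_functions_mult[OF open_ball smooth_on_subset[OF smooth_on_hardy_profile sub] vt])
    then have u: "u \<in> test_functions \<Omega>"
      by (rule test_functions_mono) (rule assms(7))
    have u_eq: "u x = hardy_profile m x" if "j \<in> {4 * k..<5 * k}" "x \<in> shell_ball m j" for j x
      using cutoff_eq_1[OF \<open>r > 0\<close> k(1) small that] by (simp add: u_def v_def)
    have in_\<Omega>: "x \<in> \<Omega>" if "u x \<noteq> 0" for x
      using u not_in_supp[of x u] that by (auto simp: test_functions_iff)
    have shell: "0 < x $ m / norm x" "5/8 \<le> x $ m / norm x" "(2 ^ j) ^ CARD('n) \<le> 1 / norm x ^ CARD('n)"
      "u x \<noteq> 0" "(1/2) ^ (5 * k) \<le> norm x"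
      if "j \<in> {4 * k..<5 * k}" "x \<in> shell_ball m j" for j x
    proof -
      note b = shell_ball_bounds[OF that(2)]
      have "5/8 * norm x \<le> x $ m" using b(1,2) by linarith
      then show *: "5/8 \<le> x $ m / norm x" using b(4) by (simp add: field_simps)
      then show "0 < x $ m / norm x" by linarith
      then have "x $ m > 0" using b(4) by (simp add: zero_less_divide_iff)
      then show "u x \<noteq> 0" using b(4) u_eq[OF that] by (simp add: hardy_profile_def)
      have "2 ^ j \<le> 1 / norm x" using b(2,4) by (simp add: field_simps power_one_over)
      then have "(2 ^ j) ^ CARD('n) \<le> (1 / norm x) ^ CARD('n)" by (intro power_mono) auto
      then show "(2 ^ j) ^ CARD('n) \<le> 1 / norm x ^ CARD('n)" by (simp add: power_one_over)
      have "(1/2 :: real) ^ (5 * k) \<le> (1/2) ^ Suc j"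
        by (rule power_decreasing) (use that in auto)
      then show "(1/2) ^ (5 * k) \<le> norm x" using b(3) by linarith
    qed
    show "\<exists>u\<in>test_functions \<Omega>.
      (LINT x|lborel. (norm (grad u x))\<^sup>2) + \<mu> * (LINT x|lborel. (u x)\<^sup>2)
         \<le> n\<^sup>2 / 4 * (LINT x|lborel. (u x)\<^sup>2 / (norm x)\<^sup>2) + A / 3 / k
      \<and> a * k \<le> (LINT x|lborel. (u x)\<^sup>2 / (norm x)\<^sup>2)
      \<and> (\<forall>p. a * k * (1 / (B * k)) powr (max p 0)
          \<le> (LINT x|lborel. X1 (norm x / (3 * D)) powr p * \<bar>u x\<bar> powr (2 * n / (n - 2))))"
    proof (intro bexI[OF _ u] conjI allI)
      have "(LINT x|lborel. (norm (grad u x))\<^sup>2) = n\<^sup>2 / 4 * (LINT x|lborel. (u x)\<^sup>2 / (norm x)\<^sup>2)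
         + (LINT x|lborel. (hardy_profile m x)\<^sup>2 * (norm (grad v x))\<^sup>2)"
        unfolding u_def n_def by (rule ground_state_representation(1)[OF v0])
      moreover have "(LINT x|lborel. (hardy_profile m x)\<^sup>2 * (norm (grad v x))\<^sup>2) + \<mu> * (LINT x|lborel. (u x)\<^sup>2) \<le> A / 3 / k"
        using A[of "3 * k"] k by (simp add: u_def v_def)
      ultimately show "(LINT x|lborel. (norm (grad u x))\<^sup>2) + \<mu> * (LINT x|lborel. (u x)\<^sup>2)
         \<le> n\<^sup>2 / 4 * (LINT x|lborel. (u x)\<^sup>2 / (norm x)\<^sup>2) + A / 3 / k"
        by linarith
    next
      have "real (card {4 * k..<5 * k}) * ((5/8)\<^sup>2 * (unit_ball_vol (CARD('n)) / 8 ^ CARD('n)))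
         \<le> (LINT x|lborel. (u x)\<^sup>2 / (norm x)\<^sup>2)"
      proof (rule integral_ge_shell_balls[where m = m])
        fix j x
        assume j: "j \<in> {4 * k..<5 * k}" "x \<in> shell_ball m j"
        have x: "x \<noteq> 0" by (rule shell_ball_bounds[OF j(2)])
        have "(5/8)\<^sup>2 * (2 ^ j) ^ CARD('n) \<le> (x $ m / norm x)\<^sup>2 * (1 / norm x ^ CARD('n))"
          using shell(2,3)[OF j] by (intro mult_mono power_mono) auto
        also have "\<dots> = (u x)\<^sup>2 / (norm x)\<^sup>2"
          unfolding u_eq[OF j] hardy_profile_power2[OF x] by (simp add: power_divide)
        finally show "(5/8)\<^sup>2 * (2 ^ j) ^ CARD('n) \<le> (u x)\<^sup>2 / (norm x)\<^sup>2" .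
      qed (use test_functions_integrable_hardy[OF u \<open>0 \<notin> \<Omega>\<close>] in auto)
      moreover have "a * k \<le> (5/8)\<^sup>2 * V * k"
        unfolding a_def using \<open>V > 0\<close> by (intro mult_right_mono) auto
      ultimately show "a * k \<le> (LINT x|lborel. (u x)\<^sup>2 / (norm x)\<^sup>2)"
        by (simp add: V_def n_def algebra_simps)
    next
      fix p
      define w where "w = (1 / (B * k)) powr (max p 0)"
      have "real (card {4 * k..<5 * k}) * (w * (5/8) powr q * (unit_ball_vol (CARD('n)) / 8 ^ CARD('n)))
         \<le> (LINT x|lborel. X1 (norm x / (3 * D)) powr p * \<bar>u x\<bar> powr q)"
      proof (rule integral_ge_shell_balls[where m = m])
        show "integrable lborel (\<lambda>x. X1 (norm x / (3 * D)) powr p * \<bar>u x\<bar> powr q)"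
          by (rule test_functions_integrable_weighted[OF u \<open>0 \<notin> \<Omega>\<close> \<open>D > 0\<close> le_D \<open>q > 0\<close>])
        fix j x
        assume j: "j \<in> {4 * k..<5 * k}" "x \<in> shell_ball m j"
        have x: "x \<noteq> 0" by (rule shell_ball_bounds[OF j(2)])
        have "norm x \<le> D" using in_\<Omega>[OF shell(4)[OF j]] le_D by blast
        define X where "X = X1 (norm x / (3 * D))"
        have X: "1 / (B * k) \<le> X" "0 < X" "X \<le> 1"
          using X1_lower_bound[OF \<open>D > 0\<close> k(1) shell(5)[OF j] \<open>norm x \<le> D\<close>]
            X1_bounds[of "norm x / (3 * D)"] x \<open>norm x \<le> D\<close> \<open>D > 0\<close>
          by (auto simp: X_def B_def)
        have "w \<le> X powr p"
        proof (cases "p \<ge> 0")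
          case True
          then show ?thesis
            unfolding w_def using X \<open>B > 0\<close> k by (simp add: max_absorb1 powr_mono2)
        next
          case False
          have "X powr 0 \<le> X powr p"
            using X False by (intro powr_mono') auto
          then show ?thesis
            unfolding w_def using X \<open>B > 0\<close> k False by (simp add: max_absorb2)
        qed
        moreover have "(5/8) powr q * (2 ^ j) ^ CARD('n) \<le> \<bar>u x\<bar> powr q"
        proof -
          have xm: "x $ m \<ge> 0" using shell(1)[OF j] x by (auto simp: zero_less_divide_iff)
          have "(5/8) powr q * (2 ^ j) ^ CARD('n) \<le> (x $ m / norm x) powr q * (1 / norm x ^ CARD('n))"
            using shell(2,3)[OF j] \<open>q > 0\<close> by (intro mult_mono powr_mono2) auto
          also have "\<dots> = hardy_profile m x powr q"
            unfolding q_def n_def using hardy_profile_powr[OF x xm \<open>CARD('n) \<ge> 3\<close>] by simp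
          also have "hardy_profile m x = \<bar>u x\<bar>"
            using xm u_eq[OF j] by (simp add: hardy_profile_def)
          finally show ?thesis .
        qed
        ultimately have "w * ((5/8) powr q * (2 ^ j) ^ CARD('n)) \<le> X powr p * \<bar>u x\<bar> powr q"
          by (intro mult_mono) auto
        then show "w * (5/8) powr q * (2 ^ j) ^ CARD('n) \<le> X1 (norm x / (3 * D)) powr p * \<bar>u x\<bar> powr q"
          by (simp add: X_def mult.assoc)
      qed (auto simp: w_def)
      then have 1: "k * (w * (5/8) powr q * V) \<le> (LINT x|lborel. X1 (norm x / (3 * D)) powr p * \<bar>u x\<bar> powr q)"
        by (simp add: V_def n_def)
      have "a * k * w \<le> ((5/8) powr q * V) * k * w"
        unfolding a_def using \<open>V > 0\<close> by (intro mult_right_mono) (auto simp: w_def)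
      also have "\<dots> = k * (w * (5/8) powr q * V)" by (simp add: mult_ac)
      finally show "a * k * (1 / (B * k)) powr (max p 0)
          \<le> (LINT x|lborel. X1 (norm x / (3 * D)) powr p * \<bar>u x\<bar> powr (2 * n / (n - 2)))"
        using 1 by (simp add: w_def q_def)
    qed
  qed (use \<open>a > 0\<close> \<open>B > 0\<close> in auto)
qed

lemma zero_notin_domain: "bounded_domain \<Omega> \<Longrightarrow> 0 \<in> frontier \<Omega> \<Longrightarrow> 0 \<notin> \<Omega>"
  by (simp add: bounded_domain_def frontier_def interior_open)

lemma interior_ball_along_e_last:
  fixes \<Omega> :: "(real ^ 'n::{finite,linorder}) set"
  assumes "exterior_ball_at_0 \<Omega> \<rho>" "\<rho> > 0" "interior_ball_at_0 \<Omega>"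
  shows "\<exists>r>0. ball (r *\<^sub>R axis (Max UNIV) 1) r \<subseteq> \<Omega>"
proof -
  obtain y r where r: "r > 0" "ball y r \<subseteq> \<Omega>" "0 \<in> frontier (ball y r)"
    using assms(3) unfolding interior_ball_at_0_def by blast
  have "ball (- \<rho> *\<^sub>R e_last) \<rho> \<inter> ball y r = {}"
    using assms(1) r(2) closure_subset[of \<Omega>] unfolding exterior_ball_at_0_def by blast
  moreover have "norm y = r"
    using r by (simp add: frontier_ball)
  ultimately have "y = r *\<^sub>R e_last"
    using assms(2) r(1) by (intro interior_ball_tangent) (auto simp: e_last_def)
  then show ?thesis
    using r by (auto simp: e_last_def)
qed

text \<open>The inequality would give \<open>(c - n\<^sup>2/4) a k \<le> A/k\<close> for all large \<open>k\<close>.\<close>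

lemma hardy_constant_sharp:
  fixes \<Omega> :: "(real ^ 'n::finite) set" and m :: 'n
  defines "n \<equiv> real CARD('n)"
  assumes \<Omega>: "CARD('n) \<ge> 3" "bounded \<Omega>" "0 \<notin> \<Omega>" "r > 0" "ball (r *\<^sub>R axis m 1) r \<subseteq> \<Omega>" "\<mu> \<ge> 0"
    and "c > n\<^sup>2 / 4" "C > 0"
  shows "\<not> hardy_sobolev_ineq \<Omega> \<mu> c p C"
proof
  assume hs: "hardy_sobolev_ineq \<Omega> \<mu> c p C"
  obtain A a k0 where "a > 0" and fam: "\<And>k. (k0::nat) \<le> k \<Longrightarrow> \<exists>u\<in>test_functions \<Omega>.
      (LINT x|lborel. (norm (grad u x))\<^sup>2) + \<mu> * (LINT x|lborel. (u x)\<^sup>2)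
         \<le> n\<^sup>2 / 4 * (LINT x|lborel. (u x)\<^sup>2 / (norm x)\<^sup>2) + A / real k
      \<and> a * real k \<le> (LINT x|lborel. (u x)\<^sup>2 / (norm x)\<^sup>2)"
    using concentrating_family[OF \<Omega>] unfolding n_def by blast
  define \<delta> where "\<delta> = c - n\<^sup>2 / 4"
  have "\<delta> > 0" using \<open>c > n\<^sup>2 / 4\<close> by (simp add: \<delta>_def)
  have bound: "\<delta> * a * real k * real k \<le> A" if k: "k0 \<le> k" "k \<ge> 1" for k
  proof -
    obtain u where u: "u \<in> test_functions \<Omega>"
      "(LINT x|lborel. (norm (grad u x))\<^sup>2) + \<mu> * (LINT x|lborel. (u x)\<^sup>2)
         \<le> n\<^sup>2 / 4 * (LINT x|lborel. (u x)\<^sup>2 / (norm x)\<^sup>2) + A / real k"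
      "a * real k \<le> (LINT x|lborel. (u x)\<^sup>2 / (norm x)\<^sup>2)"
      using fam[OF k(1)] by blast
    define H where "H = (LINT x|lborel. (u x)\<^sup>2 / (norm x)\<^sup>2)"
    have "c * H \<le> c * H + C * (LINT x|lborel. X1 (norm x / (3 * sup_norm_on \<Omega>)) powr p * \<bar>u x\<bar> powr (2 * n / (n - 2))) powr ((n - 2) / n)"
      using \<open>C > 0\<close> by simp
    also have "\<dots> \<le> n\<^sup>2 / 4 * H + A / real k"
      using hs[unfolded hardy_sobolev_ineq_iff, rule_format, OF u(1)] u(2)
      unfolding H_def n_def by linarith
    finally have "\<delta> * H \<le> A / real k"
      by (simp add: \<delta>_def algebra_simps)
    moreover have "\<delta> * (a * real k) \<le> \<delta> * H"
      using u(3) \<open>\<delta> > 0\<close> unfolding H_def by (intro mult_left_mono) auto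
    ultimately have "\<delta> * (a * real k) \<le> A / real k" by linarith
    then show ?thesis
      using k(2) by (simp add: pos_le_divide_eq mult.assoc)
  qed
  obtain k1 :: nat where k1: "A / (\<delta> * a) < real k1"
    using reals_Archimedean2 by blast
  define k where "k = max (max k0 1) k1"
  have k: "k0 \<le> k" "1 \<le> k" "A / (\<delta> * a) < real k"
    using k1 by (auto simp: k_def)
  have da: "\<delta> * a > 0" using \<open>\<delta> > 0\<close> \<open>a > 0\<close> by simp
  then have "A < \<delta> * a * real k"
    using k(3) by (simp add: pos_divide_less_eq mult.commute)
  also have "\<dots> \<le> \<delta> * a * real k * real k"
    using da k(2) mult_left_mono[of 1 "real k" "\<delta> * a * real k"] by simp
  finally show False using bound[OF k(1,2)] by simp
qed

text \<open>With \<open>s = (n-2)/n\<close> the inequality would give \<open>k powr ((1 - max p 0) * s) = O(1/k)\<close>, but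
  \<open>1 + (1 - p) * s\<close> is positive precisely for \<open>p < (2n-2)/(n-2)\<close>.\<close>

lemma weight_exponent_sharp:
  fixes \<Omega> :: "(real ^ 'n::finite) set" and m :: 'n
  defines "n \<equiv> real CARD('n)"
  assumes \<Omega>: "CARD('n) \<ge> 3" "bounded \<Omega>" "0 \<notin> \<Omega>" "r > 0" "ball (r *\<^sub>R axis m 1) r \<subseteq> \<Omega>" "\<mu> \<ge> 0"
    and "p < (2 * n - 2) / (n - 2)" "C > 0"
  shows "\<not> hardy_sobolev_ineq \<Omega> \<mu> (n\<^sup>2 / 4) p C"
proof
  assume hs: "hardy_sobolev_ineq \<Omega> \<mu> (n\<^sup>2 / 4) p C"
  define W where "W = (\<lambda>u :: real ^ 'n \<Rightarrow> real. LINT x|lborel. X1 (norm x / (3 * sup_norm_on \<Omega>)) powr p * \<bar>u x\<bar> powr (2 * n / (n - 2)))"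
  from concentrating_family[OF \<Omega>, folded n_def] obtain A a B and k0 :: nat where "a > 0" "B > 0"
    and fam0: "\<forall>k::nat. k0 \<le> k \<longrightarrow> (\<exists>u\<in>test_functions \<Omega>.
      (LINT x|lborel. (norm (grad u x))\<^sup>2) + \<mu> * (LINT x|lborel. (u x)\<^sup>2)
         \<le> n\<^sup>2 / 4 * (LINT x|lborel. (u x)\<^sup>2 / (norm x)\<^sup>2) + A / real k
      \<and> a * real k \<le> (LINT x|lborel. (u x)\<^sup>2 / (norm x)\<^sup>2)
      \<and> (\<forall>p. a * real k * (1 / (B * real k)) powr (max p 0)
          \<le> (LINT x|lborel. X1 (norm x / (3 * sup_norm_on \<Omega>)) powr p * \<bar>u x\<bar> powr (2 * n / (n - 2)))))"
    by (elim exE conjE)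
  have fam: "\<exists>u\<in>test_functions \<Omega>.
      (LINT x|lborel. (norm (grad u x))\<^sup>2) + \<mu> * (LINT x|lborel. (u x)\<^sup>2)
         \<le> n\<^sup>2 / 4 * (LINT x|lborel. (u x)\<^sup>2 / (norm x)\<^sup>2) + A / real k
      \<and> a * real k * (1 / (B * real k)) powr (max p 0) \<le> W u" if "k0 \<le> k" for k
    using fam0[rule_format, OF that] unfolding W_def
    by (elim bexE conjE) (rule bexI, erule conjI, erule spec)
  define p' s \<beta> where "p' = max p 0" and "s = (n - 2) / n" and "\<beta> = 1 + (1 - p') * s"
  have n3: "n \<ge> 3" using \<Omega>(1) by (simp add: n_def)
  then have "s > 0" by (simp add: s_def)
  have "p' < (2 * n - 2) / (n - 2)"
    using \<open>p < _\<close> n3 by (simp add: p'_def)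
  then have "p' * (n - 2) < 2 * n - 2"
    using n3 by (simp add: pos_less_divide_eq)
  then have "\<beta> > 0"
    using n3 by (simp add: \<beta>_def s_def field_simps)
  define Q where "Q = A / (C * (a * B powr (- p')) powr s)"
  have Q0: "C * (a * B powr (- p')) powr s > 0"
    using \<open>C > 0\<close> \<open>a > 0\<close> \<open>B > 0\<close> by simp
  have bound: "real k powr \<beta> \<le> Q" if k: "k0 \<le> k" "k \<ge> 1" for k
  proof -
    obtain u where u0: "u \<in> test_functions \<Omega>" and u1:
      "(LINT x|lborel. (norm (grad u x))\<^sup>2) + \<mu> * (LINT x|lborel. (u x)\<^sup>2)
         \<le> n\<^sup>2 / 4 * (LINT x|lborel. (u x)\<^sup>2 / (norm x)\<^sup>2) + A / real k
       \<and> a * real k * (1 / (B * real k)) powr (max p 0) \<le> W u"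
      using fam[OF k(1)] by (rule bexE)
    note u = u0 conjunct1[OF u1] conjunct2[OF u1, folded p'_def]
    have k0: "real k > 0" using k by simp
    \<comment> \<open>The Hardy integrals on both sides carry the same constant and cancel.\<close>
    have "n\<^sup>2 / 4 * (LINT x|lborel. (u x)\<^sup>2 / (norm x)\<^sup>2) + C * W u powr s
      \<le> n\<^sup>2 / 4 * (LINT x|lborel. (u x)\<^sup>2 / (norm x)\<^sup>2) + A / real k"
      using hs[unfolded hardy_sobolev_ineq_iff, rule_format, OF u(1)] u(2)
      unfolding W_def n_def s_def by linarith
    then have 1: "C * W u powr s \<le> A / real k" by simp
    have eq: "a * real k * (1 / (B * real k)) powr p' = (a * B powr (- p')) * real k powr (1 - p')"
    proof -
      have "(1 / (B * real k)) powr p' = B powr (- p') * real k powr (- p')"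
        using k0 \<open>B > 0\<close> by (simp add: powr_divide powr_mult powr_minus inverse_eq_divide)
      moreover have "real k * real k powr (- p') = real k powr (1 - p')"
        using k0 powr_add[of "real k" 1 "- p'"] by simp
      ultimately show ?thesis by (simp add: mult_ac)
    qed
    have "((a * B powr (- p')) * real k powr (1 - p')) powr s \<le> W u powr s"
      using \<open>s > 0\<close> \<open>a > 0\<close> by (intro powr_mono2 u(3)[unfolded eq]) auto
    moreover have "((a * B powr (- p')) * real k powr (1 - p')) powr s = (a * B powr (- p')) powr s * real k powr ((1 - p') * s)"
      using \<open>a > 0\<close> by (simp add: powr_mult powr_powr)
    ultimately have "(a * B powr (- p')) powr s * real k powr ((1 - p') * s) \<le> W u powr s"
      by (simp only:)
    from mult_left_mono[OF this less_imp_le[OF \<open>C > 0\<close>]]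
    have "C * ((a * B powr (- p')) powr s * real k powr ((1 - p') * s)) \<le> A / real k"
      using 1 by linarith
    then have "C * (a * B powr (- p')) powr s * (real k powr 1 * real k powr ((1 - p') * s)) \<le> A"
      using k0 by (simp add: pos_le_divide_eq mult_ac)
    then have "C * (a * B powr (- p')) powr s * real k powr \<beta> \<le> A"
      by (simp only: \<beta>_def powr_add)
    then show ?thesis
      unfolding Q_def using Q0 by (simp add: pos_le_divide_eq mult.commute)
  qed
  obtain k1 :: nat where k1: "(max Q 1) powr (1 / \<beta>) < real k1"
    using reals_Archimedean2 by blast
  define k where "k = max (max k0 1) k1"
  have k: "k0 \<le> k" "1 \<le> k" "(max Q 1) powr (1 / \<beta>) < real k"
    using k1 by (auto simp: k_def)
  have "((max Q 1) powr (1 / \<beta>)) powr \<beta> < real k powr \<beta>"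
    using k(3) \<open>\<beta> > 0\<close> by (intro powr_less_mono2) auto
  then have "max Q 1 < real k powr \<beta>"
    using \<open>\<beta> > 0\<close> by (simp add: powr_powr)
  then show False using bound[OF k(1,2)] by simp
qed

section \<open>Half balls and caps\<close>

lemma exterior_ball_at_0I:
  fixes \<Omega> :: "(real ^ 'n::{finite,linorder}) set"
  assumes "\<And>x. x \<in> \<Omega> \<Longrightarrow> norm (x + \<rho> *\<^sub>R e_last) \<ge> \<rho>"
  shows "exterior_ball_at_0 \<Omega> \<rho>"
proof -
  have "ball (- \<rho> *\<^sub>R e_last) \<rho> \<inter> \<Omega> = {}"
    using assms by (fastforce simp: dist_norm norm_minus_commute[of "- _"])
  then have "ball (- \<rho> *\<^sub>R e_last) \<rho> \<inter> closure \<Omega> = {}"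
    using open_Int_closure_eq_empty[of "ball (- \<rho> *\<^sub>R e_last) \<rho>" \<Omega>] by simp
  then show ?thesis
    by (auto simp: exterior_ball_at_0_def)
qed

lemma norm_e_last [simp]: "norm e_last = 1"
  by (simp add: e_last_def)

lemma norm_add_e_last_power2:
  "(norm (x + s *\<^sub>R e_last))\<^sup>2 = (norm x)\<^sup>2 + 2 * s * x $ Max UNIV + s\<^sup>2"
  unfolding power2_norm_eq_inner
  by (simp add: e_last_def inner_add_left inner_add_right inner_axis inner_axis' power2_eq_square distrib_left)

lemma zero_in_frontierI:
  fixes \<Omega> :: "(real ^ 'n::{finite,linorder}) set"
  assumes "open \<Omega>" "0 \<notin> \<Omega>" "\<delta> > 0" "\<And>t. 0 < t \<Longrightarrow> t < \<delta> \<Longrightarrow> t *\<^sub>R e_last \<in> \<Omega>"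
  shows "0 \<in> frontier \<Omega>"
proof -
  have "0 \<in> closure \<Omega>"
    unfolding closure_approachable
  proof (intro allI impI)
    fix \<epsilon> :: real
    assume "\<epsilon> > 0"
    then show "\<exists>y\<in>\<Omega>. dist y 0 < \<epsilon>"
      using assms(3) by (intro bexI[of _ "(min \<epsilon> \<delta> / 2) *\<^sub>R e_last"] assms(4)) auto
  qed
  then show ?thesis
    using assms by (simp add: frontier_def interior_open)
qed

lemma sup_norm_on_le: "\<Omega> \<noteq> {} \<Longrightarrow> (\<And>x. x \<in> \<Omega> \<Longrightarrow> norm x \<le> R) \<Longrightarrow> sup_norm_on \<Omega> \<le> R"
  unfolding sup_norm_on_def by (rule cSUP_least)

text \<open>Half balls are convex and satisfy the exterior ball condition for every radius, so the assumption
  of the theorem always applies to them.\<close>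

definition half_ball :: "real \<Rightarrow> (real ^ 'n::{finite,linorder}) set" where
  "half_ball R = ball 0 R \<inter> {x. x $ Max UNIV > 0}"

lemma half_ball_memI: "0 < t \<Longrightarrow> t < R \<Longrightarrow> t *\<^sub>R e_last \<in> half_ball R"
  by (simp add: half_ball_def dist_norm) (simp add: e_last_def)

lemma convex_half_ball: "convex (half_ball R)"
  unfolding half_ball_def
  using convex_halfspace_gt[of 0 "axis (Max UNIV) (1 :: real)"]
  by (intro convex_Int convex_ball) (simp add: inner_axis' inner_real_def)

lemma half_ball_domain:
  assumes "R > 0" "\<rho> \<ge> 0"
  shows "bounded_domain (half_ball R :: (real ^ 'n::{finite,linorder}) set)"
    "0 \<in> frontier (half_ball R :: (real ^ 'n::{finite,linorder}) set)"
    "exterior_ball_at_0 (half_ball R :: (real ^ 'n::{finite,linorder}) set) \<rho>"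
    "sup_norm_on (half_ball R :: (real ^ 'n::{finite,linorder}) set) \<le> R"
    "sup_norm_on (half_ball R :: (real ^ 'n::{finite,linorder}) set) > 0"
proof -
  have op: "open (half_ball R :: ((real, 'n) vec) set)"
    unfolding half_ball_def by (intro open_Int open_ball open_Collect_less continuous_intros)
  have mem: "(R / 2) *\<^sub>R e_last \<in> (half_ball R :: ((real, 'n) vec) set)"
    using assms by (intro half_ball_memI) auto
  have bd: "bounded (half_ball R :: ((real, 'n) vec) set)"
    by (rule bounded_subset[OF bounded_ball[of 0 R]]) (auto simp: half_ball_def)
  show "bounded_domain (half_ball R :: ((real, 'n) vec) set)"
    unfolding bounded_domain_def
    by (intro conjI op bd convex_connected[OF convex_half_ball]) (use mem in blast)
  show "0 \<in> frontier (half_ball R :: ((real, 'n) vec) set)"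
    by (rule zero_in_frontierI[OF op _ \<open>R > 0\<close> half_ball_memI]) (auto simp: half_ball_def)
  show "exterior_ball_at_0 (half_ball R :: ((real, 'n) vec) set) \<rho>"
  proof (rule exterior_ball_at_0I)
    fix x :: "(real, 'n) vec"
    assume "x \<in> half_ball R"
    then have "\<rho>\<^sup>2 \<le> (norm (x + \<rho> *\<^sub>R e_last))\<^sup>2"
      using assms by (simp add: norm_add_e_last_power2 half_ball_def)
    then show "\<rho> \<le> norm (x + \<rho> *\<^sub>R e_last)"
      by (rule power2_le_imp_le) simp
  qed
  show "sup_norm_on (half_ball R :: ((real, 'n) vec) set) \<le> R"
  proof (rule sup_norm_on_le)
    show "norm x \<le> R" if "x \<in> half_ball R" for x :: "(real, 'n) vec"
      using that by (simp add: half_ball_def)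
  qed (use mem in blast)
  show "sup_norm_on (half_ball R :: ((real, 'n) vec) set) > 0"
    using norm_le_sup_norm_on[OF bd mem] \<open>R > 0\<close> by simp
qed

text \<open>The part of a ball about the origin outside the closed exterior ball. It serves as the domain for
  the inner piece of a test function, since the intersection of the given domain with a small ball
  need not be connected.\<close>

definition cap :: "real \<Rightarrow> real \<Rightarrow> (real ^ 'n::{finite,linorder}) set" where
  "cap R \<rho> = ball 0 R \<inter> {x. norm (x + \<rho> *\<^sub>R e_last) > \<rho>}"

lemma half_ball_subset_cap: "\<rho> \<ge> 0 \<Longrightarrow> half_ball R \<subseteq> cap R \<rho>"
proof
  fix x :: "real ^ 'n::{finite,linorder}"
  assume "\<rho> \<ge> 0" "x \<in> half_ball R"
  then have "x \<noteq> 0" "x $ Max UNIV > 0"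
    by (auto simp: half_ball_def)
  then have "\<rho>\<^sup>2 < (norm (x + \<rho> *\<^sub>R e_last))\<^sup>2"
    unfolding norm_add_e_last_power2 using \<open>\<rho> \<ge> 0\<close> by (simp add: add_pos_nonneg)
  then show "x \<in> cap R \<rho>"
    using \<open>x \<in> half_ball R\<close> power2_less_imp_less[of \<rho> "norm (x + \<rho> *\<^sub>R e_last)"]
    by (simp add: half_ball_def cap_def)
qed

text \<open>From each point of the cap, a short move in direction \<open>e\<close> up into the half ball stays in the
  cap: it stays in the ball by convexity, and for \<open>R \<le> \<rho>\<close> the height of the point above the center of the exterior ball is positive, so the distance from
  that center grows. All points are thereby joined to the half ball, which is convex.\<close>

lemma connected_cap:
  assumes "0 < R" "R \<le> \<rho>"
  shows "connected (cap R \<rho> :: (real ^ 'n::{finite,linorder}) set)"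
proof -
  define H where "H = (half_ball R :: ((real, 'n) vec) set)"
  have H: "H \<subseteq> cap R \<rho>" "connected H" "(R / 2) *\<^sub>R e_last \<in> H"
    using half_ball_subset_cap[of \<rho> R] convex_connected[OF convex_half_ball] half_ball_memI[of "R / 2" R] assms
    by (auto simp: H_def)
  have "\<exists>T. connected T \<and> x \<in> T \<and> H \<subseteq> T \<and> T \<subseteq> cap R \<rho>" if x: "x \<in> cap R \<rho>" for x
  proof (cases "x $ Max UNIV > 0")
    case True
    then show ?thesis
      using x H by (intro exI[of _ H]) (auto simp: H_def half_ball_def cap_def)
  next
    case False
    define h where "h = x $ Max UNIV"
    have "h \<le> 0" using False by (simp add: h_def)
    define x' where "x' = x + (- h) *\<^sub>R e_last"
    have "norm x < R" using x by (simp add: cap_def)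
    have "(norm x')\<^sup>2 \<le> (norm x)\<^sup>2"
      unfolding x'_def norm_add_e_last_power2 by (simp add: h_def power2_eq_square)
    then have "norm x' \<le> norm x"
      by (rule power2_le_imp_le) simp
    then have "norm x' < R"
      using \<open>norm x < R\<close> by linarith
    \<comment> \<open>\<open>x'\<close> is the projection of \<open>x\<close> to the boundary of the half space; \<open>\<delta>\<close> leaves room inside the ball.\<close>
    define \<delta> where "\<delta> = (R - norm x') / 2"
    have "\<delta> > 0" using \<open>norm x' < R\<close> by (simp add: \<delta>_def)
    define z where "z = x + (\<delta> - h) *\<^sub>R e_last"
    have "z = x' + \<delta> *\<^sub>R e_last"
      by (simp add: z_def x'_def algebra_simps)
    then have "norm z \<le> norm x' + \<delta>"
      using norm_triangle_ineq[of x' "\<delta> *\<^sub>R e_last"] \<open>\<delta> > 0\<close> by simp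
    also have "\<dots> < R"
      using \<open>norm x' < R\<close> by (simp add: \<delta>_def field_simps)
    finally have zR: "norm z < R" .
    have "z $ Max UNIV = \<delta>"
      by (simp add: z_def h_def e_last_def)
    then have zH: "z \<in> H"
      using zR \<open>\<delta> > 0\<close> by (simp add: H_def half_ball_def)
    have "y \<in> cap R \<rho>" if seg: "y \<in> closed_segment x z" for y
    proof -
      obtain t where t: "0 \<le> t" "t \<le> 1" "y = (1 - t) *\<^sub>R x + t *\<^sub>R z"
        using seg unfolding in_segment by blast
      have "y \<in> ball 0 R"
        using seg \<open>norm x < R\<close> zR closed_segment_subset[OF _ _ convex_ball, of x 0 R z] by auto
      define s where "s = t * (\<delta> - h)"
      have "s \<ge> 0" using t \<open>\<delta> > 0\<close> \<open>h \<le> 0\<close> by (simp add: s_def)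
      have "y + \<rho> *\<^sub>R e_last = (x + \<rho> *\<^sub>R e_last) + s *\<^sub>R e_last"
        unfolding t(3) z_def s_def by (simp add: algebra_simps)
      then have "(norm (y + \<rho> *\<^sub>R e_last))\<^sup>2 = (norm (x + \<rho> *\<^sub>R e_last))\<^sup>2 + 2 * s * (h + \<rho>) + s\<^sup>2"
        by (simp only: norm_add_e_last_power2[of "x + \<rho> *\<^sub>R e_last"]) (simp add: h_def e_last_def)
      moreover have "h + \<rho> \<ge> 0"
        using component_le_norm_cart[of x "Max UNIV"] \<open>norm x < R\<close> \<open>R \<le> \<rho>\<close> by (simp add: h_def)
      ultimately have "(norm (x + \<rho> *\<^sub>R e_last))\<^sup>2 \<le> (norm (y + \<rho> *\<^sub>R e_last))\<^sup>2"
        using \<open>s \<ge> 0\<close> by simp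
      then have "norm (x + \<rho> *\<^sub>R e_last) \<le> norm (y + \<rho> *\<^sub>R e_last)"
        by (rule power2_le_imp_le) simp
      then show ?thesis
        using x \<open>y \<in> ball 0 R\<close> by (simp add: cap_def)
    qed
    moreover have "connected (closed_segment x z \<union> H)"
      using zH by (intro connected_Un H(2) connected_segment) auto
    ultimately show ?thesis
      using H by (intro exI[of _ "closed_segment x z \<union> H"]) auto
  qed
  then obtain T where T: "\<And>x. x \<in> cap R \<rho> \<Longrightarrow> connected (T x) \<and> x \<in> T x \<and> H \<subseteq> T x \<and> T x \<subseteq> cap R \<rho>"
    by metis
  have "connected (\<Union>x\<in>cap R \<rho>. T x)"
  proof (rule connected_Union)
    have "(R / 2) *\<^sub>R e_last \<in> \<Inter> (T ` cap R \<rho>)"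
      using T H by blast
    then show "\<Inter> (T ` cap R \<rho>) \<noteq> {}" by blast
  qed (use T in auto)
  moreover have "(\<Union>x\<in>cap R \<rho>. T x) = cap R \<rho>"
    using T by blast
  ultimately show ?thesis by simp
qed

lemma cap_domain:
  assumes "0 < R" "R \<le> \<rho>"
  shows "bounded_domain (cap R \<rho> :: (real ^ 'n::{finite,linorder}) set)"
    "0 \<in> frontier (cap R \<rho> :: (real ^ 'n::{finite,linorder}) set)"
    "exterior_ball_at_0 (cap R \<rho> :: (real ^ 'n::{finite,linorder}) set) \<rho>"
    "sup_norm_on (cap R \<rho> :: (real ^ 'n::{finite,linorder}) set) \<le> R"
    "sup_norm_on (cap R \<rho> :: (real ^ 'n::{finite,linorder}) set) > 0"
proof -
  have op: "open (cap R \<rho> :: ((real, 'n) vec) set)"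
    unfolding cap_def by (intro open_Int open_ball open_Collect_less continuous_intros)
  have memt: "t *\<^sub>R e_last \<in> (cap R \<rho> :: ((real, 'n) vec) set)" if "0 < t" "t < R" for t
    using half_ball_memI[OF that] half_ball_subset_cap[of \<rho> R] assms by auto
  have mem: "(R / 2) *\<^sub>R e_last \<in> (cap R \<rho> :: ((real, 'n) vec) set)"
    using assms by (intro memt) auto
  have bd: "bounded (cap R \<rho> :: ((real, 'n) vec) set)"
    by (rule bounded_subset[OF bounded_ball[of 0 R]]) (auto simp: cap_def)
  show "bounded_domain (cap R \<rho> :: ((real, 'n) vec) set)"
    unfolding bounded_domain_def
    by (intro conjI op bd connected_cap[OF assms]) (use mem in blast)
  show "0 \<in> frontier (cap R \<rho> :: ((real, 'n) vec) set)"
    by (rule zero_in_frontierI[OF op _ \<open>R > 0\<close> memt]) (use assms in \<open>auto simp: cap_def\<close>)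
  show "exterior_ball_at_0 (cap R \<rho> :: ((real, 'n) vec) set) \<rho>"
    by (rule exterior_ball_at_0I) (simp add: cap_def)
  show "sup_norm_on (cap R \<rho> :: ((real, 'n) vec) set) \<le> R"
  proof (rule sup_norm_on_le)
    show "norm x \<le> R" if "x \<in> cap R \<rho>" for x :: "(real, 'n) vec"
      using that by (simp add: cap_def)
  qed (use mem in blast)
  show "sup_norm_on (cap R \<rho> :: ((real, 'n) vec) set) > 0"
    using norm_le_sup_norm_on[OF bd mem] \<open>R > 0\<close> by simp
qed

lemma domain_Int_ball_subset_cap:
  fixes \<Omega> :: "(real ^ 'n::{finite,linorder}) set"
  assumes "open \<Omega>" "exterior_ball_at_0 \<Omega> \<rho>" "\<rho> > 0"
  shows "\<Omega> \<inter> ball 0 R \<subseteq> cap R \<rho>"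
proof -
  have "\<Omega> \<inter> ball (- \<rho> *\<^sub>R e_last) \<rho> = {}"
    using assms(2) closure_subset[of \<Omega>] unfolding exterior_ball_at_0_def by blast
  then have "\<Omega> \<inter> closure (ball (- \<rho> *\<^sub>R e_last) \<rho>) = {}"
    using open_Int_closure_eq_empty[OF \<open>open \<Omega>\<close>] by simp
  then have "\<Omega> \<inter> cball (- \<rho> *\<^sub>R e_last) \<rho> = {}"
    using \<open>\<rho> > 0\<close> by (simp add: closure_ball)
  then have "norm (x + \<rho> *\<^sub>R e_last) > \<rho>" if "x \<in> \<Omega>" for x
    using that by (fastforce simp: dist_norm norm_minus_commute[of "- _"])
  then show ?thesis by (auto simp: cap_def)
qed

section \<open>The Sobolev inequality\<close>

text \<open>Let the support of \<open>w\<close> lie in the ball of radius \<open>L\<close>. Shifted by \<open>4L\<close> along \<open>e\<close>, it lies in the half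
  ball of radius \<open>8L\<close> at distance at least \<open>3L\<close> from the origin, where the argument of \<open>X1\<close> is at least
  \<open>3L / (3 * 8L) = 1/8\<close>. The weight is thus bounded below by a constant that does not depend on \<open>w\<close>.\<close>

lemma sobolev_from_domain_inequality:
  fixes n c p C \<sigma> :: real
  assumes n: "n = real CARD('n::{finite,linorder})" "n \<ge> 3" and "c \<ge> 0" "p \<ge> 0" "C > 0" "\<sigma> > 0"
    and hyp: "\<And>(\<Omega> :: (real ^ 'n::{finite,linorder}) set) \<rho>. bounded_domain \<Omega> \<Longrightarrow> 0 \<in> frontier \<Omega> \<Longrightarrow>
        exterior_ball_at_0 \<Omega> \<rho> \<Longrightarrow> \<rho> \<ge> sup_norm_on \<Omega> / \<sigma> \<Longrightarrow> hardy_sobolev_ineq \<Omega> 0 c p C"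
  shows "\<exists>S>0. \<forall>w\<in>test_functions (UNIV :: (real ^ 'n::{finite,linorder}) set).
     S * (LINT x|lborel. \<bar>w x\<bar> powr (2 * n / (n - 2))) powr ((n - 2) / n) \<le> (LINT x|lborel. (norm (grad w x))\<^sup>2)"
proof -
  define q s where "q = 2 * n / (n - 2)" and "s = (n - 2) / n"
  have qs: "q > 0" "s > 0" using n by (simp_all add: q_def s_def)
  define X where "X = X1 (1 / 8) powr p"
  have X: "X > 0" using X1_bounds(1)[of "1/8"] by (simp add: X_def)
  define S where "S = C * X powr s"
  have "S > 0" using X \<open>C > 0\<close> by (simp add: S_def)
  moreover have "S * (LINT x|lborel. \<bar>w x\<bar> powr q) powr s \<le> (LINT x|lborel. (norm (grad w x))\<^sup>2)"
    if w: "w \<in> test_functions (UNIV :: ((real, 'n) vec) set)" for w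
  proof -
    obtain L where "L > 0" and L: "\<And>x. x \<in> supp w \<Longrightarrow> norm x \<le> L"
      using w by (metis bounded_pos compact_imp_bounded test_functions_iff)
    define \<Omega> where "\<Omega> = (half_ball (8 * L) :: ((real, 'n) vec) set)"
    define D where "D = sup_norm_on \<Omega>"
    have L8: "8 * L > 0" using \<open>L > 0\<close> by simp
    have D: "D \<le> 8 * L" "D > 0"
      using half_ball_domain(4,5)[OF L8 order_refl] by (simp_all add: D_def \<Omega>_def)
    have hs: "hardy_sobolev_ineq \<Omega> 0 c p C"
      unfolding \<Omega>_def
      by (rule hyp[where \<rho> = "D / \<sigma>"])
        (use half_ball_domain[OF L8, of "D / \<sigma>"] D \<open>\<sigma> > 0\<close> in \<open>simp_all add: D_def \<Omega>_def\<close>)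
    define a where "a = (- (4 * L)) *\<^sub>R (e_last :: (real, 'n) vec)"
    define v where "v = (\<lambda>x. w (x + a))"
    have na: "norm a = 4 * L" using \<open>L > 0\<close> by (simp add: a_def)
    have sup: "x \<in> \<Omega>" "norm x \<ge> 3 * L" if "x + a \<in> supp w" for x
    proof -
      have x: "norm (x + a) \<le> L" using L that by blast
      show "norm x \<ge> 3 * L"
        using x na norm_triangle_ineq[of "x + a" "- x"] by simp
      have "norm x \<le> 5 * L"
        using x na norm_triangle_ineq[of "x + a" "- a"] by simp
      moreover have "\<bar>(x + a) $ Max UNIV\<bar> \<le> L"
        using x component_le_norm_cart order_trans by blast
      then have "x $ Max UNIV > 0"
        using \<open>L > 0\<close> by (simp add: a_def e_last_def abs_le_iff)
      ultimately show "x \<in> \<Omega>"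
        using \<open>L > 0\<close> by (simp add: \<Omega>_def half_ball_def)
    qed
    have v: "v \<in> test_functions \<Omega>"
      unfolding v_def by (rule test_functions_translate[OF w]) (rule sup(1))
    have "0 \<notin> \<Omega>" by (simp add: \<Omega>_def half_ball_def)
    have le_D: "norm x \<le> D" if "x \<in> \<Omega>" for x
      unfolding D_def by (rule norm_le_sup_norm_on) 
        (use half_ball_domain(1)[OF L8 order_refl] that in \<open>auto simp: \<Omega>_def bounded_domain_def\<close>)
    have int_w: "integrable lborel (\<lambda>x. \<bar>w x\<bar> powr q)"
      by (rule test_functions_integrable_powr[OF w \<open>q > 0\<close>])
    have "X * (LINT x|lborel. \<bar>w x\<bar> powr q) = (LINT x|lborel. X * \<bar>v x\<bar> powr q)"
      unfolding v_def using integral_translation(2)[OF int_w, of a] by simp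
    also have "\<dots> \<le> (LINT x|lborel. X1 (norm x / (3 * D)) powr p * \<bar>v x\<bar> powr q)"
    proof (rule integral_mono)
      show "integrable lborel (\<lambda>x. X * \<bar>v x\<bar> powr q)"
        unfolding v_def using integral_translation(1)[OF int_w, of a] by simp
      show "integrable lborel (\<lambda>x. X1 (norm x / (3 * D)) powr p * \<bar>v x\<bar> powr q)"
        by (rule test_functions_integrable_weighted[OF v \<open>0 \<notin> \<Omega>\<close> D(2) le_D \<open>q > 0\<close>])
      fix x
      show "X * \<bar>v x\<bar> powr q \<le> X1 (norm x / (3 * D)) powr p * \<bar>v x\<bar> powr q"
      proof (cases "x + a \<in> supp w")
        case True
        have "1 / 8 \<le> norm x / (3 * D)"
          using sup(2)[OF True] D by (simp add: field_simps)
        moreover have "norm x / (3 * D) < 1"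
          using le_D[OF sup(1)[OF True]] D by simp
        ultimately have "X1 (1 / 8) \<le> X1 (norm x / (3 * D))"
          by (intro X1_mono) auto
        then have "X \<le> X1 (norm x / (3 * D)) powr p"
          unfolding X_def using \<open>p \<ge> 0\<close> X1_bounds(1)[of "1/8"] by (intro powr_mono2) auto
        then show ?thesis by (intro mult_right_mono) auto
      next
        case False
        then show ?thesis using not_in_supp[OF False] by (simp add: v_def)
      qed
    qed
    finally have "(X * (LINT x|lborel. \<bar>w x\<bar> powr q)) powr s
        \<le> (LINT x|lborel. X1 (norm x / (3 * D)) powr p * \<bar>v x\<bar> powr q) powr s"
      using X \<open>s > 0\<close> by (intro powr_mono2) auto
    moreover have "(X * (LINT x|lborel. \<bar>w x\<bar> powr q)) powr s = X powr s * (LINT x|lborel. \<bar>w x\<bar> powr q) powr s"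
      by (rule powr_mult)
    ultimately have "C * (X powr s * (LINT x|lborel. \<bar>w x\<bar> powr q) powr s)
        \<le> C * (LINT x|lborel. X1 (norm x / (3 * D)) powr p * \<bar>v x\<bar> powr q) powr s"
      using \<open>C > 0\<close> by (intro mult_left_mono) auto
    moreover have "c * (LINT x|lborel. (v x)\<^sup>2 / (norm x)\<^sup>2)
       + C * (LINT x|lborel. X1 (norm x / (3 * D)) powr p * \<bar>v x\<bar> powr q) powr s
      \<le> (LINT x|lborel. (norm (grad v x))\<^sup>2) + 0 * (LINT x|lborel. (v x)\<^sup>2)"
      using hs[unfolded hardy_sobolev_ineq_iff, rule_format, OF v]
      unfolding q_def s_def D_def n(1) .
    moreover have "c * (LINT x|lborel. (v x)\<^sup>2 / (norm x)\<^sup>2) \<ge> 0"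
      using \<open>c \<ge> 0\<close> by (intro mult_nonneg_nonneg) auto
    moreover have "(LINT x|lborel. (norm (grad v x))\<^sup>2) = (LINT x|lborel. (norm (grad w x))\<^sup>2)"
    proof -
      have "grad v x = grad w (x + a)" for x
        unfolding v_def using w by (intro grad_translate smooth_on_differentiable[of UNIV]) (auto simp: test_functions_iff)
      then show ?thesis
        using integral_translation(2)[OF test_functions_integrable_grad[OF w], of a] by simp
    qed
    ultimately show ?thesis
      unfolding S_def mult.assoc by linarith
  qed
  ultimately show ?thesis
    unfolding q_def s_def by blast
qed

section \<open>Localization at the scale of the exterior ball\<close>

text \<open>The gradients of \<open>cos \<theta> * u\<close> and \<open>sin \<theta> * u\<close> form a rotation of the pair \<open>(\<nabla>u, u \<nabla>\<theta>)\<close>.\<close>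

lemma ims_pointwise:
  fixes g h :: "'a::real_inner"
  shows "(norm (cos t *\<^sub>R g + u *\<^sub>R (- sin t *\<^sub>R h)))\<^sup>2 + (norm (sin t *\<^sub>R g + u *\<^sub>R (cos t *\<^sub>R h)))\<^sup>2
    = (norm g)\<^sup>2 + u\<^sup>2 * (norm h)\<^sup>2"
proof -
  have "(norm (c *\<^sub>R g + u *\<^sub>R (- s *\<^sub>R h)))\<^sup>2 + (norm (s *\<^sub>R g + u *\<^sub>R (c *\<^sub>R h)))\<^sup>2
     = (s\<^sup>2 + c\<^sup>2) * (g \<bullet> g) + (s\<^sup>2 + c\<^sup>2) * (u\<^sup>2 * (h \<bullet> h))" for c s
    unfolding power2_norm_eq_inner
    by (simp add: inner_add_left inner_add_right inner_commute power2_eq_square algebra_simps)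
  from this[of "cos t" "sin t"] show ?thesis
    by (simp only: sin_cos_squared_add mult_1 power2_norm_eq_inner)
qed

lemma powr_add_le_two_times:
  fixes a b s :: real
  assumes "a \<ge> 0" "b \<ge> 0" "0 < s" "s \<le> 1"
  shows "(a + b) powr s \<le> 2 * (a powr s + b powr s)"
proof -
  define M where "M = max a b"
  have "(a + b) powr s \<le> (2 * M) powr s"
    using assms by (intro powr_mono2) (auto simp: M_def)
  also have "\<dots> = 2 powr s * M powr s"
    by (rule powr_mult)
  also have "\<dots> \<le> 2 * M powr s"
    using assms powr_mono[of s 1 "2::real"] by (intro mult_right_mono) auto
  also have "M powr s \<le> a powr s + b powr s"
    by (auto simp: M_def max_def)
  finally show ?thesis by simp
qed

text \<open>The larger of \<open>|cos t|\<close> and \<open>|sin t|\<close> is at least \<open>1 / sqrt 2\<close>.\<close>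

lemma powr_le_cos_sin:
  fixes a t q :: real
  assumes "q > 0"
  shows "\<bar>a\<bar> powr q \<le> sqrt 2 powr q * (\<bar>cos t * a\<bar> powr q + \<bar>sin t * a\<bar> powr q)"
proof -
  define M where "M = max \<bar>cos t * a\<bar> \<bar>sin t * a\<bar>"
  have M: "\<bar>cos t * a\<bar> \<le> M" "\<bar>sin t * a\<bar> \<le> M" "M \<ge> 0" by (auto simp: M_def)
  have "a\<^sup>2 = ((sin t)\<^sup>2 + (cos t)\<^sup>2) * a\<^sup>2"
    by simp
  also have "\<dots> = \<bar>cos t * a\<bar>\<^sup>2 + \<bar>sin t * a\<bar>\<^sup>2"
    unfolding power2_abs power_mult_distrib by (simp only: distrib_right add.commute)
  also have "\<dots> \<le> M\<^sup>2 + M\<^sup>2"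
    using M by (intro add_mono power_mono) auto
  also have "\<dots> = (sqrt 2 * M)\<^sup>2"
    by (simp add: power_mult_distrib)
  finally have "\<bar>a\<bar>\<^sup>2 \<le> (sqrt 2 * M)\<^sup>2" by simp
  then have "\<bar>a\<bar> \<le> sqrt 2 * M"
    by (rule power2_le_imp_le) (use M in simp)
  then have "\<bar>a\<bar> powr q \<le> (sqrt 2 * M) powr q"
    using assms by (intro powr_mono2) auto
  also have "\<dots> = sqrt 2 powr q * M powr q"
    by (rule powr_mult)
  also have "\<dots> \<le> sqrt 2 powr q * (\<bar>cos t * a\<bar> powr q + \<bar>sin t * a\<bar> powr q)"
    by (intro mult_left_mono) (auto simp: M_def max_def)
  finally show ?thesis .
qed

text \<open>The angle grows from \<open>0\<close> at \<open>|x| = R/2\<close> to \<open>\<pi>/2\<close> at \<open>|x|\<^sup>2 = 3/4 R\<^sup>2\<close>, so that the cosine is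
  supported strictly inside the ball of radius \<open>R\<close>.\<close>

definition cut_angle :: "real \<Rightarrow> real ^ 'n \<Rightarrow> real" where
  "cut_angle R x = pi / 2 * smooth_step ((4 * (norm x)\<^sup>2 / R\<^sup>2 - 1) / 2)"

lemma smooth_on_cut_angle: "smooth_on UNIV (cut_angle R)"
proof -
  have "smooth_on UNIV (\<lambda>x :: real ^ 'n. pi / 2 * smooth_step ((2 / R\<^sup>2) * (norm x)\<^sup>2 - 1/2))"
    by (intro smooth_on_mult smooth_on_const smooth_on_smooth_step smooth_on_diff smooth_on_norm_power2 open_UNIV)
  then show ?thesis
    by (simp add: cut_angle_def[abs_def] diff_divide_distrib)
qed

lemma cut_angle_inside:
  assumes "R > 0" "norm x \<le> R / 2"
  shows "cut_angle R x = 0"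
proof -
  have "(norm x)\<^sup>2 \<le> (R / 2)\<^sup>2" using assms by (intro power_mono) auto
  then show ?thesis
    using assms by (simp add: cut_angle_def smooth_step_eq_0 power_divide field_simps)
qed

lemma cut_angle_outside:
  assumes "R > 0" "(norm x)\<^sup>2 \<ge> 3/4 * R\<^sup>2"
  shows "cut_angle R x = pi / 2"
  using assms by (simp add: cut_angle_def smooth_step_eq_1 field_simps)

lemma cut_angle_gradient_bound:
  "\<exists>L. \<forall>R>0. \<forall>x :: real ^ 'n. (norm (grad (cut_angle R) x))\<^sup>2 \<le> L / R\<^sup>2"
proof -
  obtain S' K where S': "\<And>t. (smooth_step has_real_derivative S' t) (at t)" "\<And>t. \<bar>S' t\<bar> \<le> K"
      "\<And>t. t > 1 \<Longrightarrow> S' t = 0"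
    using smooth_step_bounded_derivative by blast
  have "K \<ge> 0" using S'(2)[of 0] by linarith
  have "(norm (grad (cut_angle R) x))\<^sup>2 \<le> (2 * pi * K)\<^sup>2 / R\<^sup>2" if "R > 0" for R and x :: "real ^ 'n"
  proof -
    define w where "w = (4 * (norm x)\<^sup>2 / R\<^sup>2 - 1) / 2"
    have "((\<lambda>t. (4 * t / R\<^sup>2 - 1) / 2) has_real_derivative 2 / R\<^sup>2) (at ((norm x)\<^sup>2))"
      using that by (auto intro!: derivative_eq_intros simp: field_simps)
    from DERIV_chain2[OF S'(1) this]
    have "((\<lambda>t. pi / 2 * smooth_step ((4 * t / R\<^sup>2 - 1) / 2)) has_real_derivative pi / 2 * (S' w * (2 / R\<^sup>2))) (at ((norm x)\<^sup>2))"
      unfolding w_def by (rule DERIV_cmult)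
    from grad_eqI[OF GDERIV_DERIV_compose[OF GDERIV_norm_power2 this]]
    have g: "grad (cut_angle R) x = (pi / 2 * (S' w * (2 / R\<^sup>2))) *\<^sub>R (2 *\<^sub>R x)"
      unfolding cut_angle_def[abs_def] .
    have "norm (grad (cut_angle R) x) \<le> 2 * pi * K / R"
    proof (cases "norm x \<le> R")
      case True
      have "norm (grad (cut_angle R) x) = 2 * pi / R\<^sup>2 * (\<bar>S' w\<bar> * norm x)"
        unfolding g by (simp add: abs_mult)
      also have "\<dots> \<le> 2 * pi / R\<^sup>2 * (K * R)"
        using S'(2) True \<open>K \<ge> 0\<close> by (intro mult_left_mono mult_mono) auto
      also have "\<dots> = 2 * pi * K / R"
        using that by (simp add: power2_eq_square)
      finally show ?thesis .
    next
      case False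
      then have "R\<^sup>2 < (norm x)\<^sup>2" using that by (intro power_strict_mono) auto
      then have "3 * R\<^sup>2 < 4 * (norm x)\<^sup>2"
        using zero_le_power2[of R] by linarith
      then have "w > 1" using that by (simp add: w_def field_simps)
      then show ?thesis using S'(3) g that \<open>K \<ge> 0\<close> by simp
    qed
    then have "(norm (grad (cut_angle R) x))\<^sup>2 \<le> (2 * pi * K / R)\<^sup>2"
      by (intro power_mono) auto
    then show ?thesis by (simp add: power_divide)
  qed
  then show ?thesis by blast
qed

text \<open>The localization argument: the assumption is used on the cap for \<open>cos \<theta> * u\<close> and the Sobolev
  inequality for \<open>sin \<theta> * u\<close>. Replacing \<open>D\<close> by the smaller supremum \<open>D'\<close> of the norm over the cap only
  increases the weight, so the inner estimate is stronger than required.\<close>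

lemma hardy_sobolev_localization:
  fixes n p C \<sigma> :: real
  assumes n: "n = real CARD('n::{finite,linorder})" "n \<ge> 3" and "p \<ge> 0" "C > 0" "\<sigma> > 0"
    and hyp: "\<And>(\<Omega> :: (real ^ 'n::{finite,linorder}) set) \<rho>. bounded_domain \<Omega> \<Longrightarrow> 0 \<in> frontier \<Omega> \<Longrightarrow>
        exterior_ball_at_0 \<Omega> \<rho> \<Longrightarrow> \<rho> \<ge> sup_norm_on \<Omega> / \<sigma> \<Longrightarrow> hardy_sobolev_ineq \<Omega> 0 (n\<^sup>2 / 4) p C"
  shows "\<exists>lam>0. \<exists>C'>0. \<forall>(\<Omega> :: (real ^ 'n::{finite,linorder}) set) \<rho>. bounded_domain \<Omega> \<longrightarrow> 0 \<in> frontier \<Omega> \<longrightarrow> \<rho> > 0 \<longrightarrow>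
        exterior_ball_at_0 \<Omega> \<rho> \<longrightarrow> \<rho> < sup_norm_on \<Omega> / \<sigma> \<longrightarrow> hardy_sobolev_ineq \<Omega> (lam / \<rho>\<^sup>2) (n\<^sup>2 / 4) p C'"
proof -
  define q s where "q = 2 * n / (n - 2)" and "s = (n - 2) / n"
  have qs: "q > 0" "s > 0" "s \<le> 1" "q * s = 2" using n by (simp_all add: q_def s_def field_simps)
  have "\<exists>S>0. \<forall>w\<in>test_functions (UNIV :: (real ^ 'n::{finite,linorder}) set).
     S * (LINT x|lborel. \<bar>w x\<bar> powr q) powr s \<le> (LINT x|lborel. (norm (grad w x))\<^sup>2)"
    unfolding q_def s_def
    by (rule sobolev_from_domain_inequality[OF n _ \<open>p \<ge> 0\<close> \<open>C > 0\<close> \<open>\<sigma> > 0\<close> hyp]) simp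
  then obtain S where "S > 0" and S: "\<And>w. w \<in> test_functions (UNIV :: (real ^ 'n::{finite,linorder}) set) \<Longrightarrow>
     S * (LINT x|lborel. \<bar>w x\<bar> powr q) powr s \<le> (LINT x|lborel. (norm (grad w x))\<^sup>2)"
    by blast
  obtain L where L: "\<And>R (x :: real ^ 'n::{finite,linorder}). R > 0 \<Longrightarrow> (norm (grad (cut_angle R) x))\<^sup>2 \<le> L / R\<^sup>2"
    using cut_angle_gradient_bound[where 'n = 'n] by blast
  have "L \<ge> 0" using L[of 1 0] by (simp add: order_trans[OF zero_le_power2])
  define \<kappa> where "\<kappa> = min \<sigma> 1"
  have \<kappa>: "\<kappa> > 0" "\<kappa> \<le> 1" "\<kappa> \<le> \<sigma>" using \<open>\<sigma> > 0\<close> by (auto simp: \<kappa>_def)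
  define lam where "lam = (L + n\<^sup>2) / \<kappa>\<^sup>2"
  have "lam > 0" using \<open>L \<ge> 0\<close> n \<kappa> by (simp add: lam_def add_nonneg_pos)
  define C' where "C' = min C S / 4"
  have C': "C' > 0" "4 * C' \<le> C" "4 * C' \<le> S" using \<open>C > 0\<close> \<open>S > 0\<close> by (auto simp: C'_def)
  have main: "hardy_sobolev_ineq \<Omega> (lam / \<rho>\<^sup>2) (n\<^sup>2 / 4) p C'"
    if dom: "bounded_domain \<Omega>" "0 \<in> frontier \<Omega>" and "\<rho> > 0" and ext: "exterior_ball_at_0 \<Omega> \<rho>" and \<rho>D: "\<rho> < sup_norm_on \<Omega> / \<sigma>"
    for \<Omega> :: "(real ^ 'n::{finite,linorder}) set" and \<rho>
  proof -
    define R where "R = \<kappa> * \<rho>"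
    have R: "R > 0" "R \<le> \<rho>" "R \<le> \<sigma> * \<rho>"
      using \<kappa> \<open>\<rho> > 0\<close> by (auto simp: R_def)
    define D where "D = sup_norm_on \<Omega>"
    have RD: "R < D"
      using R(3) \<rho>D \<open>\<sigma> > 0\<close> by (simp add: D_def field_simps)
    have "D > 0" using RD R(1) by linarith
    have op: "open \<Omega>" and bd: "bounded \<Omega>" using dom(1) by (auto simp: bounded_domain_def)
    have "0 \<notin> \<Omega>" by (rule zero_notin_domain[OF dom])
    have le_D: "norm x \<le> D" if "x \<in> \<Omega>" for x
      unfolding D_def by (rule norm_le_sup_norm_on[OF bd that])
    define \<Omega>' where "\<Omega>' = (cap R \<rho> :: (real, 'n) vec set)"
    define D' where "D' = sup_norm_on \<Omega>'"
    have D': "0 < D'" "D' \<le> R"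
      using cap_domain(4,5)[OF R(1,2)] by (simp_all add: D'_def \<Omega>'_def)
    have "D' / \<sigma> \<le> \<rho>"
      using D'(2) R(3) \<open>\<sigma> > 0\<close> by (simp add: field_simps)
    then have hs': "hardy_sobolev_ineq \<Omega>' 0 (n\<^sup>2 / 4) p C"
      unfolding D'_def \<Omega>'_def by (rule hyp[OF cap_domain(1,2,3)[OF R(1,2)]])
    have dom': "0 \<notin> \<Omega>'" "bounded \<Omega>'"
      using zero_notin_domain[OF cap_domain(1,2)[OF R(1,2)]] cap_domain(1)[OF R(1,2)]
      by (auto simp: \<Omega>'_def bounded_domain_def)
    have le_D': "norm x \<le> D'" if "x \<in> \<Omega>'" for x
      unfolding D'_def by (rule norm_le_sup_norm_on[OF dom'(2) that])
    have sub: "\<Omega> \<inter> ball 0 R \<subseteq> \<Omega>'"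
      unfolding \<Omega>'_def by (rule domain_Int_ball_subset_cap[OF op ext \<open>\<rho> > 0\<close>])
    show ?thesis
      unfolding hardy_sobolev_ineq_iff
    proof
      fix u
      assume u: "u \<in> test_functions \<Omega>"
      define \<theta> where "\<theta> = (cut_angle R :: (real, 'n) vec \<Rightarrow> real)"
      define u1 where "u1 = (\<lambda>x. cos (\<theta> x) * u x)"
      define u2 where "u2 = (\<lambda>x. sin (\<theta> x) * u x)"
      have \<theta>: "smooth_on UNIV \<theta>" unfolding \<theta>_def by (rule smooth_on_cut_angle)
      have cs: "smooth_on \<Omega> (\<lambda>x. cos (\<theta> x))" "smooth_on \<Omega> (\<lambda>x. sin (\<theta> x))"
        using smooth_on_compose[OF open_UNIV \<theta> smooth_real_on_cos[of UNIV]]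
          smooth_on_compose[OF open_UNIV \<theta> smooth_real_on_sin[of UNIV]]
        by (auto intro: smooth_on_subset)
      have u1: "u1 \<in> test_functions \<Omega>" and u2: "u2 \<in> test_functions \<Omega>"
        unfolding u1_def u2_def by (rule test_functions_mult[OF op _ u]; rule cs)+
      have u1': "u1 \<in> test_functions \<Omega>'"
      proof (rule test_functionsI)
        show "smooth_on UNIV u1" using u1 by (simp add: test_functions_iff)
        have "closed {x :: (real, 'n) vec. (norm x)\<^sup>2 \<le> 3/4 * R\<^sup>2}"
          by (intro closed_Collect_le continuous_intros)
        then show "compact (supp u \<inter> {x. (norm x)\<^sup>2 \<le> 3/4 * R\<^sup>2})"
          using u by (intro compact_Int_closed) (auto simp: test_functions_iff)
        have "norm x < R" if "(norm x)\<^sup>2 \<le> 3/4 * R\<^sup>2" for x :: "(real, 'n) vec"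
        proof (rule power2_less_imp_less)
          show "(norm x)\<^sup>2 < R\<^sup>2" using that R(1) zero_less_power[of R 2] by linarith
        qed (use R in simp)
        then show "supp u \<inter> {x. (norm x)\<^sup>2 \<le> 3/4 * R\<^sup>2} \<subseteq> \<Omega>'"
          using u sub by (auto simp: test_functions_iff)
        show "u1 x = 0" if x: "x \<notin> supp u \<inter> {x. (norm x)\<^sup>2 \<le> 3/4 * R\<^sup>2}" for x
        proof (cases "x \<in> supp u")
          case True
          then have "\<theta> x = pi / 2"
            unfolding \<theta>_def using x by (intro cut_angle_outside[OF R(1)]) simp
          then show ?thesis by (simp only: u1_def cos_pi_half mult_zero_left)
        qed (simp add: u1_def not_in_supp[of x u])
      qed
      have u2': "u2 \<in> test_functions UNIV"
        by (rule test_functions_mono[OF u2]) simp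
      define H where "H = (\<lambda>w :: (real, 'n) vec \<Rightarrow> real. LINT x|lborel. (w x)\<^sup>2 / (norm x)\<^sup>2)"
      define G where "G = (\<lambda>w :: (real, 'n) vec \<Rightarrow> real. LINT x|lborel. (norm (grad w x))\<^sup>2)"
      define W where "W = (\<lambda>E (w :: (real, 'n) vec \<Rightarrow> real). LINT x|lborel. X1 (norm x / (3 * E)) powr p * \<bar>w x\<bar> powr q)"
      define I where "I = (LINT x|lborel. (u x)\<^sup>2)"
      define J where "J = (LINT x|lborel. \<bar>u2 x\<bar> powr q)"
      have ims: "(norm (grad u1 x))\<^sup>2 + (norm (grad u2 x))\<^sup>2 \<le> (norm (grad u x))\<^sup>2 + L / R\<^sup>2 * (u x)\<^sup>2" for x
      proof -
        note gu = test_functions_GDERIV[OF u, of x] and gt = smooth_on_GDERIV[OF \<theta> UNIV_I, of x]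
        have "grad u1 x = cos (\<theta> x) *\<^sub>R grad u x + u x *\<^sub>R (- sin (\<theta> x) *\<^sub>R grad \<theta> x)"
          unfolding u1_def by (rule grad_eqI[OF GDERIV_mult[OF GDERIV_DERIV_compose[OF gt DERIV_cos] gu]])
        moreover have "grad u2 x = sin (\<theta> x) *\<^sub>R grad u x + u x *\<^sub>R (cos (\<theta> x) *\<^sub>R grad \<theta> x)"
          unfolding u2_def by (rule grad_eqI[OF GDERIV_mult[OF GDERIV_DERIV_compose[OF gt DERIV_sin] gu]])
        ultimately have "(norm (grad u1 x))\<^sup>2 + (norm (grad u2 x))\<^sup>2 = (norm (grad u x))\<^sup>2 + (u x)\<^sup>2 * (norm (grad \<theta> x))\<^sup>2"
          by (simp only: ims_pointwise)
        also have "(u x)\<^sup>2 * (norm (grad \<theta> x))\<^sup>2 \<le> (u x)\<^sup>2 * (L / R\<^sup>2)"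
          unfolding \<theta>_def by (intro mult_left_mono L R(1)) simp
        finally show ?thesis by (simp only: mult.commute)
      qed
      have iu: "integrable lborel (\<lambda>x. (u x)\<^sup>2)" by (rule test_functions_integrable_power2[OF u])
      note ig = test_functions_integrable_grad
      have "G u1 + G u2 = (LINT x|lborel. (norm (grad u1 x))\<^sup>2 + (norm (grad u2 x))\<^sup>2)"
        unfolding G_def using ig[OF u1] ig[OF u2] by simp
      also have "\<dots> \<le> (LINT x|lborel. (norm (grad u x))\<^sup>2 + L / R\<^sup>2 * (u x)\<^sup>2)"
        by (rule integral_mono)
          (intro Bochner_Integration.integrable_add integrable_mult_right ig[OF u1] ig[OF u2] ig[OF u] iu ims)+
      also have "\<dots> = G u + L / R\<^sup>2 * I"
        unfolding G_def I_def using ig[OF u] iu by simp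
      finally have grads: "G u1 + G u2 \<le> G u + L / R\<^sup>2 * I" .
      \<comment> \<open>Where the outer piece lives, \<open>|x| \<ge> R/2\<close>, so its share of the Hardy integral is absorbed by the
        integral of \<open>u\<^sup>2\<close>.\<close>
      have hardy_pt: "(u x)\<^sup>2 / (norm x)\<^sup>2 \<le> (u1 x)\<^sup>2 / (norm x)\<^sup>2 + 4 / R\<^sup>2 * (u x)\<^sup>2" for x
      proof (cases "norm x \<le> R / 2")
        case True
        then have "u1 x = u x"
          by (simp add: u1_def \<theta>_def cut_angle_inside[OF R(1)])
        then show ?thesis by simp
      next
        case False
        then have "(R / 2)\<^sup>2 \<le> (norm x)\<^sup>2" using R by (intro power_mono) auto
        then have "(u x)\<^sup>2 / (norm x)\<^sup>2 \<le> (u x)\<^sup>2 / (R / 2)\<^sup>2"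
          using R by (intro divide_left_mono mult_pos_pos) (auto intro: less_le_trans[of 0 "(R/2)\<^sup>2"])
        then show ?thesis by (simp add: power_divide mult.commute add_increasing)
      qed
      note ih = test_functions_integrable_hardy
      have "H u \<le> (LINT x|lborel. (u1 x)\<^sup>2 / (norm x)\<^sup>2 + 4 / R\<^sup>2 * (u x)\<^sup>2)"
        unfolding H_def
        by (rule integral_mono)
          (intro Bochner_Integration.integrable_add integrable_mult_right ih[OF u1 \<open>0 \<notin> \<Omega>\<close>] ih[OF u \<open>0 \<notin> \<Omega>\<close>] iu hardy_pt)+
      also have "\<dots> = H u1 + 4 / R\<^sup>2 * I"
        unfolding H_def I_def using ih[OF u1 \<open>0 \<notin> \<Omega>\<close>] iu by simp
      finally have hardy: "H u \<le> H u1 + 4 / R\<^sup>2 * I" .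
      \<comment> \<open>The exponents satisfy \<open>q * s = 2\<close>, so \<open>c = sqrt 2 powr q\<close> turns into 2; another 2 stems from splitting
        the power of a sum, which explains the division by 4 in \<open>C'\<close>.\<close>
      define c where "c = sqrt 2 powr q"
      have X_le_1: "X1 (norm x / (3 * D)) powr p \<le> 1" and X_mono: "x \<in> \<Omega>' \<Longrightarrow> X1 (norm x / (3 * D)) powr p \<le> X1 (norm x / (3 * D')) powr p"
        if x: "x \<in> \<Omega>" for x
      proof -
        have "x \<noteq> 0" using x \<open>0 \<notin> \<Omega>\<close> by auto
        then have t: "0 < norm x / (3 * D)" "norm x / (3 * D) < 1"
          using le_D[OF x] \<open>D > 0\<close> by auto
        show "X1 (norm x / (3 * D)) powr p \<le> 1"
          using X1_bounds[OF t] \<open>p \<ge> 0\<close> powr_mono2[of p "X1 (norm x / (3 * D))" 1] by simp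
        assume "x \<in> \<Omega>'"
        then have "norm x / (3 * D') < 1"
          using le_D' D'(1) by fastforce
        moreover have "norm x / (3 * D) \<le> norm x / (3 * D')"
          using D' RD by (intro divide_left_mono) auto
        ultimately have "X1 (norm x / (3 * D)) \<le> X1 (norm x / (3 * D'))"
          using t by (intro X1_mono)
        then show "X1 (norm x / (3 * D)) powr p \<le> X1 (norm x / (3 * D')) powr p"
          using X1_bounds[OF t] \<open>p \<ge> 0\<close> by (intro powr_mono2) auto
      qed
      have sob_pt: "X1 (norm x / (3 * D)) powr p * \<bar>u x\<bar> powr q
          \<le> c * (X1 (norm x / (3 * D')) powr p * \<bar>u1 x\<bar> powr q + \<bar>u2 x\<bar> powr q)" for x
      proof (cases "x \<in> \<Omega>")
        case True
        define X where "X = X1 (norm x / (3 * D)) powr p"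
        have "X * \<bar>u x\<bar> powr q \<le> X * (c * (\<bar>u1 x\<bar> powr q + \<bar>u2 x\<bar> powr q))"
          unfolding c_def u1_def u2_def by (intro mult_left_mono powr_le_cos_sin qs(1)) (simp add: X_def)
        also have "\<dots> = c * (X * \<bar>u1 x\<bar> powr q + X * \<bar>u2 x\<bar> powr q)"
          by (simp add: algebra_simps)
        also have "\<dots> \<le> c * (X1 (norm x / (3 * D')) powr p * \<bar>u1 x\<bar> powr q + 1 * \<bar>u2 x\<bar> powr q)"
        proof (intro mult_left_mono add_mono)
          show "X * \<bar>u1 x\<bar> powr q \<le> X1 (norm x / (3 * D')) powr p * \<bar>u1 x\<bar> powr q"
          proof (cases "u1 x = 0")
            case False
            then have "x \<in> \<Omega>'" using u1' not_in_supp[of x u1] by (auto simp: test_functions_iff)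
            then show ?thesis unfolding X_def by (intro mult_right_mono X_mono[OF True]) auto
          qed simp
          show "X * \<bar>u2 x\<bar> powr q \<le> 1 * \<bar>u2 x\<bar> powr q"
            unfolding X_def by (intro mult_right_mono X_le_1[OF True]) simp
        qed (simp add: c_def)
        finally show ?thesis by (simp add: X_def)
      next
        case False
        then have "u x = 0" using u not_in_supp[of x u] by (auto simp: test_functions_iff)
        then show ?thesis by (simp add: u1_def u2_def)
      qed
      have iW1: "integrable lborel (\<lambda>x. X1 (norm x / (3 * D')) powr p * \<bar>u1 x\<bar> powr q)"
        by (rule test_functions_integrable_weighted[OF u1' dom'(1) D'(1) le_D' qs(1)])
      have iW: "integrable lborel (\<lambda>x. X1 (norm x / (3 * D)) powr p * \<bar>u x\<bar> powr q)"
        by (rule test_functions_integrable_weighted[OF u \<open>0 \<notin> \<Omega>\<close> \<open>D > 0\<close> le_D qs(1)])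
      have iJ: "integrable lborel (\<lambda>x. \<bar>u2 x\<bar> powr q)"
        by (rule test_functions_integrable_powr[OF u2 qs(1)])
      have "W D u \<le> (LINT x|lborel. c * (X1 (norm x / (3 * D')) powr p * \<bar>u1 x\<bar> powr q + \<bar>u2 x\<bar> powr q))"
        unfolding W_def
        by (rule integral_mono[OF iW _ sob_pt]) (intro integrable_mult_right Bochner_Integration.integrable_add iW1 iJ)
      also have "\<dots> = c * (W D' u1 + J)"
        unfolding W_def J_def using iW1 iJ by simp
      finally have "W D u \<le> c * (W D' u1 + J)" .
      moreover have "W D u \<ge> 0" "W D' u1 \<ge> 0" "J \<ge> 0"
        unfolding W_def J_def by simp_all
      ultimately have "W D u powr s \<le> (c * (W D' u1 + J)) powr s"
        using qs by (intro powr_mono2) auto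
      also have "\<dots> = c powr s * (W D' u1 + J) powr s"
        by (rule powr_mult)
      also have "c powr s = 2"
        unfolding c_def powr_powr qs(4) by simp
      also have "2 * (W D' u1 + J) powr s \<le> 2 * (2 * (W D' u1 powr s + J powr s))"
        using \<open>W D' u1 \<ge> 0\<close> \<open>J \<ge> 0\<close> qs by (intro mult_left_mono powr_add_le_two_times) auto
      finally have "C' * W D u powr s \<le> C' * (2 * (2 * (W D' u1 powr s + J powr s)))"
        using C'(1) by (intro mult_left_mono) auto
      also have "\<dots> = 4 * C' * W D' u1 powr s + 4 * C' * J powr s"
        by (simp add: algebra_simps)
      also have "\<dots> \<le> C * W D' u1 powr s + S * J powr s"
        using C' by (intro add_mono mult_right_mono) auto
      finally have sob: "C' * W D u powr s \<le> C * W D' u1 powr s + S * J powr s" .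
      have ineq1: "n\<^sup>2 / 4 * H u1 + C * W D' u1 powr s \<le> G u1"
        using hs'[unfolded hardy_sobolev_ineq_iff, rule_format, OF u1']
        unfolding H_def W_def G_def D'_def q_def s_def n(1) by simp
      have ineq2: "S * J powr s \<le> G u2"
        unfolding J_def G_def by (rule S[OF u2'])
      have "n\<^sup>2 / 4 * H u \<le> n\<^sup>2 / 4 * (H u1 + 4 / R\<^sup>2 * I)"
        using hardy by (intro mult_left_mono) auto
      also have "\<dots> = n\<^sup>2 / 4 * H u1 + n\<^sup>2 / R\<^sup>2 * I"
        by (simp add: algebra_simps)
      finally have "n\<^sup>2 / 4 * H u + C' * W D u powr s \<le> G u + (L / R\<^sup>2 * I + n\<^sup>2 / R\<^sup>2 * I)"
        using sob ineq1 ineq2 grads by linarith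
      also have "L / R\<^sup>2 * I + n\<^sup>2 / R\<^sup>2 * I = lam / \<rho>\<^sup>2 * I"
        by (simp add: lam_def R_def power_mult_distrib add_divide_distrib distrib_right)
      finally show "n\<^sup>2 / 4 * (LINT x|lborel. (u x)\<^sup>2 / (norm x)\<^sup>2)
         + C' * (LINT x|lborel. X1 (norm x / (3 * sup_norm_on \<Omega>)) powr p * \<bar>u x\<bar> powr (2 * real CARD('n) / (real CARD('n) - 2)))
             powr ((real CARD('n) - 2) / real CARD('n))
        \<le> (LINT x|lborel. (norm (grad u x))\<^sup>2) + lam / \<rho>\<^sup>2 * (LINT x|lborel. (u x)\<^sup>2)"
        unfolding H_def W_def G_def I_def D_def q_def s_def n(1) .
    qed
  qed
  show ?thesis
    by (rule exI[of _ lam], intro conjI \<open>lam > 0\<close>, rule exI[of _ C'], intro conjI \<open>C' > 0\<close> allI impI main)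
qed

theorem theorem9:
  fixes \<sigma> n :: real
  assumes dim: "CARD('n::{finite,linorder}) \<ge> 3" and n: "n = real CARD('n::{finite,linorder})"
    and \<sigma>_pos: "\<sigma> > 0"
    and \<sigma>: "\<exists>C>0. \<forall>(\<Omega> :: (real ^ 'n::{finite,linorder}) set) \<rho>.
          bounded_domain \<Omega> \<and> 0 \<in> frontier \<Omega> \<and> exterior_ball_at_0 \<Omega> \<rho> \<and>
          \<rho> \<ge> sup_norm_on \<Omega> / \<sigma> \<longrightarrow>
          hardy_sobolev_ineq \<Omega> 0 (n\<^sup>2 / 4) ((2 * n - 2) / (n - 2)) C"
  shows "\<exists>lam>0. \<exists>C>0. \<forall>(\<Omega> :: (real ^ 'n::{finite,linorder}) set) \<rho>.
          bounded_domain \<Omega> \<and> 0 \<in> frontier \<Omega> \<and> \<rho> > 0 \<and> exterior_ball_at_0 \<Omega> \<rho> \<and>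
          \<rho> < sup_norm_on \<Omega> / \<sigma> \<longrightarrow>
          hardy_sobolev_ineq \<Omega> (lam / \<rho>\<^sup>2) (n\<^sup>2 / 4) ((2 * n - 2) / (n - 2)) C \<and>
          (interior_ball_at_0 \<Omega> \<longrightarrow>
            (\<forall>c > n\<^sup>2 / 4. \<forall>C'>0.
               \<not> hardy_sobolev_ineq \<Omega> (lam / \<rho>\<^sup>2) c ((2 * n - 2) / (n - 2)) C') \<and>
            (\<forall>p < (2 * n - 2) / (n - 2). \<forall>C'>0.
               \<not> hardy_sobolev_ineq \<Omega> (lam / \<rho>\<^sup>2) (n\<^sup>2 / 4) p C'))"
proof -
  define P where "P = (2 * n - 2) / (n - 2)"
  have n3: "n \<ge> 3" using dim n by simp
  then have "P \<ge> 0" by (simp add: P_def)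
  obtain C where "C > 0" and hyp: "\<And>(\<Omega> :: (real, 'n) vec set) \<rho>. bounded_domain \<Omega> \<Longrightarrow> 0 \<in> frontier \<Omega> \<Longrightarrow>
        exterior_ball_at_0 \<Omega> \<rho> \<Longrightarrow> \<rho> \<ge> sup_norm_on \<Omega> / \<sigma> \<Longrightarrow> hardy_sobolev_ineq \<Omega> 0 (n\<^sup>2 / 4) P C"
    using \<sigma> unfolding P_def by blast
  have "\<exists>lam>0. \<exists>C'>0. \<forall>(\<Omega> :: (real, 'n) vec set) \<rho>. bounded_domain \<Omega> \<longrightarrow> 0 \<in> frontier \<Omega> \<longrightarrow> \<rho> > 0 \<longrightarrow>
        exterior_ball_at_0 \<Omega> \<rho> \<longrightarrow> \<rho> < sup_norm_on \<Omega> / \<sigma> \<longrightarrow> hardy_sobolev_ineq \<Omega> (lam / \<rho>\<^sup>2) (n\<^sup>2 / 4) P C'"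
    by (rule hardy_sobolev_localization[OF n n3 \<open>P \<ge> 0\<close> \<open>C > 0\<close> \<sigma>_pos]) (rule hyp)
  then obtain lam C' where "lam > 0" "C' > 0" and ineq: "\<And>(\<Omega> :: (real, 'n) vec set) \<rho>. bounded_domain \<Omega> \<Longrightarrow> 0 \<in> frontier \<Omega> \<Longrightarrow> \<rho> > 0 \<Longrightarrow>
        exterior_ball_at_0 \<Omega> \<rho> \<Longrightarrow> \<rho> < sup_norm_on \<Omega> / \<sigma> \<Longrightarrow> hardy_sobolev_ineq \<Omega> (lam / \<rho>\<^sup>2) (n\<^sup>2 / 4) P C'"
    by blast
  show ?thesis
    unfolding P_def[symmetric]
  proof (rule exI[of _ lam], intro conjI \<open>lam > 0\<close>, rule exI[of _ C'], intro conjI \<open>C' > 0\<close> allI impI; (elim conjE)?)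
    fix \<Omega> :: "(real, 'n) vec set" and \<rho>
    assume dom: "bounded_domain \<Omega>" "0 \<in> frontier \<Omega>" "\<rho> > 0" "exterior_ball_at_0 \<Omega> \<rho>"
    have \<mu>: "lam / \<rho>\<^sup>2 \<ge> 0" using \<open>lam > 0\<close> by simp
    have \<Omega>: "bounded \<Omega>" "0 \<notin> \<Omega>"
      using dom(1) zero_notin_domain[OF dom(1,2)] by (auto simp: bounded_domain_def)
    show "hardy_sobolev_ineq \<Omega> (lam / \<rho>\<^sup>2) (n\<^sup>2 / 4) P C'" if "\<rho> < sup_norm_on \<Omega> / \<sigma>"
      by (rule ineq[OF dom that])
    fix c q B :: real
    assume int: "interior_ball_at_0 \<Omega>" and "B > 0"
    obtain r where r: "r > 0" "ball (r *\<^sub>R axis (Max UNIV) 1) r \<subseteq> \<Omega>"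
      using interior_ball_along_e_last[OF dom(4,3) int] by blast
    show "\<not> hardy_sobolev_ineq \<Omega> (lam / \<rho>\<^sup>2) c P B" if "c > n\<^sup>2 / 4"
      using hardy_constant_sharp[OF dim \<Omega> r \<mu> that[unfolded n] \<open>B > 0\<close>] .
    show "\<not> hardy_sobolev_ineq \<Omega> (lam / \<rho>\<^sup>2) (n\<^sup>2 / 4) q B" if "q < P"
      using weight_exponent_sharp[OF dim \<Omega> r \<mu> that[unfolded P_def n] \<open>B > 0\<close>] unfolding n .
  qed
qed

end
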